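(* Let $t_0 \in \{0, 4, 5\}$ and let $t \ge 1$ be an integer. If $t_0 \in\{4,5\}$ let $s = -1$; if $t_0 = 0$ let $s \in \{-1,1\}$. Put $T = t_0 + 9t$, let $M$ be the square-free part of $T^2 - 4s$, and $E_s(T) = \frac12(T + \sqrt{T^2 - 4s})$, a unit of norm $s$ of $\mathbb{Q}(\sqrt M)$. Then the class number of the imaginary quadratic field $\mathbb{Q}(\sqrt{-3M})$ is divisible by $3$, unless $E_s(T) \in \langle \varepsilon_M^3 \rangle$. Moreover, let $M$ be the square-free part of $81 t^2 - 1$ with $t \ge 1$, $t \equiv 2$ or $5 \pmod 7$, or the square-free part of $81 t^2 + 1$ with $t \ge 1$, $t \equiv 3$ or $4 \pmod 7$. Then the class number of $\mathbb{Q}(\sqrt{-3M})$ is divisible by $3$.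
   Context: For a square-free integer $M \ge 2$, $\varepsilon_M > 1$ is the fundamental unit of $\mathbb{Q}(\sqrt M)$. The square-free part of a nonzero integer $n$ is the unique square-free $M$ with $n = M r^2$, $r\ge1$. *)

theory Defs
  imports "HOL-Computational_Algebra.Computational_Algebra"
begin

definition sqfree_part :: "int \<Rightarrow> int" where
  "sqfree_part n = (THE M. squarefree M \<and> (\<exists>r::int. r \<ge> 1 \<and> n = M * r^2))"

definition algebraic_integer :: "complex \<Rightarrow> bool" where
  "algebraic_integer x \<longleftrightarrow>
     (\<exists>p :: int poly. lead_coeff p = 1 \<and> poly (map_poly of_int p) x = 0)"

definition quad_field :: "int \<Rightarrow> complex set" where
  "quad_field d = {of_rat a + of_rat b * csqrt (of_int d) | a b. True}"

definition quad_ints :: "int \<Rightarrow> complex set" where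
  "quad_ints d = {x \<in> quad_field d. algebraic_integer x}"

definition is_ideal :: "complex set \<Rightarrow> complex set \<Rightarrow> bool" where
  "is_ideal R I \<longleftrightarrow> I \<subseteq> R \<and> 0 \<in> I \<and> (\<forall>x\<in>I. \<forall>y\<in>I. x + y \<in> I)
     \<and> (\<forall>r\<in>R. \<forall>x\<in>I. r * x \<in> I)"

definition nonzero_ideals :: "int \<Rightarrow> complex set set" where
  "nonzero_ideals d = {I. is_ideal (quad_ints d) I \<and> I \<noteq> {0}}"

definition ideal_equiv :: "int \<Rightarrow> (complex set \<times> complex set) set" where
  "ideal_equiv d = {(I, J). I \<in> nonzero_ideals d \<and> J \<in> nonzero_ideals d \<and>
     (\<exists>\<alpha>\<in>quad_ints d - {0}. \<exists>\<beta>\<in>quad_ints d - {0}.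
        (\<lambda>x. \<alpha> * x) ` I = (\<lambda>x. \<beta> * x) ` J)}"

definition class_number :: "int \<Rightarrow> nat" where
  "class_number d = card (nonzero_ideals d // ideal_equiv d)"

definition is_unit_in :: "int \<Rightarrow> complex \<Rightarrow> bool" where
  "is_unit_in d u \<longleftrightarrow> u \<in> quad_ints d \<and> (\<exists>v \<in> quad_ints d. u * v = 1)"

definition fund_unit :: "int \<Rightarrow> real" where
  "fund_unit M = (THE e. e > 1 \<and> is_unit_in M (of_real e) \<and>
     (\<forall>u. u > 1 \<and> is_unit_in M (of_real u) \<longrightarrow> e \<le> u))"

end

theory Submission
  imports Defs
begin

text \<open>
  If $E_s(T)$ is not a cube in $\langle \varepsilon_M \rangle$, then $y^3 - 3sy - T$ has no rational root, since an
  integral root $y$ yields the unit $\theta = \frac12(y + \sqrt{y^2 - 4s})$ with $\theta^3 = E_s(T)$. The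
  discriminant of this cubic is $-27(T^2 - 4s)$, so its splitting field $L$ is cyclic of degree 3 over
  $F = \mathbb{Q}(\sqrt{-3M})$, and the condition on $T$ modulo 9 makes $L/F$ unramified.

  Class field theory is avoided by means of Hilbert's Theorem 94. Let $\sigma$ generate the Galois group. A unit
  $u$ of $L$ of norm 1 is $\sigma\alpha/\alpha$ with $\alpha$ integral; as $L/F$ is unramified, Galois descent gives
  $(\alpha) = \mathfrak{a}\mathcal{O}_L$ for an ideal $\mathfrak{a}$ of $F$, and $\mathfrak{a}^3$ is principal. If 3 does
  not divide the class number, then $\mathfrak{a}$ is principal and $u = \sigma v/v$ for a unit $v$, which may be
  taken of norm 1. Applying this twice, every unit of norm 1 is a cube of such a unit, because
  $(\sigma - 1)^2 = -3\sigma$ there. Hence all units of norm 1 are roots of unity, which contradicts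
  Dirichlet's pigeonhole argument applied to the cubic field.

  Divisibility of the class number uses neither its finiteness nor the group structure: multiplication by
  $\mathfrak{a}$ permutes the classes with order 3 and without fixed points, and the cardinality of an infinite
  set is 0.
\<close>

section \<open>Almost integral elements and rings of quadratic integers\<close>

text \<open>The cubic comes from a cube root \<theta> of E = E_s(T): since E + s/E = T, cubing y =
  \<theta> + s/\<theta> gives y^3 = 3sy + T. After adjoining sqrt(-3), L/F becomes the Kummer
  extension generated by \<theta>; this is Scholz's reflection between Q(sqrt M) and Q(sqrt(-3M)).

  Unramifiedness is encoded without prime ideals. A prime that ramifies in a cyclic cubic extension
  does so totally, hence all conjugates y, y', y'' of an integer agree modulo the prime above it,
  which then contains y^2 + y'^2 + y''^2 - yy' - yy'' - y'y''. Coprime values of this form therefore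
  exclude ramification. At a root of the cubic the value is 9s, so only 3 is critical. There the
  cubic is (y - n)^3 modulo 3 with n = 0 or 1, and T modulo 9 makes (y - n)^2/3 an integer whose
  conjugates are not all congruent.

  The residue 5 is reduced to 4 by y -> -y. The last two claims use T = 18t and exclude a root
  modulo 7, so they need no knowledge of the fundamental unit.\<close>

locale csubring =
  fixes A :: "complex set"
  assumes one_closed: "1 \<in> A"
    and diff_closed: "x \<in> A \<Longrightarrow> y \<in> A \<Longrightarrow> x - y \<in> A"
    and mult_closed: "x \<in> A \<Longrightarrow> y \<in> A \<Longrightarrow> x * y \<in> A"
begin

lemma zero_closed: "0 \<in> A"
  using diff_closed[OF one_closed one_closed] by simp

lemma uminus_closed: "x \<in> A \<Longrightarrow> - x \<in> A"
  using diff_closed[OF zero_closed, of x] by simp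

lemma add_closed: "x \<in> A \<Longrightarrow> y \<in> A \<Longrightarrow> x + y \<in> A"
  using diff_closed[of x "- y"] uminus_closed[of y] by simp

lemma power_closed: "x \<in> A \<Longrightarrow> x ^ n \<in> A"
  by (induction n) (auto intro: one_closed mult_closed)

lemma sum_closed: "(\<And>i. i \<in> I \<Longrightarrow> f i \<in> A) \<Longrightarrow> sum f I \<in> A"
  by (induction I rule: infinite_finite_induct) (auto intro: zero_closed add_closed)

lemma of_nat_closed: "of_nat n \<in> A"
  by (induction n) (auto intro: zero_closed one_closed add_closed)

lemma of_int_closed: "of_int n \<in> A"
  by (cases n) (auto intro: of_nat_closed uminus_closed simp del: of_nat_Suc)

lemma numeral_closed: "numeral n \<in> A"
  using of_int_closed[of "numeral n"] by simp

lemmas closed = one_closed zero_closed diff_closed mult_closed uminus_closed add_closed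
  power_closed sum_closed of_nat_closed of_int_closed numeral_closed

end

text \<open>Complete integral closure with integer denominators: all powers of \<open>z\<close>
  share one denominator. That this is a ring follows from the binomial theorem and the product of
  two denominators, whereas roots of monic polynomials would call for resultants or determinants. It
  serves for \<open>OF\<close> and for the integers \<open>R\<close> of the cubic extension
  alike.\<close>

definition almost_int :: "complex set \<Rightarrow> complex set" where
  "almost_int A = {z. \<exists>m::int. m \<noteq> 0 \<and> (\<forall>k::nat. of_int m * z ^ k \<in> A)}"

context csubring
begin

lemma subset_almost_int: "A \<subseteq> almost_int A"
  unfolding almost_int_def using power_closed by (force intro: exI[of _ 1])

lemma csubring_almost_int: "csubring (almost_int A)"
proof
  show "1 \<in> almost_int A" using subset_almost_int one_closed by blast
next
  fix x y assume "x \<in> almost_int A" "y \<in> almost_int A"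
  then obtain m n :: int where m: "m \<noteq> 0" "\<And>k. of_int m * x ^ k \<in> A"
    and n: "n \<noteq> 0" "\<And>k. of_int n * y ^ k \<in> A"
    unfolding almost_int_def by blast
  have "of_int (m * n) * (x * y) ^ k \<in> A" for k
    using mult_closed[OF m(2)[of k] n(2)[of k]] by (simp add: power_mult_distrib mult_ac)
  then show "x * y \<in> almost_int A"
    unfolding almost_int_def using m n by (intro CollectI exI[of _ "m * n"]) simp
  have "of_int (m * n) * (x - y) ^ k \<in> A" for k
  proof -
    have "of_int (m * n) * (x - y) ^ k =
        (\<Sum>i\<le>k. of_nat (k choose i) * ((of_int m * x ^ i) * ((-1) ^ (k - i) * (of_int n * y ^ (k - i)))))"
      using binomial_ring[of x "- y" k]
      by (simp add: sum_distrib_left mult_ac power_minus[of y])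
    also have "\<dots> \<in> A"
      by (intro closed m n)
    finally show ?thesis .
  qed
  then show "x - y \<in> almost_int A"
    unfolding almost_int_def using m n by (intro CollectI exI[of _ "m * n"]) simp
qed

text \<open>The monic relation lowers every exponent from \<open>n\<close> on, so a denominator of
  the first \<open>n\<close> powers serves for all of them.\<close>

lemma integral_imp_almost_int:
  assumes "m \<noteq> 0" "\<And>i. i < n \<Longrightarrow> of_int m * z ^ i \<in> A"
    and eq: "z ^ n = (\<Sum>i<n. c i * z ^ i)" and c: "\<And>i. i < n \<Longrightarrow> c i \<in> A"
  shows "z \<in> almost_int A"
proof -
  have "of_int m * z ^ k \<in> A" for k
  proof (induction k rule: less_induct)
    case (less k)
    show ?case
    proof (cases "k < n")
      case False
      then have "of_int m * z ^ k = of_int m * (z ^ n * z ^ (k - n))"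
        by (simp flip: power_add)
      also have "\<dots> = (\<Sum>i<n. c i * (of_int m * z ^ (i + (k - n))))"
        by (simp add: eq sum_distrib_left sum_distrib_right power_add mult_ac)
      also have "\<dots> \<in> A"
        using False by (intro sum_closed mult_closed c less.IH) auto
      finally show ?thesis .
    qed (use assms in auto)
  qed
  then show ?thesis unfolding almost_int_def using assms(1) by blast
qed

end

text \<open>The conductor \<open>m\<close> multiplies into the denominator; with
  \<open>m = 1\<close> this is monotonicity.\<close>

lemma almost_int_conductor:
  assumes "m \<noteq> 0" "\<And>z. z \<in> B \<Longrightarrow> of_int m * z \<in> A"
  shows "almost_int B \<subseteq> almost_int A"
proof
  fix z assume "z \<in> almost_int B"
  then obtain n :: int where n: "n \<noteq> 0" "\<And>k. of_int n * z ^ k \<in> B"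
    unfolding almost_int_def by blast
  have "of_int (m * n) * z ^ k \<in> A" for k
    using assms(2)[OF n(2)[of k]] by (simp add: mult_ac)
  then show "z \<in> almost_int A"
    unfolding almost_int_def using n assms by (intro CollectI exI[of _ "m * n"]) simp
qed

text \<open>The integers are completely integrally closed: for a/b in lowest terms, every power of b
  divides the fixed \<open>m\<close>.\<close>

lemma Rats_almost_int:
  fixes q :: complex
  assumes "q \<in> \<rat>" and "m \<noteq> 0" and "\<And>k. of_int m * q ^ k \<in> \<int>"
  shows "q \<in> \<int>"
proof -
  obtain r where q: "q = of_rat r" using assms(1) by (auto elim: Rats_cases)
  obtain a b :: int where ab: "r = Rat.Fract a b" "b > 0" "coprime a b"
    by (cases r) auto
  have qab: "q = of_int a / of_int b"
    using ab by (simp add: q of_rat_rat)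
  have "b ^ k dvd m" for k
  proof -
    obtain j :: int where j: "of_int m * q ^ k = of_int j"
      using assms(3)[of k] by (auto elim: Ints_cases)
    have "complex_of_int (m * a ^ k) = of_int (j * b ^ k)"
      using j ab by (simp add: qab field_simps)
    then have "m * a ^ k = j * b ^ k" using of_int_eq_iff by blast
    then have "b ^ k dvd m * a ^ k" by simp
    moreover have "coprime (b ^ k) (a ^ k)" using ab(3) by (simp add: coprime_commute)
    ultimately show ?thesis by (simp add: coprime_dvd_mult_left_iff)
  qed
  have "b = 1"
  proof (rule ccontr)
    assume "b \<noteq> 1"
    then have "b \<ge> 2" using ab by simp
    \<comment> \<open>The exponent |m| is large enough, since 2^|m| already exceeds |m|.\<close>
    have "b ^ nat \<bar>m\<bar> \<le> \<bar>m\<bar>"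
      using \<open>b ^ nat \<bar>m\<bar> dvd m\<close> assms(2) by (intro zdvd_imp_le) auto
    moreover have "\<bar>m\<bar> < 2 ^ nat \<bar>m\<bar>"
      using of_nat_less_two_power[of "nat \<bar>m\<bar>", where ?'a = int] by simp
    moreover have "(2::int) ^ nat \<bar>m\<bar> \<le> b ^ nat \<bar>m\<bar>"
      using \<open>b \<ge> 2\<close> by (intro power_mono) auto
    ultimately show False by simp
  qed
  then show ?thesis by (simp add: qab)
qed

section \<open>Integers of a quadratic field\<close>

lemma algebraic_integerI_quadratic:
  assumes "z ^ 2 - of_int t * z + of_int n = 0"
  shows "algebraic_integer z"
  unfolding algebraic_integer_def
  by (intro exI[of _ "[:n, -t, 1:]"]) (use assms in \<open>simp add: algebra_simps power2_eq_square map_poly_pCons\<close>)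

text \<open>The order Z[sqrt d], an explicit lattice against which denominators are measured; for
  square-free \<open>d\<close> it has index 1 or 2 in the ring of integers.\<close>

definition quad_order :: "int \<Rightarrow> complex set" where
  "quad_order d = {of_int a + of_int b * csqrt (of_int d) | a b. True}"

lemma csubring_quad_order: "csubring (quad_order d)"
proof
  show "1 \<in> quad_order d"
    unfolding quad_order_def by (rule CollectI, rule exI[of _ 1], rule exI[of _ 0]) simp
next
  fix x y assume "x \<in> quad_order d" "y \<in> quad_order d"
  then obtain a b a' b' where xy: "x = of_int a + of_int b * csqrt (of_int d)"
    "y = of_int a' + of_int b' * csqrt (of_int d)" unfolding quad_order_def by blast
  show "x - y \<in> quad_order d" unfolding quad_order_def
    by (rule CollectI, rule exI[of _ "a - a'"], rule exI[of _ "b - b'"]) (simp add: xy algebra_simps)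
  have "x * y = of_int (a * a') + of_int (b * b') * (csqrt (of_int d))\<^sup>2
      + of_int (a * b' + a' * b) * csqrt (of_int d)"
    by (simp add: xy algebra_simps power2_eq_square del: power2_csqrt)
  also have "\<dots> = of_int (a * a' + b * b' * d) + of_int (a * b' + a' * b) * csqrt (of_int d)"
    by simp
  finally show "x * y \<in> quad_order d" unfolding quad_order_def by blast
qed

locale quad_number_field =
  fixes d :: int
  assumes squarefree_d: "squarefree d" and d_neq_1: "d \<noteq> 1"
begin

definition S :: complex where "S = csqrt (of_int d)"
abbreviation F :: "complex set" where "F \<equiv> quad_field d"
abbreviation OF :: "complex set" where "OF \<equiv> quad_ints d"

lemma d_nonzero: "d \<noteq> 0"
  using squarefree_d by (metis not_squarefree_0)

lemma S_square: "S * S = of_int d"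
  using power2_csqrt[of "of_int d"] by (simp add: power2_eq_square S_def)

lemmas quad_order_altdef = quad_order_def[of d, folded S_def]

lemma S_irrational: "S \<notin> \<rat>"
proof
  assume "S \<in> \<rat>"
  moreover have "algebraic_int S"
    by (rule algebraic_int_root[of "of_int d" "monom 1 2"])
       (auto simp: poly_monom degree_monom_eq S_square power2_eq_square)
  ultimately have "S \<in> \<int>" by (metis rational_algebraic_int_is_int)
  then obtain j :: int where "S = of_int j" by (auto elim: Ints_cases)
  with S_square have "complex_of_int (j * j) = of_int d" by simp
  then have j: "j * j = d" using of_int_eq_iff by blast
  then have "j ^ 2 dvd d" by (auto simp: power2_eq_square)
  then have "is_unit j" using squarefree_d by (auto simp: squarefree_def)
  then have "j = 1 \<or> j = -1" by (simp add: abs_if split: if_splits)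
  then have "j * j = 1" by auto
  then show False using j d_neq_1 by simp
qed

lemma rational_S_unique:
  assumes "a \<in> \<rat>" "b \<in> \<rat>" "a' \<in> \<rat>" "b' \<in> \<rat>" "a + b * S = a' + b' * S"
  shows "a = a'" "b = b'"
proof -
  have e: "(b - b') * S = a' - a" using assms(5) by (simp add: algebra_simps)
  show "b = b'"
  proof (rule ccontr)
    assume "b \<noteq> b'"
    then have "S = (a' - a) / (b - b')" using e by (simp add: field_simps)
    then show False using S_irrational assms(1-4) by (auto intro: Rats_diff Rats_divide)
  qed
  then show "a = a'" using assms(5) by simp
qed

lemma quad_field_iff: "z \<in> F \<longleftrightarrow> (\<exists>a\<in>\<rat>. \<exists>b\<in>\<rat>. z = a + b * S)"
  unfolding quad_field_def S_def by (auto simp: Rats_def)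

lemma quad_fieldI: "a \<in> \<rat> \<Longrightarrow> b \<in> \<rat> \<Longrightarrow> a + b * S \<in> F"
  unfolding quad_field_iff by blast

lemma csubring_F: "csubring F"
proof
  show "1 \<in> F" using quad_fieldI[of 1 0] by simp
next
  fix x y assume "x \<in> F" "y \<in> F"
  then obtain a b a' b' where *: "a \<in> \<rat>" "b \<in> \<rat>" "a' \<in> \<rat>" "b' \<in> \<rat>"
    and xy: "x = a + b * S" "y = a' + b' * S" unfolding quad_field_iff by blast
  have "x - y = (a - a') + (b - b') * S" by (simp add: xy algebra_simps)
  also have "\<dots> \<in> F" using * by (intro quad_fieldI Rats_diff)
  finally show "x - y \<in> F" .
  have "x * y = (a * a' + b * b' * (S * S)) + (a * b' + a' * b) * S"
    by (simp only: xy) (simp add: algebra_simps)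
  also have "\<dots> \<in> F" using * unfolding S_square
    by (intro quad_fieldI Rats_add Rats_mult Rats_of_int)
  finally show "x * y \<in> F" .
qed

lemma Rats_subset_F: "q \<in> \<rat> \<Longrightarrow> q \<in> F"
  using quad_fieldI[of q 0] by simp

lemma S_in_F: "S \<in> F"
  using quad_fieldI[of 0 1] by simp

lemma almost_int_quad_order_subset: "almost_int (quad_order d) \<subseteq> F"
proof
  fix z assume "z \<in> almost_int (quad_order d)"
  then obtain m :: int where m: "m \<noteq> 0" "of_int m * z ^ 1 \<in> quad_order d"
    unfolding almost_int_def by blast
  then obtain a b where ab: "of_int m * z = of_int a + of_int b * S"
    unfolding quad_order_altdef by auto
  then have "z = of_int a / of_int m + (of_int b / of_int m) * S"
    using m by (simp add: field_simps)
  also have "\<dots> \<in> F" by (intro quad_fieldI Rats_divide Rats_of_int)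
  finally show "z \<in> F" .
qed

text \<open>Here \<open>d\<close> may be positive, so complex conjugation need not be the
  conjugation of F; the conjugate power is carried along explicitly.\<close>

lemma power_conjugates:
  assumes "a \<in> \<rat>" "b \<in> \<rat>"
  shows "\<exists>p\<in>\<rat>. \<exists>q\<in>\<rat>. (a + b * S) ^ k = p + q * S \<and> (a - b * S) ^ k = p - q * S"
proof (induction k)
  case 0
  then show ?case by (intro bexI[of _ 1] bexI[of _ 0]) auto
next
  case (Suc k)
  then obtain p q where pq: "p \<in> \<rat>" "q \<in> \<rat>" "(a + b * S) ^ k = p + q * S" "(a - b * S) ^ k = p - q * S"
    by blast
  have "(a + b * S) ^ Suc k = (a * p + b * q * (S * S)) + (a * q + b * p) * S"
    by (simp only: power_Suc pq) (simp add: algebra_simps)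
  moreover have "(a - b * S) ^ Suc k = (a * p + b * q * (S * S)) - (a * q + b * p) * S"
    by (simp only: power_Suc pq) (simp add: algebra_simps)
  moreover have "a * p + b * q * (S * S) \<in> \<rat>" "a * q + b * p \<in> \<rat>"
    unfolding S_square using assms pq by (auto intro!: Rats_add Rats_mult)
  ultimately show ?case by blast
qed

text \<open>If m z^k lies in Z[sqrt d], its norm m^2 N(z)^k is an integer. This holds for all k, so
  the rational number N(z) has bounded denominators in its powers and is an integer.\<close>

lemma almost_int_norm:
  assumes "a + b * S \<in> almost_int (quad_order d)" "a \<in> \<rat>" "b \<in> \<rat>"
  shows "a\<^sup>2 - b\<^sup>2 * of_int d \<in> \<int>"
proof -
  obtain m :: int where m: "m \<noteq> 0" "\<And>k. of_int m * (a + b * S) ^ k \<in> quad_order d"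
    using assms(1) unfolding almost_int_def by blast
  have "of_int (m * m) * (a\<^sup>2 - b\<^sup>2 * of_int d) ^ k \<in> \<int>" for k
  proof -
    obtain p q where pq: "p \<in> \<rat>" "q \<in> \<rat>" "(a + b * S) ^ k = p + q * S" "(a - b * S) ^ k = p - q * S"
      using power_conjugates[OF assms(2,3)] by blast
    obtain i j where ij: "of_int m * (a + b * S) ^ k = of_int i + of_int j * S"
      using m(2)[of k] unfolding quad_order_altdef by blast
    have "of_int m * p + of_int m * q * S = of_int i + of_int j * S"
      using ij pq(3) by (simp add: algebra_simps)
    from rational_S_unique[OF _ _ _ _ this] have mp: "of_int m * p = of_int i" "of_int m * q = of_int j"
      using pq by auto
    have "(a\<^sup>2 - b\<^sup>2 * of_int d) = (a + b * S) * (a - b * S)"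
      unfolding S_square[symmetric] by (simp add: algebra_simps power2_eq_square)
    then have "of_int (m * m) * (a\<^sup>2 - b\<^sup>2 * of_int d) ^ k
      = (of_int m * (p + q * S)) * (of_int m * (p - q * S))"
      by (simp add: power_mult_distrib pq)
    also have "\<dots> = (of_int m * p) * (of_int m * p) - (of_int m * q) * (of_int m * q) * (S * S)"
      by (simp add: algebra_simps)
    also have "\<dots> \<in> \<int>" unfolding mp S_square by (intro Ints_diff Ints_mult Ints_of_int)
    finally show ?thesis .
  qed
  note * = this
  have "a\<^sup>2 - b\<^sup>2 * of_int d \<in> \<rat>"
    using assms(2,3) by (intro Rats_diff Rats_mult Rats_power Rats_of_int)
  then show ?thesis
    by (rule Rats_almost_int[of _ "m * m"]) (use m(1) in simp, rule *)
qed

text \<open>The trace is a difference of norms: N(z + 1) - N(z) - 1 = 2a.\<close>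

lemma almost_int_trace:
  assumes "a + b * S \<in> almost_int (quad_order d)" "a \<in> \<rat>" "b \<in> \<rat>"
  shows "2 * a \<in> \<int>"
proof -
  interpret Q: csubring "quad_order d" by (rule csubring_quad_order)
  interpret A: csubring "almost_int (quad_order d)" by (rule Q.csubring_almost_int)
  have "(a + 1) + b * S \<in> almost_int (quad_order d)"
    using A.add_closed[OF assms(1) A.one_closed] by (simp add: algebra_simps)
  then have "(a + 1)\<^sup>2 - b\<^sup>2 * of_int d \<in> \<int>"
    by (rule almost_int_norm) (use assms in auto)
  then have "((a + 1)\<^sup>2 - b\<^sup>2 * of_int d) - (a\<^sup>2 - b\<^sup>2 * of_int d) - 1 \<in> \<int>"
    by (rule Ints_diff[OF Ints_diff[OF _ almost_int_norm[OF assms]] Ints_1])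
  then show ?thesis by (simp add: algebra_simps power2_eq_square)
qed

lemma clear_denominators: 
  assumes "z \<in> F"
  shows "\<exists>m::int. m \<noteq> 0 \<and> of_int m * z \<in> quad_order d"
proof -
  obtain p q :: rat where z: "z = of_rat p + of_rat q * S"
    using assms unfolding quad_field_def S_def by blast
  obtain a b where ab: "p = Rat.Fract a b" "b > 0" by (cases p) auto
  obtain a' b' where ab': "q = Rat.Fract a' b'" "b' > 0" by (cases q) auto
  have "of_int (b * b') * z = of_int (a * b') + of_int (a' * b) * S"
    using ab ab' by (simp add: z of_rat_rat field_simps)
  then have "of_int (b * b') * z \<in> quad_order d" unfolding quad_order_altdef by blast
  then show ?thesis using ab ab' by (intro exI[of _ "b * b'"]) auto
qed

text \<open>Integral trace and norm give a monic quadratic equation; conversely the finitely many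
  powers below the degree of a monic equation have a common denominator. This is what makes
  \<open>OF\<close>, defined by roots of monic polynomials, a ring.\<close>

lemma quad_ints_eq: "OF = almost_int (quad_order d)"
proof (intro equalityI subsetI)
  fix z assume z: "z \<in> almost_int (quad_order d)"
  then have zF: "z \<in> F" using almost_int_quad_order_subset by blast
  then obtain a b where ab: "a \<in> \<rat>" "b \<in> \<rat>" "z = a + b * S"
    unfolding quad_field_iff by blast
  obtain t where t: "2 * a = of_int t"
    using almost_int_trace[of a b] ab z by (auto elim: Ints_cases)
  obtain n where n: "a\<^sup>2 - b\<^sup>2 * of_int d = of_int n"
    using almost_int_norm[of a b] ab z by (auto elim: Ints_cases)
  have "z ^ 2 - of_int t * z + of_int n = 0"
    unfolding t[symmetric] n[symmetric] ab(3) S_square[symmetric]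
    by (simp add: algebra_simps power2_eq_square)
  then show "z \<in> OF" unfolding quad_ints_def using zF algebraic_integerI_quadratic by blast
next
  fix z assume z: "z \<in> OF"
  interpret Q: csubring "quad_order d" by (rule csubring_quad_order)
  from z obtain p :: "int poly" where p: "lead_coeff p = 1" "poly (map_poly of_int p) z = 0" and zF: "z \<in> F"
    unfolding quad_ints_def algebraic_integer_def by blast
  define n where "n = degree p"
  have "(\<Sum>i\<le>n. of_int (coeff p i) * z ^ i) = 0"
    using p(2) by (simp add: poly_altdef n_def coeff_map_poly degree_map_poly)
  then have eq: "z ^ n = (\<Sum>i<n. of_int (- coeff p i) * z ^ i)"
    using p(1) by (simp add: n_def lessThan_Suc_atMost[symmetric] sum_negf eq_neg_iff_add_eq_0 add.commute)
  interpret Fs: csubring F by (rule csubring_F)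
  have "\<exists>m::int. m \<noteq> 0 \<and> (\<forall>i<k. of_int m * z ^ i \<in> quad_order d)" for k
  proof (induction k)
    case 0
    show ?case by (intro exI[of _ 1]) auto
  next
    case (Suc k)
    then obtain m :: int where m: "m \<noteq> 0" "\<And>i. i < k \<Longrightarrow> of_int m * z ^ i \<in> quad_order d" by blast
    obtain m' :: int where m': "m' \<noteq> 0" "of_int m' * z ^ k \<in> quad_order d"
      using clear_denominators[OF Fs.power_closed[OF zF]] by blast
    have "of_int (m * m') * z ^ i \<in> quad_order d" if "i < Suc k" for i
    proof (cases "i = k")
      case True
      then show ?thesis using Q.mult_closed[OF Q.of_int_closed[of m] m'(2)] by (simp add: mult_ac)
    next
      case False
      then show ?thesis using that Q.mult_closed[OF Q.of_int_closed[of m'] m(2)[of i]] by (simp add: mult_ac)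
    qed
    then show ?case using m m' by (intro exI[of _ "m * m'"]) simp
  qed
  then obtain m :: int where m: "m \<noteq> 0" "\<And>i. i < n \<Longrightarrow> of_int m * z ^ i \<in> quad_order d" by blast
  show "z \<in> almost_int (quad_order d)"
    by (rule Q.integral_imp_almost_int[OF m eq _]) (assumption, rule Q.of_int_closed)
qed

lemma quad_order_subset: "quad_order d \<subseteq> OF"
  unfolding quad_ints_eq using csubring_quad_order csubring.subset_almost_int by blast

lemma csubring_OF: "csubring OF"
  unfolding quad_ints_eq by (rule csubring.csubring_almost_int[OF csubring_quad_order])

lemma quad_intsE:
  assumes "z \<in> OF"
  obtains a b t n where "a \<in> \<rat>" "b \<in> \<rat>" "z = a + b * S" "2 * a = of_int t"
    "a\<^sup>2 - b\<^sup>2 * of_int d = of_int n"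
proof -
  have "z \<in> F" using assms by (auto simp: quad_ints_def)
  then obtain a b where ab: "a \<in> \<rat>" "b \<in> \<rat>" "z = a + b * S"
    unfolding quad_field_iff by blast
  with assms have "a + b * S \<in> almost_int (quad_order d)" by (simp add: quad_ints_eq)
  with almost_int_trace[OF this ab(1,2)] almost_int_norm[OF this ab(1,2)] that[OF ab]
  show ?thesis by (auto elim!: Ints_cases)
qed

lemma quad_intsI:
  assumes "a \<in> \<rat>" "b \<in> \<rat>" "2 * a = of_int t" "a\<^sup>2 - b\<^sup>2 * of_int d = of_int n"
  shows "a + b * S \<in> OF"
proof -
  have "(a + b * S) ^ 2 - of_int t * (a + b * S) + of_int n = 0"
    unfolding assms(3,4)[symmetric] S_square[symmetric]
    by (simp add: algebra_simps power2_eq_square)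
  then show ?thesis unfolding quad_ints_def
    using quad_fieldI[OF assms(1,2)] algebraic_integerI_quadratic by blast
qed

text \<open>Besides the trace 2a of z = a + bS, the trace 2bd of the integer zS is integral, and 2dz
  = d(2a) + (2bd)S.\<close>

lemma discriminant_conductor:
  assumes "z \<in> OF"
  shows "of_int (2 * d) * z \<in> quad_order d"
proof -
  interpret O: csubring OF by (rule csubring_OF)
  obtain a b t where ab: "a \<in> \<rat>" "b \<in> \<rat>" "z = a + b * S" "2 * a = of_int t"
    using quad_intsE[OF assms] by metis
  have "of_int 0 + of_int 1 * S \<in> quad_order d" unfolding quad_order_altdef by blast
  then have "S \<in> OF" using quad_order_subset by auto
  then have "z * S \<in> almost_int (quad_order d)"
    using assms O.mult_closed by (simp add: quad_ints_eq)
  moreover have "z * S = b * of_int d + a * S"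
    unfolding S_square[symmetric] ab(3) by (simp add: algebra_simps)
  ultimately have "2 * (b * of_int d) \<in> \<int>"
    using ab almost_int_trace[of "b * of_int d" a] by auto
  then obtain j where j: "2 * (b * of_int d) = of_int j" by (auto elim: Ints_cases)
  have "of_int (2 * d) * z = of_int d * (2 * a) + (2 * (b * of_int d)) * S"
    by (simp add: ab(3) algebra_simps)
  also have "\<dots> = of_int (d * t) + of_int j * S" unfolding ab(4) j by simp
  finally show ?thesis unfolding quad_order_altdef by blast
qed

lemma almost_int_OF: "almost_int OF \<subseteq> OF"
  using almost_int_conductor[of "2 * d" OF "quad_order d"] discriminant_conductor d_nonzero
  by (simp add: quad_ints_eq)

end

section \<open>Ideals of order three in the class group\<close>

text \<open>Orbits have exactly three elements: f(f a) = a would give f a = a by applying f once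
  more. They are removed one at a time.\<close>

lemma dvd_card_free_order3:
  assumes "\<And>x. x \<in> A \<Longrightarrow> f x \<in> A" "\<And>x. x \<in> A \<Longrightarrow> f (f (f x)) = x" "\<And>x. x \<in> A \<Longrightarrow> f x \<noteq> x"
  shows "3 dvd card A"
proof (cases "finite A")
  case True
  then show ?thesis using assms
  proof (induction "card A" arbitrary: A rule: less_induct)
    case less
    note f = less.prems
    show ?case
    proof (cases "A = {}")
      case False
      then obtain a where a: "a \<in> A" by blast
      let ?O = "{a, f a, f (f a)}"
      have fa: "f a \<in> A" "f (f a) \<in> A" using a f by auto
      have d: "f a \<noteq> a" "f (f a) \<noteq> f a" "f (f a) \<noteq> a"
        using f(4)[OF a] f(4)[OF fa(1)] f(3)[OF a] by metis+
      have sub: "?O \<subseteq> A" using a fa by auto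
      have c: "card ?O = 3" using d by auto
      have "3 dvd card (A - ?O)"
      proof (rule less.hyps)
        show "card (A - ?O) < card A" using a f(1) by (intro psubset_card_mono) auto
        fix x assume x: "x \<in> A - ?O"
        show "f x \<in> A - ?O"
          using x f(2)[of x] f(3)[of x] f(3)[OF a] f(3)[OF fa(1)] f(3)[OF fa(2)] by auto
      qed (use f in auto)
      moreover have "card A = card (A - ?O) + 3"
        using card_Diff_subset[of ?O A] card_mono[OF f(1) sub] sub c by simp
      ultimately show ?thesis by simp
    qed auto
  qed
qed auto

text \<open>Finite sums of products, defined for arbitrary sets, so that the same operation yields
  products of ideals of \<open>OF\<close> and extensions \<open>iprod J R\<close> to a larger
  ring.\<close>

inductive_set iprod :: "complex set \<Rightarrow> complex set \<Rightarrow> complex set" for I J where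
  iprod_zero: "0 \<in> iprod I J"
| iprod_step: "a \<in> I \<Longrightarrow> b \<in> J \<Longrightarrow> x \<in> iprod I J \<Longrightarrow> a * b + x \<in> iprod I J"

lemma iprod_mult: "a \<in> I \<Longrightarrow> b \<in> J \<Longrightarrow> a * b \<in> iprod I J"
  using iprod_step[OF _ _ iprod_zero] by force

lemma iprod_add: "x \<in> iprod I J \<Longrightarrow> y \<in> iprod I J \<Longrightarrow> x + y \<in> iprod I J"
  by (induction rule: iprod.induct) (auto simp: add.assoc intro: iprod_step)

lemma iprod_subsetI:
  assumes "0 \<in> K" "\<And>x y. x \<in> K \<Longrightarrow> y \<in> K \<Longrightarrow> x + y \<in> K" "\<And>a b. a \<in> I \<Longrightarrow> b \<in> J \<Longrightarrow> a * b \<in> K"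
  shows "iprod I J \<subseteq> K"
proof
  fix x assume "x \<in> iprod I J"
  then show "x \<in> K" by induction (use assms in auto)
qed

lemma iprod_mono: "I \<subseteq> I' \<Longrightarrow> J \<subseteq> J' \<Longrightarrow> iprod I J \<subseteq> iprod I' J'"
  by (intro iprod_subsetI) (auto intro: iprod_zero iprod_add iprod_mult)

lemma iprod_commute: "iprod I J = iprod J I"
proof -
  have "iprod I J \<subseteq> iprod J I" for I J
  proof (intro iprod_subsetI iprod_zero iprod_add)
    fix a b assume "a \<in> I" "b \<in> J"
    then show "a * b \<in> iprod J I" by (subst mult.commute) (rule iprod_mult)
  qed
  then show ?thesis by blast
qed

lemma iprod_scale_closed: 
  assumes "\<And>a. a \<in> I \<Longrightarrow> r * a \<in> I" "x \<in> iprod I J"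
  shows "r * x \<in> iprod I J"
  using assms(2)
proof induction
  case (iprod_step a b x)
  have "r * (a * b + x) = (r * a) * b + r * x" by (simp add: algebra_simps)
  then show ?case using iprod_step assms(1) by (metis iprod.iprod_step)
qed (auto intro: iprod_zero)

lemma iprod_assoc_subset: "iprod (iprod I J) K \<subseteq> iprod I (iprod J K)"
proof (intro iprod_subsetI iprod_zero iprod_add)
  fix x c assume "x \<in> iprod I J" "c \<in> K"
  then show "x * c \<in> iprod I (iprod J K)"
  proof induction
    case (iprod_step a b x)
    have "(a * b + x) * c = a * (b * c) + x * c" by (simp add: algebra_simps)
    then show ?case using iprod_step by (auto intro!: iprod_add iprod_mult)
  qed (auto intro: iprod_zero)
qed

lemma iprod_assoc: "iprod (iprod I J) K = iprod I (iprod J K)"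
proof
  show "iprod I (iprod J K) \<subseteq> iprod (iprod I J) K"
    using iprod_assoc_subset[of K J I] by (simp add: iprod_commute)
qed (rule iprod_assoc_subset)

lemma iprod_image_scale: "iprod ((\<lambda>x. c * x) ` I) J = (\<lambda>x. c * x) ` iprod I J"
proof
  show "iprod ((\<lambda>x. c * x) ` I) J \<subseteq> (\<lambda>x. c * x) ` iprod I J"
  proof (rule iprod_subsetI)
    show "0 \<in> (\<lambda>x. c * x) ` iprod I J" using imageI[OF iprod_zero, of "(*) c" I J] by simp
    fix x y assume "x \<in> (\<lambda>x. c * x) ` iprod I J" "y \<in> (\<lambda>x. c * x) ` iprod I J"
    then show "x + y \<in> (\<lambda>x. c * x) ` iprod I J"
      using iprod_add by (auto simp: distrib_left[symmetric])
  next
    fix a b assume "a \<in> (\<lambda>x. c * x) ` I" "b \<in> J"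
    then show "a * b \<in> (\<lambda>x. c * x) ` iprod I J"
      by (auto simp: mult.assoc intro: iprod_mult)
  qed
  show "(\<lambda>x. c * x) ` iprod I J \<subseteq> iprod ((\<lambda>x. c * x) ` I) J"
  proof clarify
    fix x assume "x \<in> iprod I J"
    then show "c * x \<in> iprod ((\<lambda>x. c * x) ` I) J"
    proof induction
      case (iprod_step a b x)
      have "c * (a * b + x) = (c * a) * b + c * x" by (simp add: algebra_simps)
      then show ?case using iprod_step by (metis iprod.iprod_step imageI)
    qed (auto intro: iprod_zero)
  qed
qed

section \<open>Ideal classes and multiplication by an ideal whose cube is principal\<close>

context quad_number_field
begin

lemma is_ideal_iprod:
  assumes "is_ideal OF I" "is_ideal OF J"
  shows "is_ideal OF (iprod I J)"
proof -
  interpret O: csubring OF by (rule csubring_OF)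
  have "iprod I J \<subseteq> OF"
    by (intro iprod_subsetI O.closed) (use assms in \<open>auto simp: is_ideal_def\<close>)
  then show ?thesis
    using assms unfolding is_ideal_def by (auto intro: iprod_zero iprod_add iprod_scale_closed)
qed

lemma nonzero_ideals_iprod:
  assumes "I \<in> nonzero_ideals d" "J \<in> nonzero_ideals d"
  shows "iprod I J \<in> nonzero_ideals d"
proof -
  obtain a b where "a \<in> I" "a \<noteq> 0" "b \<in> J" "b \<noteq> 0"
    using assms unfolding nonzero_ideals_def is_ideal_def by blast
  then have "a * b \<in> iprod I J" "a * b \<noteq> 0" by (auto intro: iprod_mult)
  then show ?thesis using assms is_ideal_iprod unfolding nonzero_ideals_def by blast
qed

lemma iprod_OF:
  assumes "is_ideal OF J"
  shows "iprod OF J = J"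
proof
  interpret O: csubring OF by (rule csubring_OF)
  show "iprod OF J \<subseteq> J"
    by (rule iprod_subsetI) (use assms in \<open>auto simp: is_ideal_def\<close>)
  show "J \<subseteq> iprod OF J" using iprod_mult[OF O.one_closed, of _ J] by auto
qed

lemma iprod_principal:
  assumes "is_ideal OF J"
  shows "iprod ((\<lambda>x. c * x) ` OF) J = (\<lambda>x. c * x) ` J"
  by (simp add: iprod_image_scale iprod_OF assms)

lemma ideal_equivI:
  assumes "I \<in> nonzero_ideals d" "J \<in> nonzero_ideals d" "a \<in> OF" "a \<noteq> 0" "b \<in> OF" "b \<noteq> 0"
    "(\<lambda>x. a * x) ` I = (\<lambda>x. b * x) ` J"
  shows "(I, J) \<in> ideal_equiv d"
  unfolding ideal_equiv_def mem_Collect_eq case_prod_conv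
  using assms(1,2) by (intro conjI bexI[of _ a] bexI[of _ b] assms(7)) (use assms(3-6) in simp_all)

lemma ideal_equivE:
  assumes "(I, J) \<in> ideal_equiv d"
  obtains a b where "I \<in> nonzero_ideals d" "J \<in> nonzero_ideals d" "a \<in> OF" "a \<noteq> 0" "b \<in> OF" "b \<noteq> 0"
    "(\<lambda>x. a * x) ` I = (\<lambda>x. b * x) ` J"
proof -
  from assms obtain a b where "I \<in> nonzero_ideals d" "J \<in> nonzero_ideals d" "a \<in> OF - {0}" "b \<in> OF - {0}"
    "(\<lambda>x. a * x) ` I = (\<lambda>x. b * x) ` J"
    unfolding ideal_equiv_def by auto
  then show ?thesis using that[of a b] by simp
qed

lemma equiv_ideal_equiv: "equiv (nonzero_ideals d) (ideal_equiv d)"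
proof (rule equivI)
  interpret O: csubring OF by (rule csubring_OF)
  show "ideal_equiv d \<subseteq> nonzero_ideals d \<times> nonzero_ideals d"
    unfolding ideal_equiv_def by auto
  show "refl_on (nonzero_ideals d) (ideal_equiv d)"
    by (rule refl_onI, rule ideal_equivI[of _ _ 1 1]) (auto intro: O.one_closed)
  show "sym (ideal_equiv d)"
    by (rule symI, erule ideal_equivE, rule ideal_equivI[rotated -1], erule sym)
  show "trans (ideal_equiv d)"
  proof (rule transI)
    fix I J K assume "(I, J) \<in> ideal_equiv d" "(J, K) \<in> ideal_equiv d"
    then obtain a b a' b' where ab: "I \<in> nonzero_ideals d" "a \<in> OF" "a \<noteq> 0" "b \<in> OF" "b \<noteq> 0"
        "(\<lambda>x. a * x) ` I = (\<lambda>x. b * x) ` J"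
      and ab': "K \<in> nonzero_ideals d" "a' \<in> OF" "a' \<noteq> 0" "b' \<in> OF" "b' \<noteq> 0"
        "(\<lambda>x. a' * x) ` J = (\<lambda>x. b' * x) ` K"
      by (elim ideal_equivE)
    have "(\<lambda>x. (a' * a) * x) ` I = (\<lambda>x. a' * x) ` (\<lambda>x. a * x) ` I" by (simp add: image_image mult.assoc)
    also have "\<dots> = (\<lambda>x. b * x) ` (\<lambda>x. a' * x) ` J" unfolding ab(6) by (simp add: image_image mult_ac)
    also have "\<dots> = (\<lambda>x. (b * b') * x) ` K" unfolding ab'(6) by (simp add: image_image mult.assoc)
    finally show "(I, K) \<in> ideal_equiv d"
      by (rule ideal_equivI[rotated -1]) (use ab ab' O.mult_closed in auto)
  qed
qed

lemma conjugate_in_OF: "a \<in> \<rat> \<Longrightarrow> b \<in> \<rat> \<Longrightarrow> a + b * S \<in> OF \<Longrightarrow> a - b * S \<in> OF"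
proof -
  assume ab: "a \<in> \<rat>" "b \<in> \<rat>" "a + b * S \<in> OF"
  then have "2 * a \<in> \<int>" "a\<^sup>2 - b\<^sup>2 * of_int d \<in> \<int>"
    using almost_int_trace almost_int_norm unfolding quad_ints_eq by blast+
  then obtain t n where "2 * a = of_int t" "a\<^sup>2 - b\<^sup>2 * of_int d = of_int n"
    by (elim Ints_cases)
  then show ?thesis using quad_intsI[of a "-b" t n] ab by simp
qed

text \<open>The determinant trick for a lattice of rank two: multipliers of a nonzero ideal have
  bounded denominators, hence are integral.\<close>
lemma ideal_multiplier_integral:
  assumes J: "J \<in> nonzero_ideals d" and b: "\<And>x. x \<in> J \<Longrightarrow> b * x \<in> J"
  shows "b \<in> OF"
proof -
  interpret O: csubring OF by (rule csubring_OF)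
  obtain j where j: "j \<in> J" "j \<noteq> 0" "j \<in> OF"
    using J unfolding nonzero_ideals_def is_ideal_def by blast
  have bj: "b ^ k * j \<in> OF" for k
  proof -
    have "b ^ k * j \<in> J" by (induction k) (use j b in \<open>auto simp: mult.assoc\<close>)
    then show ?thesis using J unfolding nonzero_ideals_def is_ideal_def by blast
  qed
  obtain p q n where pq: "p \<in> \<rat>" "q \<in> \<rat>" "j = p + q * S" "p\<^sup>2 - q\<^sup>2 * of_int d = of_int n"
    using quad_intsE[OF j(3)] by metis
  have j': "p - q * S \<in> OF" using conjugate_in_OF pq j by blast
  have N: "j * (p - q * S) = of_int n"
    unfolding pq(3) pq(4)[symmetric] S_square[symmetric] by (simp add: algebra_simps power2_eq_square)
  have "n \<noteq> 0"
  proof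
    assume "n = 0"
    then have "p - q * S = 0" using N j by simp
    then have "p + (- q) * S = 0 + 0 * S" by simp
    then have "p = 0" "- q = 0"
      using rational_S_unique[of p "-q" 0 0] pq(1,2) by (blast intro: Rats_minus_iff[THEN iffD2] Rats_0)+
    then show False using j pq by simp
  qed
  moreover have "of_int n * b ^ k \<in> OF" for k
    using O.mult_closed[OF j' bj[of k]] by (simp add: N[symmetric] mult_ac)
  ultimately have "b \<in> almost_int OF" unfolding almost_int_def by blast
  then show ?thesis using almost_int_OF by blast
qed

text \<open>A fixed class means \<aa>J = kJ for some k in F. Elements of \<aa>/k multiply J into
  itself, hence are integral, so \<aa> is contained in (k). Conversely k\<aa>\<aa>J = \<aa>^3 J = cJ
  shows that (k/c)\<aa>\<aa> is integral, and this yields k \<in> \<aa>. The hypothesis on the cube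
  replaces inverses of ideals and cancellation.\<close>

lemma class_fixed_imp_principal:
  assumes a: "\<aa> \<in> nonzero_ideals d" and cube: "iprod \<aa> (iprod \<aa> \<aa>) = (\<lambda>x. c * x) ` OF" and c: "c \<noteq> 0"
    and J: "J \<in> nonzero_ideals d" and eq: "(iprod \<aa> J, J) \<in> ideal_equiv d"
  shows "\<exists>\<kappa>\<in>OF. \<aa> = (\<lambda>x. \<kappa> * x) ` OF"
proof -
  interpret O: csubring OF by (rule csubring_OF)
  have ia: "is_ideal OF \<aa>" and iJ: "is_ideal OF J" using a J by (auto simp: nonzero_ideals_def)
  obtain l m where lm: "l \<noteq> 0" "m \<noteq> 0" and e: "(\<lambda>x. l * x) ` iprod \<aa> J = (\<lambda>x. m * x) ` J"
    using eq by (rule ideal_equivE)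
  define k where "k = m / l"
  have k0: "k \<noteq> 0" using lm by (simp add: k_def)
  have aJ: "iprod \<aa> J = (\<lambda>x. k * x) ` J"
  proof -
    have "iprod \<aa> J = (\<lambda>x. inverse l * x) ` (\<lambda>x. l * x) ` iprod \<aa> J"
      using lm by (simp add: image_image mult.assoc[symmetric])
    also have "\<dots> = (\<lambda>x. k * x) ` J"
      unfolding e by (simp add: image_image k_def field_simps)
    finally show ?thesis .
  qed
  have sub: "x / k \<in> OF" if "x \<in> \<aa>" for x
  proof (rule ideal_multiplier_integral[OF J])
    fix y assume "y \<in> J"
    then have "x * y \<in> (\<lambda>x. k * x) ` J" using that iprod_mult aJ by blast
    then show "x / k * y \<in> J" using k0 by auto
  qed
  have *: "k * x * y / c \<in> OF" if "x \<in> \<aa>" "y \<in> \<aa>" for x y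
  proof (rule ideal_multiplier_integral[OF J])
    fix z assume z: "z \<in> J"
    have kz: "k * z \<in> iprod \<aa> J" using z aJ by blast
    have "x * (y * (k * z)) \<in> iprod \<aa> (iprod \<aa> (iprod \<aa> J))"
      by (rule iprod_mult[OF that(1) iprod_mult[OF that(2) kz]])
    also have "\<dots> = iprod (iprod \<aa> (iprod \<aa> \<aa>)) J" by (simp add: iprod_assoc)
    also have "\<dots> = (\<lambda>x. c * x) ` J" by (simp add: cube iprod_principal iJ)
    finally show "k * x * y / c * z \<in> J" using c by (auto simp: field_simps)
  qed
  \<comment> \<open>Multiplying the integral set (k/c)\<aa>\<aa> by one more factor from \<aa> stays
    in \<aa>.\<close>
  have **: "k * w / c \<in> \<aa>" if "w \<in> iprod \<aa> (iprod \<aa> \<aa>)" for w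
  proof -
    have "iprod \<aa> (iprod \<aa> \<aa>) \<subseteq> {w. k * w / c \<in> \<aa>}"
    proof (rule iprod_subsetI)
      show "0 \<in> {w. k * w / c \<in> \<aa>}" using ia by (simp add: is_ideal_def)
      show "x + y \<in> {w. k * w / c \<in> \<aa>}" if "x \<in> {w. k * w / c \<in> \<aa>}" "y \<in> {w. k * w / c \<in> \<aa>}" for x y
        using that ia by (simp add: is_ideal_def distrib_left add_divide_distrib)
      show "x * u \<in> {w. k * w / c \<in> \<aa>}" if x: "x \<in> \<aa>" and u: "u \<in> iprod \<aa> \<aa>" for x u
        using u
      proof induction
        case (iprod_step y y' u)
        have "(k * y * y' / c) * x \<in> \<aa>" using *[OF iprod_step(1,2)] ia x unfolding is_ideal_def by blast
        moreover have "k * (x * u) / c \<in> \<aa>" using iprod_step by simp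
        ultimately have "(k * y * y' / c) * x + k * (x * u) / c \<in> \<aa>" using ia by (simp add: is_ideal_def)
        then show ?case by (simp add: algebra_simps add_divide_distrib)
      qed (use ia in \<open>simp add: is_ideal_def\<close>)
    qed
    then show ?thesis using that by blast
  qed
  \<comment> \<open>The generator c lies in \<aa>^3, so the previous step with w = c puts k itself
    into \<aa>.\<close>
  have "c * 1 \<in> iprod \<aa> (iprod \<aa> \<aa>)" unfolding cube by (intro imageI O.one_closed)
  then have "c \<in> iprod \<aa> (iprod \<aa> \<aa>)" by simp
  from **[OF this] have ka: "k \<in> \<aa>" using c by simp
  have "\<aa> = (\<lambda>x. k * x) ` OF"
  proof
    show "\<aa> \<subseteq> (\<lambda>x. k * x) ` OF"
    proof
      fix x assume "x \<in> \<aa>"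
      then show "x \<in> (\<lambda>x. k * x) ` OF" using sub k0 by (intro image_eqI[of _ _ "x / k"]) auto
    qed
    show "(\<lambda>x. k * x) ` OF \<subseteq> \<aa>" using ka ia by (auto simp: is_ideal_def mult.commute[of k])
  qed
  moreover have "k \<in> OF" using ka ia by (auto simp: is_ideal_def)
  ultimately show ?thesis by blast
qed

lemma ideal_equiv_scale:
  assumes "I \<in> nonzero_ideals d" "J \<in> nonzero_ideals d" "c \<in> OF" "c \<noteq> 0" "J = (\<lambda>x. c * x) ` I"
  shows "(J, I) \<in> ideal_equiv d"
proof -
  have "(\<lambda>x. 1 * x) ` J = (\<lambda>x. c * x) ` I" using assms(5) by simp
  then show ?thesis
    by (rule ideal_equivI[rotated -1]) (use assms csubring.one_closed[OF csubring_OF] in auto)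
qed

lemma ideal_equiv_iprod:
  assumes "(I, J) \<in> ideal_equiv d" "\<aa> \<in> nonzero_ideals d"
  shows "(iprod \<aa> I, iprod \<aa> J) \<in> ideal_equiv d"
  using assms(1)
proof (rule ideal_equivE)
  fix a b assume ab: "I \<in> nonzero_ideals d" "J \<in> nonzero_ideals d" "a \<in> OF" "a \<noteq> 0" "b \<in> OF" "b \<noteq> 0"
    "(\<lambda>x. a * x) ` I = (\<lambda>x. b * x) ` J"
  then have "(\<lambda>x. a * x) ` iprod \<aa> I = (\<lambda>x. b * x) ` iprod \<aa> J"
    using iprod_image_scale[of a I \<aa>] iprod_image_scale[of b J \<aa>] by (simp add: iprod_commute)
  then show ?thesis
    by (rule ideal_equivI[rotated -1]) (use ab assms(2) in \<open>auto intro: nonzero_ideals_iprod\<close>)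
qed

theorem three_dvd_class_number:
  assumes a: "\<aa> \<in> nonzero_ideals d" and cube: "iprod \<aa> (iprod \<aa> \<aa>) = (\<lambda>x. c * x) ` OF"
    and c: "c \<in> OF" "c \<noteq> 0" and np: "\<not> (\<exists>\<kappa>\<in>OF. \<aa> = (\<lambda>x. \<kappa> * x) ` OF)"
  shows "3 dvd class_number d"
  unfolding class_number_def
proof (rule dvd_card_free_order3)
  let ?N = "nonzero_ideals d" and ?E = "ideal_equiv d"
  define f where "f X = (\<Union>J\<in>X. ?E `` {iprod \<aa> J})" for X
  note E = equiv_ideal_equiv
  have f: "f (?E `` {J}) = ?E `` {iprod \<aa> J}" if "J \<in> ?N" for J
    unfolding f_def
    by (rule UN_equiv_class[OF E _ that])
       (auto simp: congruent_def intro!: equiv_class_eq[OF E] ideal_equiv_iprod a)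
  fix X assume "X \<in> ?N // ?E"
  then obtain J where J: "J \<in> ?N" "X = ?E `` {J}" by (auto elim: quotientE)
  note aJ = nonzero_ideals_iprod[OF a J(1)]
  note aaJ = nonzero_ideals_iprod[OF a aJ]
  note aaaJ = nonzero_ideals_iprod[OF a aaJ]
  show "f X \<in> ?N // ?E" using aJ J f by (auto intro: quotientI)
  have "iprod \<aa> (iprod \<aa> (iprod \<aa> J)) = iprod (iprod \<aa> (iprod \<aa> \<aa>)) J" by (simp add: iprod_assoc)
  also have "\<dots> = (\<lambda>x. c * x) ` J"
    unfolding cube by (rule iprod_principal) (use J in \<open>simp add: nonzero_ideals_def\<close>)
  finally have "(iprod \<aa> (iprod \<aa> (iprod \<aa> J)), J) \<in> ?E"
    by (intro ideal_equiv_scale[OF J(1) aaaJ c])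
  then show "f (f (f X)) = X"
    by (simp add: J f aJ aaJ equiv_class_eq[OF E])
  show "f X \<noteq> X"
  proof
    assume "f X = X"
    then have "(iprod \<aa> J, J) \<in> ?E" using eq_equiv_class[OF _ E J(1)] by (simp add: J f)
    then show False using class_fixed_imp_principal[OF a cube c(2) J(1)] np by blast
  qed
qed

end

section \<open>Unramified cyclic cubic extensions\<close>

locale imaginary_quad_field = quad_number_field +
  assumes d_neg: "d < 0"
begin

text \<open>For negative \<open>d\<close> complex conjugation is the nontrivial automorphism of F,
  so a bound on |z| bounds trace and norm.\<close>

lemma cnj_S: "cnj S = - S"
  using d_neg csqrt_of_real_nonpos[of "of_int d"] by (simp add: S_def)

lemma cnj_eq:
  assumes "a \<in> \<rat>" "b \<in> \<rat>"
  shows "cnj (a + b * S) = a - b * S"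
proof -
  have r: "cnj q = q" if "q \<in> \<rat>" for q
    using that by (elim Rats_cases, rename_tac r, case_tac r) (simp add: of_rat_rat)
  show ?thesis using r[OF assms(1)] r[OF assms(2)] by (simp add: cnj_S)
qed

lemma quad_ints_cnj:
  assumes "z \<in> OF"
  obtains t n :: int where "z + cnj z = of_int t" "z * cnj z = of_int n"
proof -
  obtain a b t n where ab: "a \<in> \<rat>" "b \<in> \<rat>" "z = a + b * S" "2 * a = of_int t"
    "a\<^sup>2 - b\<^sup>2 * of_int d = of_int n"
    using quad_intsE[OF assms] by metis
  have c: "cnj z = a - b * S" unfolding ab(3) by (rule cnj_eq[OF ab(1,2)])
  have "z * cnj z = of_int n"
    unfolding c unfolding ab(3) ab(5)[symmetric] S_square[symmetric] by (simp add: algebra_simps power2_eq_square)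
  moreover have "z + cnj z = of_int t" unfolding c unfolding ab(3) ab(4)[symmetric] by simp
  ultimately show ?thesis using that by blast
qed

text \<open>Each such z is a root of z^2 - tz + n with integers |t| \<le> 2B and |n| \<le>
  B^2.\<close>

lemma finite_bounded_quad_ints: "finite {z \<in> OF. norm z \<le> B}"
proof (rule finite_subset)
  let ?K = "{- \<lceil>2 * B\<rceil>..\<lceil>2 * B\<rceil>} \<times> {- \<lceil>B * B\<rceil>..\<lceil>B * B\<rceil>}"
  show "finite (\<Union>(t,n)\<in>?K. {z. poly [:of_int n, - of_int t, 1:] z = (0::complex)})"
    by (intro finite_UN_I) (auto intro!: poly_roots_finite simp del: poly_pCons)
  show "{z \<in> OF. norm z \<le> B} \<subseteq> (\<Union>(t,n)\<in>?K. {z. poly [:of_int n, - of_int t, 1:] z = (0::complex)})"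
  proof clarify
    fix z assume z: "z \<in> OF" "norm z \<le> B"
    then obtain t n where tn: "z + cnj z = of_int t" "z * cnj z = of_int n" using quad_ints_cnj by blast
    have "\<bar>real_of_int t\<bar> \<le> 2 * B"
      using norm_triangle_ineq[of z "cnj z"] z unfolding tn by simp
    moreover have "\<bar>real_of_int n\<bar> \<le> B * B"
      using norm_mult[of z "cnj z"] mult_mono[OF z(2) z(2)] norm_ge_zero[of z] z(2) unfolding tn by simp
    ultimately have "(t, n) \<in> ?K" by (auto simp: le_ceiling_iff ceiling_le_iff) linarith+
    moreover have "z * z - (z + cnj z) * z + z * cnj z = 0" by (simp add: algebra_simps)
    then have "poly [:of_int n, - of_int t, 1:] z = 0" unfolding tn by (simp add: algebra_simps)
    ultimately show "z \<in> (\<Union>(t,n)\<in>?K. {z. poly [:of_int n, - of_int t, 1:] z = (0::complex)})" by blast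
  qed
qed

end

text \<open>\<open>R\<close> plays the ring of integers of a cyclic cubic extension of F; the field
  itself is not mentioned, as quotients are taken in the complex numbers. The form in
  \<open>unramified\<close> is half the sum of the squared differences of the conjugates.
  \<open>units_OF\<close> excludes the fields with further roots of unity.\<close>

locale cyclic_cubic_extension = imaginary_quad_field + R: csubring R for R +
  fixes \<sigma> :: "complex \<Rightarrow> complex"
  assumes sigma_in: "v \<in> R \<Longrightarrow> \<sigma> v \<in> R"
    and sigma_add: "v \<in> R \<Longrightarrow> w \<in> R \<Longrightarrow> \<sigma> (v + w) = \<sigma> v + \<sigma> w"
    and sigma_mult: "v \<in> R \<Longrightarrow> w \<in> R \<Longrightarrow> \<sigma> (v * w) = \<sigma> v * \<sigma> w"
    and sigma_order3: "v \<in> R \<Longrightarrow> \<sigma> (\<sigma> (\<sigma> v)) = v"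
    and OF_fixed: "OF = {v \<in> R. \<sigma> v = v}"
    and trace_one: "\<exists>e\<in>R. e + \<sigma> e + \<sigma> (\<sigma> e) = 1"
    and unramified: "\<exists>y\<in>R. \<exists>z\<in>R. \<exists>m n :: int.
          of_int m * (y\<^sup>2 + (\<sigma> y)\<^sup>2 + (\<sigma> (\<sigma> y))\<^sup>2 - y * \<sigma> y - y * \<sigma> (\<sigma> y) - \<sigma> y * \<sigma> (\<sigma> y)) +
          of_int n * (z\<^sup>2 + (\<sigma> z)\<^sup>2 + (\<sigma> (\<sigma> z))\<^sup>2 - z * \<sigma> z - z * \<sigma> (\<sigma> z) - \<sigma> z * \<sigma> (\<sigma> z)) = 1"
    and units_OF: "z \<in> OF \<Longrightarrow> w \<in> OF \<Longrightarrow> z * w = 1 \<Longrightarrow> z = 1 \<or> z = -1"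
begin

interpretation O: csubring OF by (rule csubring_OF)

definition trace where "trace v = v + \<sigma> v + \<sigma> (\<sigma> v)"

lemma OF_subset: "OF \<subseteq> R"
  using OF_fixed by blast

lemma sigma_OF: "c \<in> OF \<Longrightarrow> \<sigma> c = c"
  using OF_fixed by blast

lemma sigma_1: "\<sigma> 1 = 1" and sigma_0: "\<sigma> 0 = 0"
  by (intro sigma_OF O.closed)+

lemma sigma_minus: "v \<in> R \<Longrightarrow> \<sigma> (- v) = - \<sigma> v"
  using sigma_mult[of "-1" v] sigma_OF[of "-1"] by (simp add: O.closed R.closed)

lemma sigma2_mult: "v \<in> R \<Longrightarrow> w \<in> R \<Longrightarrow> \<sigma> (\<sigma> (v * w)) = \<sigma> (\<sigma> v) * \<sigma> (\<sigma> w)"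
  by (simp add: sigma_mult sigma_in)

lemma sigma_eq_0: "v \<in> R \<Longrightarrow> \<sigma> v = 0 \<longleftrightarrow> v = 0"
  using sigma_order3[of v] sigma_0 by auto

lemma fixed_in_OF: "v \<in> R \<Longrightarrow> \<sigma> v = v \<Longrightarrow> v \<in> OF"
  using OF_fixed by blast

lemma trace_in_OF: "v \<in> R \<Longrightarrow> trace v \<in> OF"
  by (rule fixed_in_OF) (auto simp: trace_def sigma_add sigma_in sigma_order3 R.add_closed)

lemma norm_in_OF: "v \<in> R \<Longrightarrow> v * \<sigma> v * \<sigma> (\<sigma> v) \<in> OF"
  by (rule fixed_in_OF) (auto simp: trace_def sigma_mult sigma_in sigma_order3 R.mult_closed)

lemma trace_add: "v \<in> R \<Longrightarrow> w \<in> R \<Longrightarrow> trace (v + w) = trace v + trace w"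
  by (simp add: trace_def sigma_add sigma_in)

lemma trace_scale: "c \<in> OF \<Longrightarrow> v \<in> R \<Longrightarrow> trace (c * v) = c * trace v"
  using OF_subset by (auto simp: trace_def sigma_mult sigma_in sigma_OF distrib_left)

lemma trace_zero: "trace 0 = 0"
  by (simp add: trace_def sigma_0)

text \<open>Lagrange resolvent for the cocycle of w = 1/u: since w \<sigma>(w) \<sigma>^2(w) = 1,
  the sum \<rho>(\<theta>) satisfies w \<sigma>(\<rho>(\<theta>)) = \<rho>(\<theta>). Instead of
  independence of characters, three explicit values of \<theta> ensure that one resolvent is
  nonzero.\<close>

lemma hilbert90:
  assumes u: "u \<in> R" "u * \<sigma> u * \<sigma> (\<sigma> u) = 1"
  shows "\<exists>\<alpha>\<in>R. \<alpha> \<noteq> 0 \<and> \<sigma> \<alpha> = u * \<alpha>"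
proof -
  \<comment> \<open>The form in \<open>unramified\<close> vanishes at elements fixed by \<sigma>, so
    one of its two arguments is moved; as \<sigma> has order 3, its three conjugates are then
    distinct.\<close>
  obtain x where x: "x \<in> R" "x \<noteq> \<sigma> x" "x \<noteq> \<sigma> (\<sigma> x)" 
  proof -
    obtain y z m n where yz: "y \<in> R" "z \<in> R" and e:
      "of_int m * (y\<^sup>2 + (\<sigma> y)\<^sup>2 + (\<sigma> (\<sigma> y))\<^sup>2 - y * \<sigma> y - y * \<sigma> (\<sigma> y) - \<sigma> y * \<sigma> (\<sigma> y)) +
       of_int n * (z\<^sup>2 + (\<sigma> z)\<^sup>2 + (\<sigma> (\<sigma> z))\<^sup>2 - z * \<sigma> z - z * \<sigma> (\<sigma> z) - \<sigma> z * \<sigma> (\<sigma> z)) = 1"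
      using unramified by blast
    have *: "w\<^sup>2 + (\<sigma> w)\<^sup>2 + (\<sigma> (\<sigma> w))\<^sup>2 - w * \<sigma> w - w * \<sigma> (\<sigma> w) - \<sigma> w * \<sigma> (\<sigma> w) = 0"
      if "\<sigma> w = w" for w using that by (simp add: power2_eq_square)
    have "\<sigma> y \<noteq> y \<or> \<sigma> z \<noteq> z"
    proof (rule ccontr)
      assume "\<not> ?thesis"
      then have "\<sigma> y = y" "\<sigma> z = z" by auto
      then show False using e *[of y] *[of z] by simp
    qed
    moreover have "w \<noteq> \<sigma> (\<sigma> w)" if "w \<in> R" "\<sigma> w \<noteq> w" for w
      using that sigma_order3[of w] by metis
    ultimately show ?thesis using that yz by metis
  qed
  define w where "w = \<sigma> u * \<sigma> (\<sigma> u)"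
  have w: "w \<in> R" "u * w = 1" using u by (auto simp: w_def mult.assoc sigma_in R.mult_closed)
  have sw: "\<sigma> w = \<sigma> (\<sigma> u) * u" using u by (simp add: w_def sigma_mult sigma_in sigma_order3)
  define \<rho> where "\<rho> \<theta> = \<theta> + w * \<sigma> \<theta> + w * \<sigma> w * \<sigma> (\<sigma> \<theta>)" for \<theta>
  have wu: "w * \<sigma> w * \<sigma> (\<sigma> w) = 1"
  proof -
    have "\<sigma> (\<sigma> w) = u * \<sigma> u" unfolding sw using u by (simp add: sigma_mult sigma_in sigma_order3)
    then show ?thesis unfolding sw unfolding w_def using u(2) by algebra
  qed
  have \<rho>: "\<rho> \<theta> \<in> R" "\<sigma> (\<rho> \<theta>) = u * \<rho> \<theta>" if "\<theta> \<in> R" for \<theta>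
  proof -
    show "\<rho> \<theta> \<in> R" unfolding \<rho>_def by (intro R.closed sigma_in that w)
    have "\<sigma> (\<rho> \<theta>) = \<sigma> \<theta> + \<sigma> w * \<sigma> (\<sigma> \<theta>) + \<sigma> w * \<sigma> (\<sigma> w) * \<theta>"
      using that w by (simp add: \<rho>_def sigma_add sigma_mult sigma_in sigma_order3 R.mult_closed R.add_closed)
    also have "\<dots> = u * \<rho> \<theta>" unfolding \<rho>_def using wu w(2) by algebra
    finally show "\<sigma> (\<rho> \<theta>) = u * \<rho> \<theta>" .
  qed
  have "\<rho> 1 \<noteq> 0 \<or> \<rho> x \<noteq> 0 \<or> \<rho> (x * x) \<noteq> 0"
  proof (rule ccontr)
    assume "\<not> ?thesis"
    then have "1 + w + w * \<sigma> w = 0" "x + w * \<sigma> x + w * \<sigma> w * \<sigma> (\<sigma> x) = 0"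
      "x * x + w * (\<sigma> x * \<sigma> x) + w * \<sigma> w * (\<sigma> (\<sigma> x) * \<sigma> (\<sigma> x)) = 0"
      using x by (auto simp: \<rho>_def sigma_1 sigma_mult sigma_in)
    \<comment> \<open>Vandermonde: combining the three equations with the coefficients of the
      polynomial with roots \<sigma>(x) and \<sigma>^2(x) leaves only the first term.\<close>
    then have "(x - \<sigma> x) * (x - \<sigma> (\<sigma> x)) = 0" by algebra
    then show False using x by simp
  qed
  then show ?thesis using \<rho> x R.one_closed R.mult_closed by metis
qed

text \<open>Galois descent: put $g_y = (y - \<sigma> y)(y - \<sigma>^2 y)$. Then $g_y v$ is an $R$-combination of traces of
  $R$-multiples of $v$, and \<open>unramified\<close> writes 1 as an integer combination of two sums
  $g_y + \<sigma> g_y + \<sigma>^2 g_y$.\<close>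
lemma descent:
  assumes "v \<in> R"
  shows "v \<in> iprod {trace (c * v) | c. c \<in> R} R"
proof -
  let ?I = "iprod {trace (c * v) | c. c \<in> R} R"
  have scale: "r * x \<in> ?I" if "r \<in> R" "x \<in> ?I" for r x
    using iprod_scale_closed[of R r x "{trace (c * v) | c. c \<in> R}"] that R.mult_closed
    by (simp add: iprod_commute)
  have t: "trace (c * v) \<in> ?I" if "c \<in> R" for c
  proof -
    have "trace (c * v) * 1 \<in> ?I" using that by (intro iprod_mult R.one_closed) blast
    then show ?thesis by simp
  qed
  have g: "(y - \<sigma> y) * (y - \<sigma> (\<sigma> y)) * v \<in> ?I" if y: "y \<in> R" for y
  proof -
    define p q where "p = - (\<sigma> y + \<sigma> (\<sigma> y))" and "q = \<sigma> y * \<sigma> (\<sigma> y)"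
    have pq: "p \<in> R" "q \<in> R" unfolding p_def q_def by (intro R.closed sigma_in y)+
    have sp: "\<sigma> p = - (\<sigma> (\<sigma> y) + y)" "\<sigma> (\<sigma> p) = - (y + \<sigma> y)"
      using y by (simp_all only: p_def sigma_minus sigma_add sigma_in sigma_order3 R.add_closed)
    have sq: "\<sigma> q = \<sigma> (\<sigma> y) * y" "\<sigma> (\<sigma> q) = y * \<sigma> y"
      using y by (simp_all add: q_def sigma_mult sigma_in sigma_order3)
    \<comment> \<open>On the right the coefficient of \<sigma>^i(v) is (y - \<sigma>^(i+1)(y)) (y -
      \<sigma>^(i+2)(y)), which contains the factor y - y unless i = 0.\<close>
    have "(y - \<sigma> y) * (y - \<sigma> (\<sigma> y)) * v = y\<^sup>2 * trace (1 * v) + (y * trace (p * v) + 1 * trace (q * v))"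
      unfolding trace_def using assms pq
      by (simp only: sigma2_mult R.one_closed sigma_1) (simp only: sigma_mult R.one_closed sigma_1, simp only: sp(2) sq(2), simp only: sp(1) sq(1), simp add: p_def q_def power2_eq_square algebra_simps)
    also have "\<dots> \<in> ?I"
      by (intro iprod_add scale t pq R.one_closed R.power_closed y)
    finally show ?thesis .
  qed
  have G: "(y\<^sup>2 + (\<sigma> y)\<^sup>2 + (\<sigma> (\<sigma> y))\<^sup>2 - y * \<sigma> y - y * \<sigma> (\<sigma> y) - \<sigma> y * \<sigma> (\<sigma> y)) * v \<in> ?I"
    if y: "y \<in> R" for y
  proof -
    have "(y - \<sigma> y) * (y - \<sigma> (\<sigma> y)) * v + ((\<sigma> y - \<sigma> (\<sigma> y)) * (\<sigma> y - y) * v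
      + (\<sigma> (\<sigma> y) - y) * (\<sigma> (\<sigma> y) - \<sigma> y) * v) \<in> ?I"
      using g[OF y] g[OF sigma_in[OF y]] g[OF sigma_in[OF sigma_in[OF y]]] y
      by (intro iprod_add) (simp_all add: sigma_order3 sigma_in)
    then show ?thesis by (simp add: algebra_simps power2_eq_square)
  qed
  obtain y z m n where yz: "y \<in> R" "z \<in> R" and e:
    "of_int m * (y\<^sup>2 + (\<sigma> y)\<^sup>2 + (\<sigma> (\<sigma> y))\<^sup>2 - y * \<sigma> y - y * \<sigma> (\<sigma> y) - \<sigma> y * \<sigma> (\<sigma> y)) +
     of_int n * (z\<^sup>2 + (\<sigma> z)\<^sup>2 + (\<sigma> (\<sigma> z))\<^sup>2 - z * \<sigma> z - z * \<sigma> (\<sigma> z) - \<sigma> z * \<sigma> (\<sigma> z)) = 1"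
    using unramified by blast
  have "of_int m * ((y\<^sup>2 + (\<sigma> y)\<^sup>2 + (\<sigma> (\<sigma> y))\<^sup>2 - y * \<sigma> y - y * \<sigma> (\<sigma> y) - \<sigma> y * \<sigma> (\<sigma> y)) * v) +
     of_int n * ((z\<^sup>2 + (\<sigma> z)\<^sup>2 + (\<sigma> (\<sigma> z))\<^sup>2 - z * \<sigma> z - z * \<sigma> (\<sigma> z) - \<sigma> z * \<sigma> (\<sigma> z)) * v) \<in> ?I"
    by (intro iprod_add scale G yz R.of_int_closed)
  also have "of_int m * ((y\<^sup>2 + (\<sigma> y)\<^sup>2 + (\<sigma> (\<sigma> y))\<^sup>2 - y * \<sigma> y - y * \<sigma> (\<sigma> y) - \<sigma> y * \<sigma> (\<sigma> y)) * v) +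
     of_int n * ((z\<^sup>2 + (\<sigma> z)\<^sup>2 + (\<sigma> (\<sigma> z))\<^sup>2 - z * \<sigma> z - z * \<sigma> (\<sigma> z) - \<sigma> z * \<sigma> (\<sigma> z)) * v) = 1 * v"
    unfolding e[symmetric] by (simp only: distrib_right mult.assoc)
  finally show ?thesis by simp
qed

text \<open>For e of trace 1, the map x -> trace(ex) is an \<open>OF\<close>-linear retraction of
  \<open>R\<close> onto \<open>OF\<close>; it carries JR into J and fixes c.\<close>

lemma extension_contraction:
  assumes J: "is_ideal OF J" and c: "c \<in> OF" "c \<in> iprod J R"
  shows "c \<in> J"
proof -
  obtain e where e: "e \<in> R" "trace e = 1" using trace_one by (auto simp: trace_def)
  have JO: "J \<subseteq> OF" using J by (simp add: is_ideal_def)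
  have "x \<in> R \<and> trace (e * x) \<in> J" if "x \<in> iprod J R" for x
    using that
  proof induction
    case iprod_zero
    then show ?case using J by (simp add: is_ideal_def trace_zero R.zero_closed)
  next
    case (iprod_step a b x)
    then have a: "a \<in> OF" "a \<in> R" using JO OF_subset by auto
    have "e * (a * b + x) = a * (e * b) + e * x" by (simp add: algebra_simps)
    then have "trace (e * (a * b + x)) = trace (e * b) * a + trace (e * x)"
      using a e iprod_step by (simp add: trace_add trace_scale R.closed)
    also have "\<dots> \<in> J"
      using trace_in_OF[of "e * b"] iprod_step e J by (auto simp: is_ideal_def R.mult_closed)
    finally show ?case using a iprod_step by (auto intro: R.closed)
  qed
  from this[OF c(2)] have "trace (e * c) \<in> J" by blast
  moreover have "trace (e * c) = c"
    using trace_scale[OF c(1) e(1)] e(2) by (simp add: mult.commute)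
  ultimately show ?thesis by simp
qed

text \<open>Since \<sigma>(\<alpha>) = u\<alpha>, the ideal (\<alpha>) is stable under \<sigma>. Its
  contraction \<aa> satisfies \<aa>R = (\<alpha>) by descent, and \<aa>^3 is generated by the norm c
  of \<alpha>. A generator \<kappa> of \<aa> makes v = \<alpha>/\<kappa> a unit with the same
  quotient \<sigma>(v)/v = u.\<close>

lemma norm_one_unit_is_quotient:
  assumes h: "\<not> 3 dvd class_number d" and u: "u \<in> R" "u * \<sigma> u * \<sigma> (\<sigma> u) = 1"
  shows "\<exists>v\<in>R. \<exists>w\<in>R. v * w = 1 \<and> \<sigma> v = u * v"
proof -
  obtain \<alpha> where \<alpha>: "\<alpha> \<in> R" "\<alpha> \<noteq> 0" "\<sigma> \<alpha> = u * \<alpha>" using hilbert90[OF u] by blast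
  define \<aa> where "\<aa> = {y \<in> OF. y / \<alpha> \<in> R}"
  define c where "c = \<alpha> * \<sigma> \<alpha> * \<sigma> (\<sigma> \<alpha>)"
  define w where "w = \<sigma> u * \<sigma> (\<sigma> u)"
  have w: "w \<in> R" "u * w = 1" using u by (auto simp: w_def mult.assoc sigma_in R.mult_closed)
  have s2: "\<sigma> (\<sigma> \<alpha>) = \<sigma> u * u * \<alpha>" using \<alpha> u by (simp add: sigma_mult sigma_in)
  have c: "c \<in> OF" unfolding c_def by (rule norm_in_OF[OF \<alpha>(1)])
  have c0: "c \<noteq> 0" using \<alpha>(1,2) by (simp add: c_def sigma_eq_0 sigma_in)
  \<comment> \<open>The norm of \<alpha> is a unit times \<alpha>^3, because all conjugates of
    \<alpha> are unit multiples of \<alpha>.\<close>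
  have ceq: "c = u\<^sup>2 * \<sigma> u * \<alpha> ^ 3" unfolding c_def s2 unfolding \<alpha>(3) by (simp add: power2_eq_square power3_eq_cube)
  have su: "\<sigma> u * (u * \<sigma> (\<sigma> u)) = 1" using u by (simp add: mult_ac)
  have quot: "c / \<alpha> ^ 3 \<in> R" "\<alpha> ^ 3 / c \<in> R"
  proof -
    show "c / \<alpha> ^ 3 \<in> R" using \<alpha>(2) unfolding ceq by (simp add: R.closed sigma_in u)
    have "\<alpha> ^ 3 = w\<^sup>2 * (u * \<sigma> (\<sigma> u)) * c" unfolding ceq using w(2) su by algebra
    then have "\<alpha> ^ 3 / c = w\<^sup>2 * (u * \<sigma> (\<sigma> u))" using c0 by simp
    then show "\<alpha> ^ 3 / c \<in> R" by (simp add: R.closed sigma_in u w)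
  qed
  \<comment> \<open>For the same reason every trace of a multiple of \<alpha> is divisible by
    \<alpha>; \<open>descent\<close> then recovers \<alpha> from \<aa>.\<close>
  have tr: "trace (r * \<alpha>) \<in> \<aa>" if r: "r \<in> R" for r
  proof -
    have "trace (r * \<alpha>) / \<alpha> = r + \<sigma> r * u + \<sigma> (\<sigma> r) * (\<sigma> u * u)"
      unfolding trace_def sigma2_mult[OF r \<alpha>(1)] unfolding sigma_mult[OF r \<alpha>(1)] s2 unfolding \<alpha>(3)
      using \<alpha>(2) by (simp add: add_divide_distrib)
    also have "\<dots> \<in> R" by (intro R.closed sigma_in r u)
    finally show ?thesis unfolding \<aa>_def using trace_in_OF r \<alpha>(1) by (auto intro: R.mult_closed)
  qed
  have ideal: "is_ideal OF \<aa>"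
    unfolding is_ideal_def \<aa>_def
  proof (intro conjI ballI)
    show "0 \<in> {y \<in> OF. y / \<alpha> \<in> R}" using O.zero_closed R.zero_closed by simp
    show "x + y \<in> {y \<in> OF. y / \<alpha> \<in> R}" if "x \<in> {y \<in> OF. y / \<alpha> \<in> R}" "y \<in> {y \<in> OF. y / \<alpha> \<in> R}" for x y
      using that by (auto simp: add_divide_distrib O.add_closed R.add_closed)
    show "r * x \<in> {y \<in> OF. y / \<alpha> \<in> R}" if "r \<in> OF" "x \<in> {y \<in> OF. y / \<alpha> \<in> R}" for r x
      using that OF_subset R.mult_closed[of r "x / \<alpha>"] by (auto simp: O.mult_closed)
  qed auto
  have \<alpha>a: "\<alpha> \<in> iprod \<aa> R"
    using descent[OF \<alpha>(1)] iprod_mono[of "{trace (c * \<alpha>) | c. c \<in> R}" \<aa> R R] tr by blast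
  have "\<aa> \<noteq> {0}"
  proof
    assume "\<aa> = {0}"
    then have "iprod \<aa> R \<subseteq> {0}" by (intro iprod_subsetI) auto
    then show False using \<alpha>a \<alpha> by auto
  qed
  then have nz: "\<aa> \<in> nonzero_ideals d" using ideal by (simp add: nonzero_ideals_def)
  have RR: "iprod R R \<subseteq> R" by (intro iprod_subsetI) (auto intro: R.closed)
  have cube: "iprod \<aa> (iprod \<aa> \<aa>) = (\<lambda>x. c * x) ` OF"
  proof
    have i2: "x / \<alpha>\<^sup>2 \<in> R" if "x \<in> iprod \<aa> \<aa>" for x
    proof -
      have "iprod \<aa> \<aa> \<subseteq> {x. x / \<alpha>\<^sup>2 \<in> R}"
      proof (rule iprod_subsetI)
        show "a * b \<in> {x. x / \<alpha>\<^sup>2 \<in> R}" if "a \<in> \<aa>" "b \<in> \<aa>" for a b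
          using that R.mult_closed[of "a / \<alpha>" "b / \<alpha>"] by (auto simp: \<aa>_def power2_eq_square)
      qed (auto simp: add_divide_distrib R.closed)
      then show ?thesis using that by blast
    qed
    have i3: "x / \<alpha> ^ 3 \<in> R" if "x \<in> iprod \<aa> (iprod \<aa> \<aa>)" for x
    proof -
      have "iprod \<aa> (iprod \<aa> \<aa>) \<subseteq> {x. x / \<alpha> ^ 3 \<in> R}"
      proof (rule iprod_subsetI)
        show "a * b \<in> {x. x / \<alpha> ^ 3 \<in> R}" if "a \<in> \<aa>" "b \<in> iprod \<aa> \<aa>" for a b
          using that(1) i2[OF that(2)] R.mult_closed[of "a / \<alpha>" "b / \<alpha>\<^sup>2"]
          by (auto simp: \<aa>_def power2_eq_square power3_eq_cube mult.assoc)
      qed (auto simp: add_divide_distrib R.closed)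
      then show ?thesis using that by blast
    qed
    show "iprod \<aa> (iprod \<aa> \<aa>) \<subseteq> (\<lambda>x. c * x) ` OF"
    proof
      fix x assume x: "x \<in> iprod \<aa> (iprod \<aa> \<aa>)"
      then have xO: "x \<in> OF" using is_ideal_iprod[OF ideal is_ideal_iprod[OF ideal ideal]] by (auto simp: is_ideal_def)
      have "x / c = (x / \<alpha> ^ 3) * (\<alpha> ^ 3 / c)" using \<alpha> by simp
      also have "\<dots> \<in> R" using i3[OF x] quot by (intro R.mult_closed)
      finally have r: "x / c \<in> R" .
      have "c * \<sigma> (x / c) = \<sigma> (c * (x / c))"
        using r c OF_subset by (auto simp: sigma_mult sigma_OF simp del: times_divide_eq_right)
      also have "\<dots> = x" using c0 xO by (simp add: sigma_OF)
      finally have "\<sigma> (x / c) = x / c" using c0 by (simp add: field_simps)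
      then have "x / c \<in> OF" using r fixed_in_OF by blast
      then show "x \<in> (\<lambda>x. c * x) ` OF" using c0 by (intro image_eqI[of _ _ "x / c"]) auto
    qed
    \<comment> \<open>For the other inclusion, \<alpha>^3 lies in (\<aa>R)^3, hence in \<aa>^3 R,
      and so does its unit multiple c; contraction to \<open>OF\<close> puts c into \<aa>^3.\<close>
    let ?A = "iprod \<aa> (iprod \<aa> \<aa>)"
    have "\<alpha> ^ 3 \<in> iprod ?A R"
    proof -
      have "\<alpha> * (\<alpha> * \<alpha>) \<in> iprod (iprod \<aa> R) (iprod (iprod \<aa> R) (iprod \<aa> R))"
        by (intro iprod_mult \<alpha>a)
      also have "\<dots> = iprod ?A (iprod R (iprod R R))"
        by (metis iprod_assoc iprod_commute)
      also have "\<dots> \<subseteq> iprod ?A R" using RR iprod_mono by (meson order.trans order.refl)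
      finally show ?thesis by (simp add: power3_eq_cube mult.assoc)
    qed
    then have "(c / \<alpha> ^ 3) * \<alpha> ^ 3 \<in> iprod ?A R"
      unfolding iprod_commute[of ?A]
      by (intro iprod_scale_closed[of R "c / \<alpha> ^ 3"] R.mult_closed quot(1))
    then have "c \<in> iprod ?A R" using \<alpha> by simp
    moreover have iA: "is_ideal OF ?A" by (intro is_ideal_iprod ideal)
    ultimately have "c \<in> ?A" using extension_contraction c by blast
    then show "(\<lambda>x. c * x) ` OF \<subseteq> ?A" using iA by (auto simp: is_ideal_def mult.commute[of c])
  qed
  obtain \<kappa> where \<kappa>: "\<kappa> \<in> OF" "\<aa> = (\<lambda>x. \<kappa> * x) ` OF"
    using three_dvd_class_number[OF nz cube c c0] h by blast
  have k0: "\<kappa> \<noteq> 0" using \<kappa> \<open>\<aa> \<noteq> {0}\<close> O.one_closed by auto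
  have "iprod \<aa> R \<subseteq> {x. x / \<kappa> \<in> R}"
    by (rule iprod_subsetI) (use \<kappa> k0 OF_subset in \<open>auto simp: add_divide_distrib R.closed mult.assoc\<close>)
  then have v: "\<alpha> / \<kappa> \<in> R" using \<alpha>a by blast
  have "\<kappa> * 1 \<in> \<aa>" unfolding \<kappa>(2) by (intro imageI O.one_closed)
  then have v': "\<kappa> / \<alpha> \<in> R" by (simp add: \<aa>_def)
  have "\<kappa> * \<sigma> (\<alpha> / \<kappa>) = \<sigma> (\<kappa> * (\<alpha> / \<kappa>))"
    using v \<kappa>(1) OF_subset by (auto simp: sigma_mult sigma_OF simp del: times_divide_eq_right)
  also have "\<dots> = u * \<alpha>" using k0 \<alpha> by simp
  finally have "\<sigma> (\<alpha> / \<kappa>) = u * (\<alpha> / \<kappa>)" using k0 by (simp add: field_simps)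
  then show ?thesis using v v' k0 \<alpha>(2) by (intro bexI[of _ "\<alpha> / \<kappa>"] bexI[of _ "\<kappa> / \<alpha>"]) auto
qed

section \<open>Extracting cube roots of norm-one units\<close>

definition norm_one_units where
  "norm_one_units = {u \<in> R. u * \<sigma> u * \<sigma> (\<sigma> u) = 1}"

text \<open>The norm of the unit v is a unit of \<open>OF\<close>, hence 1 or -1. The degree is odd,
  so replacing v by -v corrects the sign and keeps the quotient.\<close>

lemma norm_one_unit_is_normalized_quotient:
  assumes h: "\<not> 3 dvd class_number d" and u: "u \<in> norm_one_units"
  shows "\<exists>v\<in>norm_one_units. \<sigma> v = u * v"
proof -
  obtain v w where v: "v \<in> R" "w \<in> R" "v * w = 1" "\<sigma> v = u * v"
    using norm_one_unit_is_quotient[OF h] u unfolding norm_one_units_def by blast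
  let ?N = "\<lambda>v. v * \<sigma> v * \<sigma> (\<sigma> v)"
  have "?N v * ?N w = (v * w) * \<sigma> (v * w) * \<sigma> (\<sigma> (v * w))"
    using v(1,2) by (simp add: sigma_mult sigma_in)
  also have "\<dots> = 1" by (simp add: v(3) sigma_1)
  finally have N: "?N v = 1 \<or> ?N v = - 1" using units_OF norm_in_OF v(1,2) by blast
  show ?thesis
  proof (cases "?N v = 1")
    case True
    then show ?thesis using v unfolding norm_one_units_def by blast
  next
    case False
    have "?N (- v) = 1" using False N v(1) by (simp add: sigma_minus sigma_in)
    then show ?thesis using v sigma_minus[of v] unfolding norm_one_units_def
      by (intro bexI[of _ "- v"]) (auto simp: R.uminus_closed)
  qed
qed

text \<open>On norm-one units $(\<sigma> - 1)^2$ acts as $-3\<sigma>$, so two applications extract a cube root.\<close>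
lemma norm_one_unit_cube:
  assumes h: "\<not> 3 dvd class_number d" and u: "u \<in> norm_one_units"
  shows "\<exists>v\<in>norm_one_units. v ^ 3 = u"
proof -
  obtain v where v: "v \<in> norm_one_units" "\<sigma> v = u * v"
    using norm_one_unit_is_normalized_quotient[OF h u] by blast
  obtain w where w: "w \<in> norm_one_units" "\<sigma> w = v * w"
    using norm_one_unit_is_normalized_quotient[OF h v(1)] by blast
  have wR: "w \<in> R" "w * \<sigma> w * \<sigma> (\<sigma> w) = 1" and vR: "v \<in> R" and v0: "v \<noteq> 0"
    using v w by (auto simp: norm_one_units_def)
  have s2: "\<sigma> (\<sigma> w) = u * v * (v * w)"
    using vR wR v w by (metis sigma_mult)
  have N: "v ^ 3 * w ^ 3 * u = 1" using wR(2) unfolding s2 unfolding w(2) by (simp add: power3_eq_cube mult_ac)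
  \<comment> \<open>The cube root is the inverse of \<sigma>(w), written w \<sigma>^2(w) because w
    has norm 1. It equals u v^2 w^2, with cube u (u v^3 w^3)^2 = u by \<open>N\<close>.\<close>
  have "(w * \<sigma> (\<sigma> w)) ^ 3 = u"
    unfolding s2 using N by algebra
  moreover have "w * \<sigma> (\<sigma> w) \<in> norm_one_units"
  proof -
    have "w * \<sigma> (\<sigma> w) * \<sigma> (w * \<sigma> (\<sigma> w)) * \<sigma> (\<sigma> (w * \<sigma> (\<sigma> w))) = (w * \<sigma> w * \<sigma> (\<sigma> w))\<^sup>2"
      using wR(1) by (simp add: sigma_mult sigma_in sigma_order3 power2_eq_square mult_ac)
    then show ?thesis using wR by (simp add: norm_one_units_def R.closed sigma_in)
  qed
  ultimately show ?thesis by blast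
qed

text \<open>The coefficients of the characteristic polynomial of v over F are bounded elements of
  \<open>OF\<close>, of which there are finitely many.\<close>

lemma finite_bounded_integers:
  "finite {v \<in> R. norm v \<le> B \<and> norm (\<sigma> v) \<le> B \<and> norm (\<sigma> (\<sigma> v)) \<le> B}" (is "finite ?V")
proof (rule finite_subset)
  let ?b = "\<lambda>C. {z \<in> OF. norm z \<le> C}"
  let ?W = "\<Union>(p, q, r)\<in>?b (3 * B) \<times> ?b (3 * B ^ 2) \<times> ?b (B ^ 3). {v. poly [:- r, q, - p, 1:] v = 0}"
  show "finite ?W"
    by (intro finite_UN_I finite_cartesian_product finite_bounded_quad_ints)
       (auto intro!: poly_roots_finite simp del: poly_pCons)
  show "?V \<subseteq> ?W"
  proof clarify
    fix v assume v: "v \<in> R" "norm v \<le> B" "norm (\<sigma> v) \<le> B" "norm (\<sigma> (\<sigma> v)) \<le> B"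
    let ?v = "\<sigma> v" and ?w = "\<sigma> (\<sigma> v)"
    define p q r where "p = v + ?v + ?w" and "q = v * ?v + (v * ?w + ?v * ?w)" and "r = v * ?v * ?w"
    have B: "B \<ge> 0" using v(2) norm_ge_zero order_trans by blast
    have m: "norm (x * y) \<le> B\<^sup>2" if "norm x \<le> B" "norm y \<le> B" for x y :: complex
      unfolding norm_mult power2_eq_square using that B by (intro mult_mono) auto
    have "norm p \<le> 3 * B"
      unfolding p_def using v norm_triangle_ineq[of "v + ?v" ?w] norm_triangle_ineq[of v ?v] by linarith
    moreover have "norm q \<le> 3 * B\<^sup>2"
      unfolding q_def using m[OF v(2,3)] m[OF v(2,4)] m[OF v(3,4)]
        norm_triangle_ineq[of "v * ?v" "v * ?w + ?v * ?w"] norm_triangle_ineq[of "v * ?w" "?v * ?w"] by linarith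
    moreover have "norm r \<le> B ^ 3"
      unfolding r_def using mult_mono[OF m[OF v(2,3)] v(4)] B by (simp add: norm_mult power3_eq_cube power2_eq_square)
    moreover have "p \<in> OF" using trace_in_OF[OF v(1)] by (simp add: p_def trace_def)
    moreover have "r \<in> OF" using norm_in_OF[OF v(1)] by (simp add: r_def)
    moreover have "q \<in> OF"
      unfolding q_def using v(1)
      by (intro fixed_in_OF R.closed) (simp_all add: sigma_add sigma_mult sigma_in sigma_order3 R.closed mult_ac add_ac)
    moreover have "poly [:- r, q, - p, 1:] v = 0"
      by (simp add: p_def q_def r_def algebra_simps)
    ultimately show "v \<in> ?W" by blast
  qed
qed

text \<open>Iterated cube roots v_n with v_n^(3^n) = u have conjugates bounded independently of n.
  By finiteness v_m = v_n for some m < n, so |v_m|^(3^m) = |v_m|^(3^n), which forces |v_m| = 1 and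
  |u| = 1.\<close>

theorem three_dvd_class_number_if_unit:
  assumes u: "u \<in> R" "u * \<sigma> u * \<sigma> (\<sigma> u) = 1" "norm u \<noteq> 1"
  shows "3 dvd class_number d"
proof (rule ccontr)
  assume h: "\<not> 3 dvd class_number d"
  have uU: "u \<in> norm_one_units" using u by (simp add: norm_one_units_def)
  have "\<exists>v\<in>norm_one_units. v ^ (3 ^ n) = u" for n
  proof (induction n)
    case 0
    show ?case using uU by auto
  next
    case (Suc n)
    then obtain v where v: "v \<in> norm_one_units" "v ^ (3 ^ n) = u" by blast
    obtain w where "w \<in> norm_one_units" "w ^ 3 = v" using norm_one_unit_cube[OF h v(1)] by blast
    then show ?case using v by (intro bexI[of _ w]) (auto simp: power_mult)
  qed
  then obtain v where v: "\<And>n. v n \<in> norm_one_units" "\<And>n. v n ^ (3 ^ n) = u" by metis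
  have vR: "v n \<in> R" for n using v(1) by (simp add: norm_one_units_def)
  \<comment> \<open>Including 1 ensures that |x|^(3^n) \<le> B implies |x| \<le> B.\<close>
  define B where "B = Max {1, norm u, norm (\<sigma> u), norm (\<sigma> (\<sigma> u))}"
  have B: "1 \<le> B" "norm u \<le> B" "norm (\<sigma> u) \<le> B" "norm (\<sigma> (\<sigma> u)) \<le> B"
    by (simp_all add: B_def)
  have sp: "\<sigma> (x ^ n) = \<sigma> x ^ n" if "x \<in> R" for x n
    by (induction n) (use that in \<open>simp_all add: sigma_1 sigma_mult R.power_closed\<close>)
  have bound: "norm x \<le> B" if "norm (x ^ (3 ^ n)) \<le> B" for x :: complex and n :: nat
  proof (rule ccontr)
    assume "\<not> norm x \<le> B"
    then have "B < norm x" by simp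
    also have "norm x ^ 1 \<le> norm x ^ (3 ^ n)" using \<open>\<not> norm x \<le> B\<close> B(1) by (intro power_increasing) auto
    finally show False using that by (simp add: norm_power)
  qed
  have "range v \<subseteq> {v \<in> R. norm v \<le> B \<and> norm (\<sigma> v) \<le> B \<and> norm (\<sigma> (\<sigma> v)) \<le> B}"
  proof clarify
    fix n
    have "\<sigma> (v n) ^ (3 ^ n) = \<sigma> u" "\<sigma> (\<sigma> (v n)) ^ (3 ^ n) = \<sigma> (\<sigma> u)"
      using sp[OF vR] sp[OF sigma_in[OF vR]] v(2) by metis+
    then show "v n \<in> R \<and> norm (v n) \<le> B \<and> norm (\<sigma> (v n)) \<le> B \<and> norm (\<sigma> (\<sigma> (v n))) \<le> B"
      using bound B v(2) vR by metis
  qed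
  then have "finite (range v)" using finite_bounded_integers finite_subset by blast
  then have "\<not> inj v" using finite_imageD[of v UNIV] by auto
  then obtain m n where mn: "m < n" "v m = v n" unfolding inj_def by (metis linorder_neqE_nat)
  have e: "norm (v m) ^ (3 ^ m) = norm (v m) ^ (3 ^ n)"
    using v(2)[of m] v(2)[of n] mn(2) by (metis norm_power)
  have "v m \<noteq> 0" using v(1)[of m] by (auto simp: norm_one_units_def)
  have lt: "(3::nat) ^ m < 3 ^ n" using mn by simp
  have "norm (v m) = 1"
  proof (rule ccontr)
    assume "norm (v m) \<noteq> 1"
    then consider "norm (v m) < 1" | "norm (v m) > 1" by linarith
    then show False
    proof cases
      case 1
      then show False using e power_strict_decreasing[OF lt, of "norm (v m)"] \<open>v m \<noteq> 0\<close> by simp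
    next
      case 2
      then show False using e power_strict_increasing[OF lt, of "norm (v m)"] by simp
    qed
  qed
  then have "norm u = 1" using v(2)[of m] by (metis norm_power power_one)
  then show False using u(3) by simp
qed

end

section \<open>Units of complex cubic orders\<close>

text \<open>For a root $x$ of $x^3 = px + q$, the cofactor is the product of the two other conjugates of
  $a + bx + cx^2$, written in the basis $1, x, x^2$.\<close>

definition cofactor0 :: "int \<Rightarrow> int \<Rightarrow> int \<Rightarrow> int \<Rightarrow> int \<Rightarrow> int" where
  "cofactor0 p q a b c = a\<^sup>2 + 2 * p * a * c - p * b\<^sup>2 - q * b * c + p\<^sup>2 * c\<^sup>2"
definition cofactor1 :: "int \<Rightarrow> int \<Rightarrow> int \<Rightarrow> int \<Rightarrow> int \<Rightarrow> int" where
  "cofactor1 p q a b c = q * c\<^sup>2 - a * b"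
definition cofactor2 :: "int \<Rightarrow> int \<Rightarrow> int \<Rightarrow> int \<Rightarrow> int \<Rightarrow> int" where
  "cofactor2 p q a b c = b\<^sup>2 - a * c - p * c\<^sup>2"
definition cubic_norm :: "int \<Rightarrow> int \<Rightarrow> int \<Rightarrow> int \<Rightarrow> int \<Rightarrow> int" where
  "cubic_norm p q a b c = a * cofactor0 p q a b c + q * (b * cofactor2 p q a b c + c * cofactor1 p q a b c)"

definition quadratic_at :: "complex \<Rightarrow> int \<Rightarrow> int \<Rightarrow> int \<Rightarrow> complex" where
  "quadratic_at w a b c = of_int a + of_int b * w + of_int c * w\<^sup>2"

lemma quadratic_at_cofactor:
  assumes "w ^ 3 = of_int p * w + of_int q"
  shows "quadratic_at w a b c * quadratic_at w (cofactor0 p q a b c) (cofactor1 p q a b c) (cofactor2 p q a b c)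
    = of_int (cubic_norm p q a b c)"
  unfolding quadratic_at_def cubic_norm_def cofactor0_def cofactor1_def cofactor2_def
  using assms by (simp only: of_int_add of_int_diff of_int_mult of_int_power of_int_numeral) algebra

lemma quadratic_at_mult:
  assumes "w ^ 3 = of_int p * w + of_int q"
  shows "quadratic_at w a b c * quadratic_at w a' b' c' =
    quadratic_at w (a * a' + q * (b * c' + c * b'))
      (a * b' + b * a' + p * (b * c' + c * b') + q * (c * c'))
      (a * c' + b * b' + c * a' + p * (c * c'))"
  unfolding quadratic_at_def
  using assms by (simp only: of_int_add of_int_diff of_int_mult) algebra

lemma norm_quadratic_at_le:
  "norm (quadratic_at w a b c) \<le> \<bar>of_int a\<bar> + \<bar>of_int b\<bar> * norm w + \<bar>of_int c\<bar> * (norm w)\<^sup>2"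
  unfolding quadratic_at_def
  using norm_triangle_ineq[of "of_int a + of_int b * w" "of_int c * w\<^sup>2"]
    norm_triangle_ineq[of "of_int a" "of_int b * w"]
  by (simp add: norm_mult norm_power)

text \<open>The sum and product of \<open>y\<close> and \<open>z\<close> say that they are the roots
  of the quadratic cofactor of t - x in t^3 - pt - q; \<open>independent\<close> says that x has
  degree three.\<close>

locale complex_cubic =
  fixes p q :: int and x :: real and y z :: complex
  assumes x_root: "x ^ 3 = of_int p * x + of_int q"
    and y_plus_z: "y + z = - of_real x" and y_times_z: "y * z = (of_real x)\<^sup>2 - of_int p"
    and independent: "of_int a + of_int b * x + of_int c * x\<^sup>2 = 0 \<Longrightarrow> a = 0 \<and> b = 0 \<and> c = 0"
begin

lemma roots:
  "(of_real x :: complex) ^ 3 = of_int p * of_real x + of_int q"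
  "y ^ 3 = of_int p * y + of_int q" "z ^ 3 = of_int p * z + of_int q"
proof -
  have "complex_of_real (x ^ 3) = of_real (of_int p * x + of_int q)" using x_root by simp
  then show *: "(of_real x :: complex) ^ 3 = of_int p * of_real x + of_int q" by simp
  show "y ^ 3 = of_int p * y + of_int q" "z ^ 3 = of_int p * z + of_int q"
    using * y_plus_z y_times_z by algebra+
qed

lemma norm_product:
  "quadratic_at (of_real x) a b c * quadratic_at y a b c * quadratic_at z a b c = of_int (cubic_norm p q a b c)"
proof -
  have "quadratic_at y a b c * quadratic_at z a b c =
    quadratic_at (of_real x) (cofactor0 p q a b c) (cofactor1 p q a b c) (cofactor2 p q a b c)"
    unfolding quadratic_at_def cofactor0_def cofactor1_def cofactor2_def
    using roots(1) y_plus_z y_times_z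
    by (simp only: of_int_add of_int_diff of_int_mult of_int_power of_int_numeral) algebra
  then show ?thesis using quadratic_at_cofactor[OF roots(1), of a b c] by (simp add: mult.assoc)
qed

text \<open>Chosen so that both conjugates of a + bx + cx^2 are at most Q times \<open>bound\<close>
  whenever |b|, |c| \<le> Q and the element itself is below 1; the part 1 + |x| + x^2 accounts for
  a.\<close>

definition bound :: real where
  "bound = 1 + (\<bar>x\<bar> + x\<^sup>2) + (norm y + (norm y)\<^sup>2) + (norm z + (norm z)\<^sup>2)"

lemma quadratic_at_real: "norm (quadratic_at (of_real x) a b c) = \<bar>of_int a + of_int b * x + of_int c * x\<^sup>2\<bar>"
proof -
  have "quadratic_at (of_real x) a b c = of_real (of_int a + of_int b * x + of_int c * x\<^sup>2)"
    by (simp add: quadratic_at_def)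
  then show ?thesis by (simp only: norm_of_real)
qed

text \<open>(Q+1)^2 pairs (b, c) fall into Q^2 boxes of fractional parts, so some difference is
  below 1/Q^2 at x. Each of the two other conjugates is O(Q), hence the norm is bounded
  independently of Q.\<close>

lemma small_elements:
  assumes "Q \<ge> (1::nat)"
  shows "\<exists>a b c. 0 < \<bar>of_int a + of_int b * x + of_int c * x\<^sup>2\<bar> \<and>
    \<bar>of_int a + of_int b * x + of_int c * x\<^sup>2\<bar> < 1 / real (Q\<^sup>2) \<and>
    cubic_norm p q a b c \<noteq> 0 \<and> \<bar>real_of_int (cubic_norm p q a b c)\<bar> \<le> bound\<^sup>2"
proof -
  let ?P = "{0..int Q} \<times> {0..int Q}"
  define g where "g = (\<lambda>(b::int, c::int). of_int b * x + of_int c * x\<^sup>2)"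
  define h where "h t = \<lfloor>real (Q\<^sup>2) * frac (g t)\<rfloor>" for t
  have Q0: "real (Q\<^sup>2) > 0" using assms by simp
  have "h t \<in> {0..<int (Q\<^sup>2)}" for t
  proof -
    have "0 \<le> frac (g t)" "frac (g t) < 1" by (auto simp: frac_lt_1)
    then have "0 \<le> real (Q\<^sup>2) * frac (g t)" "real (Q\<^sup>2) * frac (g t) < real (Q\<^sup>2) * 1"
      using Q0 by (auto simp del: mult_1_right)
    then show ?thesis by (simp add: h_def floor_less_iff)
  qed
  then have "card (h ` ?P) \<le> card {0..<int (Q\<^sup>2)}" by (intro card_mono) auto
  also have "\<dots> = Q * Q" by (simp add: power2_eq_square nat_mult_distrib)
  also have "\<dots> < (Q + 1) * (Q + 1)" by simp
  also have "\<dots> = card ?P" by (simp add: card_cartesian_product nat_add_distrib)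
  finally have "\<not> inj_on h ?P" by (rule pigeonhole)
  then obtain t t' where t: "t \<in> ?P" "t' \<in> ?P" "t \<noteq> t'" "h t = h t'" unfolding inj_on_def by blast
  obtain b1 c1 where t1: "t = (b1, c1)" by (cases t)
  obtain b2 c2 where t2: "t' = (b2, c2)" by (cases t')
  define a b c where "a = \<lfloor>g t'\<rfloor> - \<lfloor>g t\<rfloor>" and "b = b1 - b2" and "c = c1 - c2"
  let ?v = "of_int a + of_int b * x + of_int c * x\<^sup>2"
  have v: "?v = frac (g t) - frac (g t')"
    by (simp add: a_def b_def c_def frac_def g_def t1 t2 algebra_simps)
  have "\<bar>real (Q\<^sup>2) * frac (g t) - real (Q\<^sup>2) * frac (g t')\<bar> < 1"
    using t(4) unfolding h_def by linarith
  then have "real (Q\<^sup>2) * \<bar>?v\<bar> < 1"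
    unfolding v right_diff_distrib[symmetric] abs_mult using Q0 by simp
  then have small: "\<bar>?v\<bar> < 1 / real (Q\<^sup>2)" using Q0 by (simp add: field_simps)
  have bc: "\<bar>b\<bar> \<le> int Q" "\<bar>c\<bar> \<le> int Q" using t(1,2) by (auto simp: t1 t2 b_def c_def)
  have nz: "?v \<noteq> 0"
    using independent[of a b c] t(3) by (auto simp: t1 t2 b_def c_def)
  have bcr: "\<bar>real_of_int b\<bar> \<le> real Q" "\<bar>real_of_int c\<bar> \<le> real Q"
    using bc by linarith+
  have bd: "\<bar>real_of_int b\<bar> * m + \<bar>real_of_int c\<bar> * m\<^sup>2 \<le> real Q * (m + m\<^sup>2)" if "m \<ge> 0" for m :: real
    using mult_right_mono[OF bcr(1) that] mult_right_mono[OF bcr(2), of "m\<^sup>2"] by (simp add: distrib_left)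
  have "\<bar>of_int b * x + of_int c * x\<^sup>2\<bar> \<le> real Q * (\<bar>x\<bar> + x\<^sup>2)"
    using bd[of "\<bar>x\<bar>"] abs_triangle_ineq[of "of_int b * x" "of_int c * x\<^sup>2"] by (simp add: abs_mult)
  moreover have "\<bar>?v\<bar> < 1" unfolding v using frac_lt_1[of "g t"] frac_lt_1[of "g t'"]
    frac_ge_0[of "g t"] frac_ge_0[of "g t'"] by linarith
  ultimately have ab: "\<bar>real_of_int a\<bar> \<le> 1 + real Q * (\<bar>x\<bar> + x\<^sup>2)" by linarith
  have Q1: "1 \<le> real Q" using assms by simp
  have conj: "norm (quadratic_at w a b c) \<le> real Q * bound" if "w = y \<or> w = z" for w
  proof -
    have "norm (quadratic_at w a b c) \<le> 1 + real Q * (\<bar>x\<bar> + x\<^sup>2) + real Q * (norm w + (norm w)\<^sup>2)"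
      using norm_quadratic_at_le[of w a b c] ab bd[of "norm w"] by simp
    also have "\<dots> \<le> real Q * (1 + (\<bar>x\<bar> + x\<^sup>2) + (norm w + (norm w)\<^sup>2))"
      using Q1 by (simp add: distrib_left)
    also have "\<dots> \<le> real Q * bound"
      using that by (intro mult_left_mono) (auto simp: bound_def)
    finally show ?thesis .
  qed
  have b0: "0 \<le> bound" by (simp add: bound_def)
  have "norm (of_int (cubic_norm p q a b c) :: complex) = \<bar>?v\<bar> * (norm (quadratic_at y a b c) * norm (quadratic_at z a b c))"
    unfolding norm_product[symmetric] norm_mult quadratic_at_real by (simp add: mult.assoc)
  also have "\<dots> \<le> 1 / real (Q\<^sup>2) * ((real Q * bound) * (real Q * bound))"
    using small conj b0 by (intro mult_mono) auto
  also have "\<dots> = bound\<^sup>2" using assms by (simp add: power2_eq_square field_simps)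
  finally have N: "\<bar>real_of_int (cubic_norm p q a b c)\<bar> \<le> bound\<^sup>2" by simp
  have "cubic_norm p q a b c \<noteq> 0"
  proof
    assume N0: "cubic_norm p q a b c = 0"
    let ?A = "cofactor0 p q a b c" and ?B = "cofactor1 p q a b c" and ?C = "cofactor2 p q a b c"
    have "quadratic_at (of_real x) a b c \<noteq> 0" using nz quadratic_at_real[of a b c] by auto
    then have "quadratic_at (of_real x) ?A ?B ?C = 0"
      using quadratic_at_cofactor[OF roots(1), of a b c] N0 by simp
    then have "of_int ?A + of_int ?B * x + of_int ?C * x\<^sup>2 = 0" using quadratic_at_real[of ?A ?B ?C] by simp
    then have ABC: "?A = 0" "?B = 0" "?C = 0" using independent by blast+
    have abc: "a = 0 \<and> b = 0 \<and> c = 0"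
    proof -
      \<comment> \<open>If the cofactor vanishes identically and c is nonzero, b/c is a root of the
        cubic; factoring the difference of the cubic at x and at b/c contradicts
        \<open>independent\<close>.\<close>
      have key: "b ^ 3 = q * c ^ 3 + p * c\<^sup>2 * b"
        using ABC(2,3) unfolding cofactor1_def cofactor2_def by algebra
      have "c = 0"
      proof (rule ccontr)
        assume "c \<noteq> 0"
        have "real_of_int (b ^ 3) = real_of_int (q * c ^ 3 + p * c\<^sup>2 * b)" by (simp only: key)
        then have "of_int b ^ 3 = of_int q * of_int c ^ 3 + of_int p * (of_int c)\<^sup>2 * real_of_int b" by simp
        then have "(of_int c * x - of_int b) * ((of_int c)\<^sup>2 * x\<^sup>2 + of_int b * of_int c * x + (of_int b)\<^sup>2 - of_int p * (of_int c)\<^sup>2) = 0"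
          using x_root by algebra
        then have "of_int c * x - of_int b = 0 \<or>
            (of_int c)\<^sup>2 * x\<^sup>2 + of_int b * of_int c * x + (of_int b)\<^sup>2 - of_int p * (of_int c)\<^sup>2 = 0"
          by (simp only: mult_eq_0_iff)
        then show False
          using independent[of "- b" c 0] independent[of "b\<^sup>2 - p * c\<^sup>2" "b * c" "c\<^sup>2"] \<open>c \<noteq> 0\<close>
          by (auto simp: algebra_simps)
      qed
      then have "b = 0" using key by simp
      then show ?thesis using ABC(1) \<open>c = 0\<close> by (simp add: cofactor0_def)
    qed
    then show False using nz by simp
  qed
  then show ?thesis using small nz N by (intro exI[of _ a] exI[of _ b] exI[of _ c]) simp
qed

text \<open>Among infinitely many elements of bounded norm, two have the same norm N and
  coefficients congruent modulo N. Their quotient is a unit of the order: N is v_0 times its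
  cofactor, so v_1 = v_0 + N\<delta> gives v_1/v_0 = 1 + \<delta> cofactor(v_0).\<close>

theorem nontrivial_unit:
  "\<exists>a b c. cubic_norm p q a b c = 1 \<and> \<bar>of_int a + of_int b * x + of_int c * x\<^sup>2\<bar> \<noteq> 1"
proof -
  define v where "v a b c = \<bar>of_int a + of_int b * x + of_int c * x\<^sup>2\<bar>" for a b c :: int
  have "\<forall>Q. \<exists>a b c. 0 < v a b c \<and> v a b c < 1 / real ((Suc Q)\<^sup>2) \<and> cubic_norm p q a b c \<noteq> 0 \<and>
      \<bar>real_of_int (cubic_norm p q a b c)\<bar> \<le> bound\<^sup>2"
    using small_elements[OF Suc_le_mono[THEN iffD2, OF le0, folded One_nat_def]] unfolding v_def by blast
  then obtain a b c where abc: "\<And>Q. 0 < v (a Q) (b Q) (c Q)" "\<And>Q. v (a Q) (b Q) (c Q) < 1 / real ((Suc Q)\<^sup>2)"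
    "\<And>Q. cubic_norm p q (a Q) (b Q) (c Q) \<noteq> 0"
    "\<And>Q. \<bar>real_of_int (cubic_norm p q (a Q) (b Q) (c Q))\<bar> \<le> bound\<^sup>2"
    by metis
  define n where "n Q = cubic_norm p q (a Q) (b Q) (c Q)" for Q
  define key where "key Q = (n Q, a Q mod n Q, b Q mod n Q, c Q mod n Q)" for Q
  define K where "K = \<lceil>bound\<^sup>2\<rceil>"
  have nK: "\<bar>n Q\<bar> \<le> K" for Q using abc(4)[of Q] unfolding n_def K_def by linarith
  have "\<bar>e mod n Q\<bar> \<le> K" for e Q
    using abs_mod_less[of "n Q" e] nK[of Q] abc(3)[of Q] by (simp add: n_def)
  then have "key Q \<in> {-K..K} \<times> {-K..K} \<times> {-K..K} \<times> {-K..K}" for Q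
    using nK[of Q] by (simp add: key_def abs_le_iff) (metis minus_le_iff)
  then have "range key \<subseteq> {-K..K} \<times> {-K..K} \<times> {-K..K} \<times> {-K..K}" by blast
  then have "finite (range key)" by (rule finite_subset) auto
  then obtain Q0 where Q0: "infinite {Q. key Q = key Q0}"
    using pigeonhole_infinite[of UNIV key] by auto
  \<comment> \<open>A late index makes the second element strictly smaller at x, so the quotient
    does not have absolute value 1.\<close>
  obtain Q1 where Q1: "key Q1 = key Q0" "1 / v (a Q0) (b Q0) (c Q0) < real Q1"
  proof -
    have "\<exists>Q\<in>{Q. key Q = key Q0}. Q \<ge> nat \<lceil>1 / v (a Q0) (b Q0) (c Q0)\<rceil> + 1"
      using Q0 by (metis infinite_nat_iff_unbounded_le mem_Collect_eq)
    then obtain Q where Q: "key Q = key Q0" "Q \<ge> nat \<lceil>1 / v (a Q0) (b Q0) (c Q0)\<rceil> + 1" by blast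
    then have "1 / v (a Q0) (b Q0) (c Q0) < real Q" by linarith
    then show ?thesis using that Q(1) by blast
  qed
  have less: "v (a Q1) (b Q1) (c Q1) < v (a Q0) (b Q0) (c Q0)"
  proof -
    have "1 / real ((Suc Q1)\<^sup>2) \<le> 1 / real (Suc Q1)"
      by (intro divide_left_mono mult_pos_pos) (auto simp: power2_eq_square simp del: of_nat_Suc)
    also have "1 / real (Suc Q1) < v (a Q0) (b Q0) (c Q0)"
      using Q1(2) abc(1)[of Q0] by (simp add: field_simps)
    finally show ?thesis using abc(2)[of Q1] by linarith
  qed
  define N where "N = n Q0"
  have N: "N \<noteq> 0" "n Q1 = N" using abc(3)[of Q0] Q1(1) by (auto simp: N_def n_def key_def)
  have "N dvd a Q1 - a Q0" "N dvd b Q1 - b Q0" "N dvd c Q1 - c Q0"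
    using Q1(1) N(2) by (auto simp: key_def N_def mod_eq_dvd_iff)
  then obtain e f g where efg: "a Q1 = a Q0 + N * e" "b Q1 = b Q0 + N * f" "c Q1 = c Q0 + N * g"
    by (auto simp: dvd_def algebra_simps)
  define A B C where "A = cofactor0 p q (a Q0) (b Q0) (c Q0)" and "B = cofactor1 p q (a Q0) (b Q0) (c Q0)"
    and "C = cofactor2 p q (a Q0) (b Q0) (c Q0)"
  \<comment> \<open>Coordinates of 1 + (e + fx + gx^2)(A + Bx + Cx^2), the quotient of the two
    elements.\<close>
  define i j k where "i = 1 + (e * A + q * (f * C + g * B))"
    and "j = e * B + f * A + p * (f * C + g * B) + q * (g * C)"
    and "k = e * C + f * B + g * A + p * (g * C)"
  have eta: "quadratic_at w i j k * quadratic_at w (a Q0) (b Q0) (c Q0) = quadratic_at w (a Q1) (b Q1) (c Q1)"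
    if w: "w ^ 3 = of_int p * w + of_int q" for w
  proof -
    have 1: "quadratic_at w i j k = 1 + quadratic_at w e f g * quadratic_at w A B C"
      unfolding quadratic_at_mult[OF w] by (simp add: i_def j_def k_def quadratic_at_def)
    have 2: "quadratic_at w (a Q0) (b Q0) (c Q0) * quadratic_at w A B C = of_int N"
      using quadratic_at_cofactor[OF w] by (simp add: A_def B_def C_def N_def n_def)
    have 3: "quadratic_at w (a Q1) (b Q1) (c Q1) = quadratic_at w (a Q0) (b Q0) (c Q0) + of_int N * quadratic_at w e f g"
      by (simp add: efg quadratic_at_def algebra_simps)
    show ?thesis unfolding 1 3 2[symmetric] by (simp add: algebra_simps)
  qed
  \<comment> \<open>Multiplying the relation \<open>eta\<close> over all three roots shows that
    norms multiply.\<close>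
  have "of_int (cubic_norm p q i j k) * complex_of_int N = of_int N"
  proof -
    have "of_int (cubic_norm p q i j k) * complex_of_int N =
      (quadratic_at (of_real x) i j k * quadratic_at (of_real x) (a Q0) (b Q0) (c Q0)) *
      (quadratic_at y i j k * quadratic_at y (a Q0) (b Q0) (c Q0)) *
      (quadratic_at z i j k * quadratic_at z (a Q0) (b Q0) (c Q0))"
      unfolding N_def n_def norm_product[symmetric] by (simp add: mult_ac)
    also have "\<dots> = of_int (n Q1)"
      unfolding eta[OF roots(1)] eta[OF roots(2)] eta[OF roots(3)] n_def norm_product by simp
    finally show ?thesis by (simp add: N)
  qed
  then have "cubic_norm p q i j k = 1" using N(1) by simp
  moreover have "v i j k \<noteq> 1"
  proof
    assume "v i j k = 1"
    then have "v (a Q0) (b Q0) (c Q0) = v (a Q1) (b Q1) (c Q1)"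
      using arg_cong[OF eta[OF roots(1)], of norm] unfolding norm_mult quadratic_at_real v_def by simp
    then show False using less by simp
  qed
  ultimately show ?thesis unfolding v_def by blast
qed

end

section \<open>The cubic $y^3 - 3sy - T$\<close>

lemma squarefree_times_rational_square:
  fixes q :: complex
  assumes "squarefree n" "q \<in> \<rat>" "of_int n * q\<^sup>2 = 1"
  shows "n = 1"
proof (rule ccontr)
  assume "n \<noteq> 1"
  then interpret quad_number_field n using assms by unfold_locales
  have "(S * q)\<^sup>2 = 1" using assms(3) unfolding S_square[symmetric] by (simp add: power2_eq_square mult_ac)
  then have "S * q = 1 \<or> S * q = -1" by (simp add: power2_eq_1_iff)
  moreover have "q \<noteq> 0" using assms(3) by auto
  ultimately have "S = 1 / q \<or> S = - 1 / q" by (auto simp: field_simps)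
  then show False using S_irrational assms(2) by (auto intro: Rats_divide)
qed

lemma of_real_of_rat: "complex_of_real (of_rat q) = of_rat q"
  by (cases q) (simp add: of_rat_rat)

locale mirror_cubic =
  fixes s T M r :: int
  assumes s: "s = 1 \<or> s = - 1" and discriminant: "T\<^sup>2 - 4 * s = M * r\<^sup>2" and r: "r \<ge> 1"
    and squarefree_M: "squarefree M" and M: "M \<ge> 2" "\<not> 3 dvd M"
    and no_root: "\<And>y::int. y ^ 3 \<noteq> 3 * s * y + T"
begin

lemma s_square: "s * s = 1"
  using s by auto

lemma squarefree_3M: "squarefree (3 * M)"
proof (rule squarefree_mult_coprime)
  show "squarefree (3::int)" by (rule squarefree_prime) simp
  show "coprime 3 M" using M(2) by (intro prime_imp_coprime) auto
qed (rule squarefree_M)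

definition d :: int where "d = - 3 * M"

sublocale imaginary_quad_field d
proof
  show "squarefree d" using squarefree_3M by (simp add: squarefree_def d_def)
  show "d \<noteq> 1" "d < 0" using M by (auto simp: d_def)
qed

lemma S_sq: "S * S = - 3 * of_int M"
  using S_square by (simp add: d_def)

text \<open>A unit a + bS has norm 1, so t^2 + 12 M b^2 = 4 with t = 2a. The values t = 0 and |t| =
  1 would make 3M or M the square of a rational, hence 1 by square-freeness, and |t| = 2 gives b =
  0.\<close>

lemma units_pm1:
  assumes "z \<in> OF" "w \<in> OF" "z * w = 1"
  shows "z = 1 \<or> z = - 1"
proof -
  obtain t n where tn: "z + cnj z = of_int t" "z * cnj z = of_int n" using quad_ints_cnj[OF assms(1)] by blast
  obtain t' n' where tn': "w + cnj w = of_int t'" "w * cnj w = of_int n'" using quad_ints_cnj[OF assms(2)] by blast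
  have "complex_of_int (n * n') = (z * w) * cnj (z * w)" using tn tn' by (simp add: mult_ac)
  then have "n * n' = 1" using assms(3) by (metis complex_cnj_one mult_1 of_int_1 of_int_eq_iff)
  moreover have "real_of_int n \<ge> 0"
  proof -
    have "complex_of_real (real_of_int n) = of_real ((norm z)\<^sup>2)"
      unfolding complex_norm_square tn(2) by simp
    then show ?thesis by (simp only: of_real_eq_iff) simp
  qed
  ultimately have n: "n = 1" by (auto simp: zmult_eq_1_iff)
  obtain a b t where ab: "a \<in> \<rat>" "b \<in> \<rat>" "z = a + b * S" "2 * a = of_int t"
    using quad_intsE[OF assms(1)] by metis
  have c: "cnj z = a - b * S" unfolding ab(3) by (rule cnj_eq[OF ab(1,2)])
  have N: "a\<^sup>2 + 3 * of_int M * b\<^sup>2 = 1"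
    using tn(2) S_sq unfolding c n unfolding ab(3) of_int_1 by algebra
  obtain b' :: rat where b': "b = of_rat b'" using ab(2) by (auto elim: Rats_cases)
  have "complex_of_real (of_int (t\<^sup>2) + 12 * of_int M * (of_rat b')\<^sup>2) = (2 * a)\<^sup>2 + 12 * of_int M * b\<^sup>2"
    unfolding ab(4) b' by (simp add: of_real_of_rat)
  also have "\<dots> = of_real 4" unfolding of_real_numeral using N by algebra
  finally have e: "real_of_int (t\<^sup>2) + 12 * of_int M * (of_rat b')\<^sup>2 = 4" by (simp only: of_real_eq_iff)
  have "12 * real_of_int M * (of_rat b')\<^sup>2 \<ge> 0" using M by simp
  then have "real_of_int (t\<^sup>2) \<le> of_int 4" using e by simp
  then have "t\<^sup>2 \<le> 2\<^sup>2" by (simp only: of_int_le_iff) simp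
  then have "\<bar>t\<bar> \<le> 2" using abs_le_square_iff[of t 2] by simp
  then consider "t = 0" | "\<bar>t\<bar> = 1" | "\<bar>t\<bar> = 2" by linarith
  then show ?thesis
  proof cases
    case 1
    then have "of_int (3 * M) * b\<^sup>2 = 1" using N ab(4) by simp
    then have "3 * M = 1" using squarefree_times_rational_square squarefree_3M ab(2) by blast
    then show ?thesis by presburger
  next
    case 2
    then have "t = 1 \<or> t = - 1" by linarith
    then have "t\<^sup>2 = 1" by auto
    then have "(2 * a)\<^sup>2 = 1" unfolding ab(4) by (metis of_int_1 of_int_power)
    then have "3 * (of_int M * (2 * b)\<^sup>2) = 3 * 1" using N by algebra
    then have "of_int M * (2 * b)\<^sup>2 = 1" unfolding mult_left_cancel[OF zero_neq_numeral[symmetric]] .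
    then have "M = 1" using squarefree_times_rational_square[OF squarefree_M, of "2 * b"] ab(2)
      by (blast intro: Rats_mult Rats_number_of)
    then show ?thesis using M by simp
  next
    case 3
    then have "t = 2 \<or> t = - 2" by linarith
    then have "t\<^sup>2 = 4" by auto
    then have "(2 * a)\<^sup>2 = 4" unfolding ab(4) by (metis of_int_numeral of_int_power)
    then have "a\<^sup>2 = 1" by simp
    moreover from this have "b = 0" using N M by simp
    ultimately show ?thesis using ab(3) by (simp add: power2_eq_1_iff)
  qed
qed

definition x :: real where "x = (SOME x. x ^ 3 = 3 * of_int s * x + of_int T)"

lemma x_root: "x ^ 3 = 3 * of_int s * x + of_int T"
proof -
  define f where "f y = y ^ 3 - 3 * of_int s * y - of_int T" for y :: real
  \<comment> \<open>With B at least 4 and at least |T|, the cube of B is at least 16 B and dominates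
    3B + |T|.\<close>
  define B where "B = 4 + \<bar>real_of_int T\<bar>"
  have B: "4 \<le> B" "\<bar>real_of_int T\<bar> \<le> B" by (auto simp: B_def)
  have "16 * B \<le> B ^ 3" using mult_right_mono[OF mult_mono[OF B(1) B(1)], of B] B(1)
    by (simp add: power3_eq_cube)
  moreover have "\<bar>3 * real_of_int s\<bar> \<le> 3" using s by auto
  then have "\<bar>3 * real_of_int s * B\<bar> \<le> 3 * B" using B(1) by (simp add: abs_mult)
  ultimately have "f (- B) \<le> 0" "0 \<le> f B" using B unfolding f_def by auto
  moreover have "continuous_on {- B..B} f" unfolding f_def by (intro continuous_intros)
  ultimately obtain y where "f y = 0" using IVT'[of f "-B" 0 B] B by auto
  then have "y ^ 3 = 3 * of_int s * y + of_int T" by (simp add: f_def)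
  then show ?thesis unfolding x_def by (rule someI)
qed

lemma no_rational_root:
  fixes y :: real
  assumes "y \<in> \<rat>"
  shows "y ^ 3 \<noteq> 3 * of_int s * y + of_int T"
proof
  assume y: "y ^ 3 = 3 * of_int s * y + of_int T"
  have "algebraic_int y"
  proof (rule algebraic_int.intros)
    show "lead_coeff [:- of_int T, - 3 * of_int s, 0, 1:] = (1::real)" by simp
    show "\<forall>i. coeff [:- of_int T, - 3 * of_int s, 0, 1:] i \<in> (\<int> :: real set)"
      by (auto simp: coeff_pCons split: nat.splits)
    show "poly [:- of_int T, - 3 * of_int s, 0, 1:] y = 0"
      using y by (simp add: power3_eq_cube algebra_simps)
  qed
  then have "y \<in> \<int>" using assms by (metis rational_algebraic_int_is_int)
  then obtain j :: int where j: "y = of_int j" by (auto elim: Ints_cases)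
  have "real_of_int (j ^ 3) = of_int (3 * s * j + T)" using y by (simp add: j)
  then show False using no_root[of j] by (simp only: of_int_eq_iff)
qed

text \<open>If x^2 = ux + v, reducing the cubic modulo this relation leaves a linear relation for x,
  whose coefficients vanish as x is irrational. The quadratic then divides the cubic and, the roots
  having sum 0, the third root is the rational number -u.\<close>

lemma independent_Rats:
  assumes "a \<in> \<rat>" "b \<in> \<rat>" "c \<in> \<rat>" and eq: "a + b * x + c * x\<^sup>2 = (0::real)"
  shows "a = 0 \<and> b = 0 \<and> c = 0"
proof -
  have xr: "x \<notin> \<rat>" using no_rational_root x_root by blast
  have c: "c = 0"
  proof (rule ccontr)
    assume c: "c \<noteq> 0"
    define u v where "u = - b / c" and "v = - a / c"
    have uv: "u \<in> \<rat>" "v \<in> \<rat>" using assms by (auto simp: u_def v_def intro!: Rats_divide)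
    have x2: "x\<^sup>2 = u * x + v" using eq c by (simp add: u_def v_def field_simps)
    have lin: "(u\<^sup>2 + v - 3 * of_int s) * x = of_int T - u * v"
      using x2 x_root by algebra
    have "u\<^sup>2 + v - 3 * of_int s = 0"
    proof (rule ccontr)
      assume "u\<^sup>2 + v - 3 * of_int s \<noteq> 0"
      then have "x = (of_int T - u * v) / (u\<^sup>2 + v - 3 * of_int s)" using lin by (simp add: field_simps)
      also have "\<dots> \<in> \<rat>"
        using uv by (intro Rats_divide Rats_diff Rats_add Rats_mult Rats_power Rats_of_int Rats_number_of)
      finally show False using xr by simp
    qed
    moreover from this have "of_int T = u * v" using lin by simp
    ultimately have "(- u) ^ 3 = 3 * of_int s * (- u) + of_int T" by algebra
    then show False using no_rational_root[of "- u"] uv by simp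
  qed
  have "b = 0"
  proof (rule ccontr)
    assume "b \<noteq> 0"
    then have "x = - a / b" using eq c by (simp add: field_simps)
    then show False using xr assms by (auto intro: Rats_divide)
  qed
  then show ?thesis using c eq by simp
qed

section \<open>The splitting field, its ring of integers and its automorphism\<close>

definition qat :: "complex \<Rightarrow> complex \<Rightarrow> complex \<Rightarrow> complex \<Rightarrow> complex" where
  "qat w a b c = a + b * w + c * w\<^sup>2"

text \<open>The discriminant of the cubic is $-27(T^2 - 4s) = (3 r S)^2$ and $(X - Y)(X - Z) = 3(X^2 - s)$, so
  $Y - Z$ may be taken to be $r S / (X^2 - s)$. The formula for \<open>Y\<close> uses
  $(w^2 - s)(4 + Tw - 2sw^2) = T^2 - 4s$, valid at each root $w$ of the cubic.\<close>
definition X :: complex where "X = of_real x"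
definition Y :: complex where
  "Y = - X / 2 + S * (4 + of_int T * X - 2 * of_int s * X\<^sup>2) / (2 * of_int M * of_int r)"
definition Z :: complex where "Z = - X - Y"

lemma X_root: "X ^ 3 = 3 * of_int s * X + of_int T"
proof -
  have "complex_of_real (x ^ 3) = of_real (3 * of_int s * x + of_int T)" using x_root by simp
  then show ?thesis by (simp add: X_def)
qed

lemma s_square_complex: "(of_int s :: complex) * of_int s = 1"
  by (metis of_int_1 of_int_mult s_square)

lemma discriminant_complex: "(of_int T)\<^sup>2 - 4 * of_int s = (of_int M * (of_int r)\<^sup>2 :: complex)"
  using arg_cong[OF discriminant, of "of_int :: int \<Rightarrow> complex"] by simp

lemma Mr_nonzero: "(2 * of_int M * of_int r :: complex) \<noteq> 0"
  using M r by simp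

lemma Y_scaled: "2 * of_int M * of_int r * (2 * Y + X) = 2 * S * (4 + of_int T * X - 2 * of_int s * X\<^sup>2)"
  using Mr_nonzero by (simp add: Y_def field_simps)

text \<open>Equivalent to (2Y + X)^2 = -3(X^2 - 4s), the discriminant of the quadratic cofactor of
  the cubic at X. Squaring \<open>Y_scaled\<close> gives this because S^2 = -3M and T^2 - 4s = M
  r^2.\<close>

lemma YZ: "Y * Z = X\<^sup>2 - 3 * of_int s"
proof -
  have "(2 * of_int M * of_int r)\<^sup>2 * (2 * Y + X)\<^sup>2
      = 4 * (S * S) * (4 + of_int T * X - 2 * of_int s * X\<^sup>2)\<^sup>2"
    using Y_scaled by algebra
  also have "(4 + of_int T * X - 2 * of_int s * X\<^sup>2)\<^sup>2 = (X\<^sup>2 - 4 * of_int s) * ((of_int T)\<^sup>2 - 4 * of_int s)"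
    using X_root s_square_complex by algebra
  finally have "(2 * of_int M * of_int r)\<^sup>2 * ((2 * Y + X)\<^sup>2 + 3 * (X\<^sup>2 - 4 * of_int s)) = 0"
    unfolding discriminant_complex S_sq by (simp add: algebra_simps power2_eq_square)
  then have "(2 * Y + X)\<^sup>2 + 3 * (X\<^sup>2 - 4 * of_int s) = 0" using Mr_nonzero by simp
  then show ?thesis unfolding Z_def by algebra
qed

lemma sum_roots: "X + Y + Z = 0"
  by (simp add: Z_def)

lemma pair_sum: "X * Y + Y * Z + Z * X = - 3 * of_int s"
  using YZ sum_roots by algebra

lemma product_roots: "X * Y * Z = of_int T"
  using YZ X_root by algebra

sublocale complex_cubic "3 * s" T x Y Z
proof
  show "x ^ 3 = of_int (3 * s) * x + of_int T" using x_root by simp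
  show "Y + Z = - of_real x" by (simp add: Z_def X_def)
  show "Y * Z = (of_real x)\<^sup>2 - of_int (3 * s)" using YZ by (simp add: X_def)
  show "a = 0 \<and> b = 0 \<and> c = 0" if "of_int a + of_int b * x + of_int c * x\<^sup>2 = 0" for a b c :: int
    using independent_Rats[OF _ _ _ that] by simp
qed

lemma Y_root: "Y ^ 3 = 3 * of_int s * Y + of_int T"
  using roots(2) by simp

text \<open>X is real and S purely imaginary, so real and imaginary parts split a relation over F
  into two over the rationals.\<close>

lemma independent_F:
  assumes "a \<in> F" "b \<in> F" "c \<in> F" and eq: "qat X a b c = 0"
  shows "a = 0 \<and> b = 0 \<and> c = 0"
proof -
  have *: "\<exists>p\<in>\<rat>. \<exists>q\<in>\<rat>. z = of_real p + of_real q * S" if "z \<in> F" for z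
  proof -
    obtain p q :: rat where "z = of_rat p + of_rat q * S"
      using \<open>z \<in> F\<close> unfolding quad_field_def S_def by blast
    then have "z = of_real (of_rat p) + of_real (of_rat q) * S" by (simp add: of_real_of_rat)
    moreover have "real_of_rat p \<in> \<rat>" "real_of_rat q \<in> \<rat>" by auto
    ultimately show ?thesis by blast
  qed
  obtain a1 a2 where a: "a1 \<in> \<rat>" "a2 \<in> \<rat>" "a = of_real a1 + of_real a2 * S" using *[OF assms(1)] by blast
  obtain b1 b2 where b: "b1 \<in> \<rat>" "b2 \<in> \<rat>" "b = of_real b1 + of_real b2 * S" using *[OF assms(2)] by blast
  obtain c1 c2 where c: "c1 \<in> \<rat>" "c2 \<in> \<rat>" "c = of_real c1 + of_real c2 * S" using *[OF assms(3)] by blast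
  have S: "Re S = 0" "Im S \<noteq> 0"
  proof -
    show "Re S = 0" using arg_cong[OF cnj_S, of Re] by simp
    then show "Im S \<noteq> 0" using S_sq M by (auto simp: complex_eq_iff)
  qed
  have e: "of_real (a1 + b1 * x + c1 * x\<^sup>2) + of_real (a2 + b2 * x + c2 * x\<^sup>2) * S = 0"
    using eq unfolding qat_def a(3) b(3) c(3) X_def by (simp add: algebra_simps)
  have 1: "a1 + b1 * x + c1 * x\<^sup>2 = 0" using arg_cong[OF e, of Re] S(1) by (simp del: of_real_add of_real_mult of_real_power)
  have 2: "a2 + b2 * x + c2 * x\<^sup>2 = 0" using arg_cong[OF e, of Im] S by (simp del: of_real_add of_real_mult of_real_power)
  show ?thesis
    using independent_Rats[OF a(1) b(1) c(1) 1] independent_Rats[OF a(2) b(2) c(2) 2] by (simp add: a b c)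
qed

interpretation Fs: csubring F by (rule csubring_F)
interpretation Q: csubring "quad_order d" by (rule csubring_quad_order)

text \<open>L is F(X) and \<Lambda> the order Z[sqrt d][X]; the integers R arise from \<Lambda> by
  bounded denominators, so no integral basis is needed.\<close>

definition L :: "complex set" where "L = {qat X a b c | a b c. a \<in> F \<and> b \<in> F \<and> c \<in> F}"
definition \<Lambda> :: "complex set" where
  "\<Lambda> = {qat X a b c | a b c. a \<in> quad_order d \<and> b \<in> quad_order d \<and> c \<in> quad_order d}"
definition R :: "complex set" where "R = almost_int \<Lambda>"
text \<open>Substitution of Y for X in coordinates; the choice is unambiguous on L by
  \<open>independent_F\<close>.\<close>

definition \<sigma> :: "complex \<Rightarrow> complex" where
  "\<sigma> v = (SOME w. \<exists>a\<in>F. \<exists>b\<in>F. \<exists>c\<in>F. v = qat X a b c \<and> w = qat Y a b c)"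

lemma at_mult:
  assumes "w ^ 3 = 3 * of_int s * w + of_int T"
  shows "qat w a b c * qat w a' b' c' = qat w (a * a' + of_int T * (b * c' + c * b'))
      (a * b' + b * a' + 3 * of_int s * (b * c' + c * b') + of_int T * (c * c'))
      (a * c' + b * b' + c * a' + 3 * of_int s * (c * c'))"
  unfolding qat_def using assms by algebra

lemma at_diff: "qat w a b c - qat w a' b' c' = qat w (a - a') (b - b') (c - c')"
  and at_add: "qat w a b c + qat w a' b' c' = qat w (a + a') (b + b') (c + c')"
  by (simp_all add: qat_def algebra_simps)

lemma csubring_span:
  assumes "csubring A"
  shows "csubring {qat X a b c | a b c. a \<in> A \<and> b \<in> A \<and> c \<in> A}"
proof -
  interpret A: csubring A by fact
  show ?thesis
  proof
    have "1 = qat X 1 0 0" by (simp add: qat_def)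
    then show "1 \<in> {qat X a b c | a b c. a \<in> A \<and> b \<in> A \<and> c \<in> A}" using A.closed by blast
  next
    fix v w assume "v \<in> {qat X a b c | a b c. a \<in> A \<and> b \<in> A \<and> c \<in> A}"
      "w \<in> {qat X a b c | a b c. a \<in> A \<and> b \<in> A \<and> c \<in> A}"
    then obtain a b c a' b' c' where v: "v = qat X a b c" "w = qat X a' b' c'"
      and A: "a \<in> A" "b \<in> A" "c \<in> A" "a' \<in> A" "b' \<in> A" "c' \<in> A" by blast
    show "v - w \<in> {qat X a b c | a b c. a \<in> A \<and> b \<in> A \<and> c \<in> A}"
      unfolding v at_diff using A A.diff_closed by blast
    show "v * w \<in> {qat X a b c | a b c. a \<in> A \<and> b \<in> A \<and> c \<in> A}"
      unfolding v at_mult[OF X_root]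
      by (rule CollectI, intro exI conjI, rule refl) (intro A.closed A)+
  qed
qed

sublocale L: csubring L
  unfolding L_def by (rule csubring_span) (rule csubring_F)
sublocale \<Lambda>: csubring \<Lambda>
  unfolding \<Lambda>_def by (rule csubring_span) (rule csubring_quad_order)
sublocale R: csubring R
  unfolding R_def by (rule \<Lambda>.csubring_almost_int)

lemma F_subset_L: "a \<in> F \<Longrightarrow> a \<in> L"
proof -
  assume "a \<in> F"
  moreover have "a = qat X a 0 0" by (simp add: qat_def)
  ultimately show ?thesis unfolding L_def using Fs.zero_closed by blast
qed

lemma quad_order_subset_\<Lambda>: "a \<in> quad_order d \<Longrightarrow> a \<in> \<Lambda>"
proof -
  assume "a \<in> quad_order d"
  moreover have "a = qat X a 0 0" by (simp add: qat_def)
  ultimately show ?thesis unfolding \<Lambda>_def using Q.zero_closed by blast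
qed

lemma S_in_quad_order: "S \<in> quad_order d"
proof -
  have "of_int 0 + of_int 1 * S \<in> quad_order d" unfolding quad_order_altdef by blast
  then show ?thesis by simp
qed

lemma X_in_\<Lambda>: "X \<in> \<Lambda>"
proof -
  have "X = qat X 0 1 0" by (simp add: qat_def)
  then show ?thesis unfolding \<Lambda>_def using Q.zero_closed Q.one_closed by blast
qed

lemma quad_order_subset_F: "quad_order d \<subseteq> F"
  using quad_order_subset by (auto simp: quad_ints_def)

lemma \<Lambda>_subset_L: "\<Lambda> \<subseteq> L"
  unfolding \<Lambda>_def L_def using quad_order_subset_F by blast

lemma R_subset_L: "R \<subseteq> L"
proof
  fix v assume "v \<in> R"
  then obtain m :: int where m: "m \<noteq> 0" "of_int m * v ^ 1 \<in> \<Lambda>" unfolding R_def almost_int_def by blast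
  have "1 / of_int m \<in> L" by (intro F_subset_L Rats_subset_F Rats_divide) auto
  then have "(1 / of_int m) * (of_int m * v) \<in> L"
    by (rule L.mult_closed) (use m \<Lambda>_subset_L in auto)
  then show "v \<in> L" using m(1) by simp
qed

lemma sigma_at: 
  assumes "a \<in> F" "b \<in> F" "c \<in> F"
  shows "\<sigma> (qat X a b c) = qat Y a b c"
proof -
  have "\<exists>w. \<exists>a'\<in>F. \<exists>b'\<in>F. \<exists>c'\<in>F. qat X a b c = qat X a' b' c' \<and> w = qat Y a' b' c'"
    using assms by blast
  from someI_ex[OF this] obtain a' b' c' where abc: "a' \<in> F" "b' \<in> F" "c' \<in> F" "qat X a b c = qat X a' b' c'"
    "\<sigma> (qat X a b c) = qat Y a' b' c'" unfolding \<sigma>_def by blast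
  have "qat X (a - a') (b - b') (c - c') = 0" using abc(4) by (simp add: at_diff[symmetric])
  then have "a = a' \<and> b = b' \<and> c = c'"
    using independent_F[of "a - a'" "b - b'" "c - c'"] assms abc by (simp add: Fs.diff_closed)
  then show ?thesis using abc(5) by simp
qed

lemma sigma_F: "a \<in> F \<Longrightarrow> \<sigma> a = a"
  using sigma_at[of a 0 0] by (simp add: qat_def Fs.zero_closed)

lemma sigma_add: "v \<in> L \<Longrightarrow> w \<in> L \<Longrightarrow> \<sigma> (v + w) = \<sigma> v + \<sigma> w"
  unfolding L_def by (auto simp: sigma_at at_add Fs.add_closed)

lemma sigma_mult: "v \<in> L \<Longrightarrow> w \<in> L \<Longrightarrow> \<sigma> (v * w) = \<sigma> v * \<sigma> w"
proof -
  assume "v \<in> L" "w \<in> L"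
  then obtain a b c a' b' c' where v: "v = qat X a b c" "w = qat X a' b' c'"
    and A: "a \<in> F" "b \<in> F" "c \<in> F" "a' \<in> F" "b' \<in> F" "c' \<in> F" unfolding L_def by blast
  have "\<sigma> (v * w) = qat Y (a * a' + of_int T * (b * c' + c * b'))
      (a * b' + b * a' + 3 * of_int s * (b * c' + c * b') + of_int T * (c * c'))
      (a * c' + b * b' + c * a' + 3 * of_int s * (c * c'))"
    unfolding v at_mult[OF X_root] by (rule sigma_at) (intro Fs.closed A)+
  also have "\<dots> = \<sigma> v * \<sigma> w"
    unfolding v sigma_at[OF A(1-3)] sigma_at[OF A(4-6)] at_mult[OF Y_root] ..
  finally show ?thesis .
qed

lemma X_in_L: "X \<in> L"
  using X_in_\<Lambda> \<Lambda>_subset_L by blast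

text \<open>Y itself need not lie in \<Lambda>, but 2Mr is a denominator for it, which bounds the
  denominators that \<sigma> introduces.\<close>

lemma Y_scaled_in_\<Lambda>: "of_int (2 * M * r) * Y \<in> \<Lambda>"
proof -
  have "of_int (2 * M * r) * Y = S * (4 + of_int T * X - 2 * of_int s * X\<^sup>2) - of_int (M * r) * X"
    using Y_scaled by simp algebra
  also have "\<dots> \<in> \<Lambda>"
    by (intro \<Lambda>.closed X_in_\<Lambda> quad_order_subset_\<Lambda> S_in_quad_order)
  finally show ?thesis .
qed

lemma Y_in_L: "Y \<in> L"
proof -
  have "1 / of_int (2 * M * r) \<in> L" by (intro F_subset_L Rats_subset_F Rats_divide Rats_of_int) auto
  then have "1 / of_int (2 * M * r) * (of_int (2 * M * r) * Y) \<in> L"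
    by (rule L.mult_closed) (rule subsetD[OF \<Lambda>_subset_L Y_scaled_in_\<Lambda>])
  then show ?thesis using M r by simp
qed

lemma at_in_L: "w \<in> L \<Longrightarrow> a \<in> F \<Longrightarrow> b \<in> F \<Longrightarrow> c \<in> F \<Longrightarrow> qat w a b c \<in> L"
  unfolding qat_def by (simp add: L.closed F_subset_L)

lemma sigma_in_L: "v \<in> L \<Longrightarrow> \<sigma> v \<in> L"
proof -
  assume "v \<in> L"
  then obtain a b c where "v = qat X a b c" "a \<in> F" "b \<in> F" "c \<in> F" unfolding L_def by blast
  then show ?thesis using at_in_L[OF Y_in_L] by (simp add: sigma_at)
qed

lemma sigma_X: "\<sigma> X = Y"
  using sigma_at[of 0 1 0] by (simp add: qat_def Fs.zero_closed Fs.one_closed)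

lemma sigma_minus: "v \<in> L \<Longrightarrow> \<sigma> (- v) = - \<sigma> v"
  using sigma_mult[of "-1" v] sigma_F[of "-1"] by (simp add: L.closed Fs.closed)

text \<open>This is the point where \<sigma> has order 3: it fixes F and hence S, a rational
  multiple of the square root of the discriminant, so it acts on the roots as an even permutation.
  Concretely, \<sigma> is applied to the formula for 2Y + X.\<close>

lemma sigma_Y: "\<sigma> Y = Z"
proof -
  let ?g = "\<lambda>w. 4 + of_int T * w - 2 * of_int s * w\<^sup>2"
  let ?D = "(of_int T)\<^sup>2 - 4 * of_int s :: complex"
  have inv: "(w\<^sup>2 - of_int s) * ?g w = ?D"
    if "w ^ 3 = 3 * of_int s * w + of_int T" for w
    using that s_square_complex by algebra
  have D0: "?D \<noteq> 0" unfolding discriminant_complex using M r by simp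
  define k where "k = 2 * of_int M * of_int r * (1::complex)"
  have k0: "k \<noteq> 0" using Mr_nonzero by (simp add: k_def)
  have kF: "k \<in> F" unfolding k_def by (intro Fs.closed)
  have kY: "k * (2 * Y + X) = 2 * S * ?g X" using Y_scaled by (simp add: k_def)
  have g: "k * (2 * \<sigma> Y + Y) = 2 * S * ?g Y"
  proof -
    have "k * (2 * \<sigma> Y + Y) = \<sigma> (k * (2 * Y + X))"
      using X_in_L Y_in_L kF F_subset_L[OF kF] sigma_F[OF Fs.numeral_closed]
      by (simp add: sigma_mult sigma_add sigma_F sigma_X L.closed)
    also have "\<dots> = \<sigma> (qat X (8 * S) (2 * S * of_int T) (- 4 * S * of_int s))"
      unfolding kY by (simp add: qat_def algebra_simps)
    also have "\<dots> = qat Y (8 * S) (2 * S * of_int T) (- 4 * S * of_int s)"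
      by (rule sigma_at) (intro Fs.closed S_in_F)+
    finally show ?thesis by (simp add: qat_def algebra_simps)
  qed
  have Y0: "Y\<^sup>2 - of_int s \<noteq> 0" using inv[OF Y_root] D0 by auto
  have 1: "k * (2 * Y + X) * (X\<^sup>2 - of_int s) = 2 * S * ?D" using kY inv[OF X_root] by algebra
  have 2: "k * (2 * \<sigma> Y + Y) * (Y\<^sup>2 - of_int s) = 2 * S * ?D" using g inv[OF Y_root] by algebra
  \<comment> \<open>Both sides are a third of (X - Y)(X - Z)(Y - Z): for instance 2Y + X = Y - Z and
    3(X^2 - s) = (X - Y)(X - Z).\<close>
  have "(2 * Y + X) * (X\<^sup>2 - of_int s) = (2 * Z + Y) * (Y\<^sup>2 - of_int s)"
    using sum_roots pair_sum by algebra
  then have "k * (Y\<^sup>2 - of_int s) * (2 * \<sigma> Y - 2 * Z) = 0" using 1 2 by algebra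
  then show ?thesis using k0 Y0 by simp
qed

lemma Z_in_L: "Z \<in> L"
  unfolding Z_def by (intro L.closed X_in_L Y_in_L)

lemma sigma_Z: "\<sigma> Z = X"
proof -
  have "Z = - (X + Y)" by (simp add: Z_def)
  then have "\<sigma> Z = - (Y + Z)"
    by (simp add: sigma_minus sigma_add X_in_L Y_in_L L.add_closed sigma_X sigma_Y del: minus_add_distrib)
  then show ?thesis by (simp add: Z_def)
qed

lemma sigma_at_L:
  assumes "w \<in> L" "a \<in> F" "b \<in> F" "c \<in> F"
  shows "\<sigma> (qat w a b c) = qat (\<sigma> w) a b c"
  using assms F_subset_L unfolding qat_def
  by (simp add: sigma_add sigma_mult sigma_F power2_eq_square L.closed)

lemma sigma_order3: "v \<in> L \<Longrightarrow> \<sigma> (\<sigma> (\<sigma> v)) = v"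
proof -
  assume "v \<in> L"
  then obtain a b c where "v = qat X a b c" "a \<in> F" "b \<in> F" "c \<in> F" unfolding L_def by blast
  then show ?thesis by (simp add: sigma_at_L X_in_L Y_in_L Z_in_L sigma_X sigma_Y sigma_Z)
qed

lemma sigma_power: "v \<in> L \<Longrightarrow> \<sigma> (v ^ n) = \<sigma> v ^ n"
  by (induction n) (simp_all add: sigma_mult sigma_F L.closed Fs.closed)

text \<open>Elements of \<Lambda> are quadratic in X, so (2Mr)^2 brings their images back into
  \<Lambda>; this factor does not depend on the exponent k.\<close>

lemma sigma_in_R:
  assumes "v \<in> R"
  shows "\<sigma> v \<in> R"
proof -
  have vL: "v \<in> L" using assms R_subset_L by blast
  obtain m :: int where m: "m \<noteq> 0" "\<And>k. of_int m * v ^ k \<in> \<Lambda>"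
    using assms unfolding R_def almost_int_def by blast
  let ?n = "2 * M * r"
  have n0: "?n \<noteq> 0" using M r by simp
  have "of_int (?n\<^sup>2 * m) * \<sigma> v ^ k \<in> \<Lambda>" for k
  proof -
    obtain a b c where abc: "of_int m * v ^ k = qat X a b c"
      and q: "a \<in> quad_order d" "b \<in> quad_order d" "c \<in> quad_order d"
      using m(2)[of k] unfolding \<Lambda>_def by blast
    have "of_int m * \<sigma> v ^ k = \<sigma> (of_int m * v ^ k)"
      using vL by (simp add: sigma_mult sigma_power sigma_F L.closed Fs.closed)
    also have "\<dots> = qat Y a b c"
      unfolding abc using q quad_order_subset_F by (intro sigma_at) auto
    finally have "of_int (?n\<^sup>2 * m) * \<sigma> v ^ k = of_int ?n * of_int ?n * qat Y a b c"
      by (simp add: power2_eq_square)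
    also have "\<dots> = of_int ?n * of_int ?n * a + of_int ?n * b * (of_int ?n * Y)
        + c * (of_int ?n * Y) * (of_int ?n * Y)"
      unfolding qat_def by (simp add: algebra_simps power2_eq_square)
    also have "\<dots> \<in> \<Lambda>" by (intro \<Lambda>.closed Y_scaled_in_\<Lambda> quad_order_subset_\<Lambda> q)
    finally show ?thesis .
  qed
  then show ?thesis unfolding R_def almost_int_def using m(1) n0
    by (intro CollectI exI[of _ "?n\<^sup>2 * m"]) simp
qed

text \<open>A fixed element v satisfies 3v = trace(v). The traces of X and X^2 are 0 and 6s, which
  gives v \<in> F. By uniqueness of coordinates, an element of \<Lambda> that lies in F is in
  Z[sqrt d], so denominators over \<Lambda> are denominators over Z[sqrt d].\<close>

lemma OF_eq_fixed: "OF = {v \<in> R. \<sigma> v = v}"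
proof (intro equalityI subsetI)
  fix v assume v: "v \<in> OF"
  have "almost_int (quad_order d) \<subseteq> almost_int \<Lambda>"
    by (rule almost_int_conductor[of 1]) (auto intro: quad_order_subset_\<Lambda>)
  then have "v \<in> R" using v unfolding quad_ints_eq R_def by blast
  moreover have "v \<in> F" using v by (simp add: quad_ints_def)
  ultimately show "v \<in> {v \<in> R. \<sigma> v = v}" using sigma_F by simp
next
  fix v assume "v \<in> {v \<in> R. \<sigma> v = v}"
  then have v: "v \<in> R" "\<sigma> v = v" by auto
  then obtain a b c where abc: "v = qat X a b c" "a \<in> F" "b \<in> F" "c \<in> F"
    using R_subset_L unfolding L_def by blast
  have "\<sigma> v = qat Y a b c" "\<sigma> (\<sigma> v) = qat Z a b c"
    using abc by (simp_all add: sigma_at_L X_in_L Y_in_L sigma_X sigma_Y)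
  then have "3 * v = qat X a b c + qat Y a b c + qat Z a b c" using v(2) abc(1) by simp
  also have "\<dots> = 3 * a + 6 * of_int s * c"
    unfolding qat_def using sum_roots pair_sum by algebra
  finally have "3 * v = 3 * (a + 2 * of_int s * c)" by simp
  then have "v = a + 2 * of_int s * c" unfolding mult_left_cancel[OF zero_neq_numeral[symmetric]] .
  also have "\<dots> \<in> F" by (intro Fs.closed abc)
  finally have vF: "v \<in> F" .
  obtain m :: int where m: "m \<noteq> 0" "\<And>k. of_int m * v ^ k \<in> \<Lambda>"
    using v(1) unfolding R_def almost_int_def by blast
  have "of_int m * v ^ k \<in> quad_order d" for k
  proof -
    obtain a b c where abc: "of_int m * v ^ k = qat X a b c"
      and q: "a \<in> quad_order d" "b \<in> quad_order d" "c \<in> quad_order d"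
      using m(2)[of k] unfolding \<Lambda>_def by blast
    have "of_int m * v ^ k = qat X (of_int m * v ^ k) 0 0" by (simp add: qat_def)
    then have "qat X (a - of_int m * v ^ k) (b - 0) (c - 0) = 0" using abc by (simp only: at_diff[symmetric]) simp
    moreover have "a - of_int m * v ^ k \<in> F" "b - 0 \<in> F" "c - 0 \<in> F"
      using q quad_order_subset_F vF by (auto intro!: Fs.closed)
    ultimately show ?thesis using independent_F[of "a - of_int m * v ^ k" "b - 0" "c - 0"] q(1) by simp
  qed
  then show "v \<in> OF" unfolding quad_ints_eq almost_int_def using m(1) by blast
qed

text \<open>The unit comes from the cubic order Z[x]; its norm over F is its norm over the
  rationals, and its real conjugate has absolute value different from 1.\<close>

lemma three_dvd_class_number_if_locally_unramified:
  assumes "\<exists>e\<in>R. e + \<sigma> e + \<sigma> (\<sigma> e) = 1"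
    and "\<exists>y\<in>R. \<exists>z\<in>R. \<exists>m n :: int.
      of_int m * (y\<^sup>2 + (\<sigma> y)\<^sup>2 + (\<sigma> (\<sigma> y))\<^sup>2 - y * \<sigma> y - y * \<sigma> (\<sigma> y) - \<sigma> y * \<sigma> (\<sigma> y)) +
      of_int n * (z\<^sup>2 + (\<sigma> z)\<^sup>2 + (\<sigma> (\<sigma> z))\<^sup>2 - z * \<sigma> z - z * \<sigma> (\<sigma> z) - \<sigma> z * \<sigma> (\<sigma> z)) = 1"
  shows "3 dvd class_number d"
proof -
  interpret E: cyclic_cubic_extension d R \<sigma>
    by unfold_locales
      (use R_subset_L assms in \<open>auto simp: sigma_in_R sigma_add sigma_mult sigma_order3 OF_eq_fixed[symmetric] subset_iff dest: units_pm1\<close>)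
  obtain a b c where abc: "cubic_norm (3 * s) T a b c = 1" "\<bar>of_int a + of_int b * x + of_int c * x\<^sup>2\<bar> \<noteq> 1"
    using nontrivial_unit by blast
  have q: "quadratic_at w a b c = qat w (of_int a) (of_int b) (of_int c)" for w
    by (simp add: quadratic_at_def qat_def)
  let ?u = "quadratic_at X a b c"
  have "?u \<in> \<Lambda>" unfolding q \<Lambda>_def using Q.of_int_closed by blast
  then have "?u \<in> R" unfolding R_def using \<Lambda>.subset_almost_int by blast
  moreover have "?u * \<sigma> ?u * \<sigma> (\<sigma> ?u) = 1"
    using norm_product[of a b c] abc(1)
    by (simp add: q sigma_at_L X_in_L Y_in_L sigma_X sigma_Y Fs.closed X_def[symmetric])
  moreover have "norm ?u \<noteq> 1"
    using abc(2) by (simp add: X_def quadratic_at_real)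
  ultimately show ?thesis by (rule E.three_dvd_class_number_if_unit)
qed

section \<open>Integers witnessing that 3 does not ramify, for the two residues of T\<close>

lemma in_R_if_cubic:
  assumes "of_int m * z \<in> \<Lambda>" "m \<noteq> 0" "z ^ 3 = of_int c0 + of_int c1 * z + of_int c2 * z\<^sup>2"
  shows "z \<in> R"
  unfolding R_def
proof (rule \<Lambda>.integral_imp_almost_int[where n = 3 and m = "m\<^sup>2" and c = "\<lambda>i. of_int (if i = 0 then c0 else if i = 1 then c1 else c2)"])
  fix i :: nat assume "i < 3"
  then consider "i = 0" | "i = 1" | "i = 2" by linarith
  then show "of_int (m\<^sup>2) * z ^ i \<in> \<Lambda>"
  proof cases
    case 2
    then show ?thesis using \<Lambda>.mult_closed[OF \<Lambda>.of_int_closed[of m] assms(1)] by (simp add: power2_eq_square mult.assoc)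
  next
    case 3
    then show ?thesis using \<Lambda>.mult_closed[OF assms(1) assms(1)] by (simp add: power2_eq_square mult_ac)
  qed (simp add: \<Lambda>.closed)
qed (use assms in \<open>simp_all add: eval_nat_numeral \<Lambda>.of_int_closed\<close>)

lemma sigma_third_square:
  assumes "w \<in> L" 
  shows "\<sigma> ((w - of_int n)\<^sup>2 / 3) = (\<sigma> w - of_int n)\<^sup>2 / 3"
proof -
  have F3: "1 / 3 \<in> F" by (intro Rats_subset_F Rats_divide) auto
  have eq: "(v - of_int n)\<^sup>2 / 3 = qat v (of_int n * of_int n * (1 / 3)) (- 2 * of_int n * (1 / 3)) (1 / 3)" for v
    by (simp add: qat_def power2_eq_square algebra_simps diff_divide_distrib add_divide_distrib)
  show ?thesis unfolding eq by (rule sigma_at_L[OF assms]) (intro Fs.closed F3)+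
qed

theorem three_dvd_class_number_0:
  assumes T: "T = 9 * t"
  shows "3 dvd class_number d"
proof -
  \<comment> \<open>Integral, as $z(z - s)^2 = 3t^2$; one conjugate is 0 modulo 3 and the others are $s$, so this detects
    that 3 does not ramify.\<close>
  define z where "z = X\<^sup>2 / 3"
  have sz1: "\<sigma> z = Y\<^sup>2 / 3"
    using sigma_third_square[OF X_in_L, of 0] by (simp add: z_def sigma_X)
  have sz2: "\<sigma> (\<sigma> z) = Z\<^sup>2 / 3"
    unfolding sz1 using sigma_third_square[OF Y_in_L, of 0] by (simp add: sigma_Y)
  have X3: "X ^ 3 = 3 * of_int s * X + 9 * of_int t" using X_root by (simp add: T)
  have X2: "X\<^sup>2 = 3 * z" by (simp add: z_def)
  have "z ^ 3 = of_int (3 * t\<^sup>2) + of_int (- 1) * z + of_int (2 * s) * z\<^sup>2"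
  proof -
    have "27 * (z ^ 3 - (3 * (of_int t)\<^sup>2 - z + 2 * of_int s * z\<^sup>2)) = 0"
      using X3 X2 s_square_complex by algebra
    then have "z ^ 3 - (3 * (of_int t)\<^sup>2 - z + 2 * of_int s * z\<^sup>2) = 0" unfolding mult_eq_0_iff by simp
    then show ?thesis by simp
  qed
  moreover have "of_int 3 * z \<in> \<Lambda>" by (simp add: z_def \<Lambda>.closed X_in_\<Lambda>)
  ultimately have zR: "z \<in> R" using in_R_if_cubic[of 3 z] by (metis zero_neq_numeral)
  have sums: "X\<^sup>2 + Y\<^sup>2 + Z\<^sup>2 = 6 * of_int s" "X\<^sup>2 * Y\<^sup>2 + X\<^sup>2 * Z\<^sup>2 + Y\<^sup>2 * Z\<^sup>2 = 9"
    using sum_roots pair_sum s_square_complex by algebra+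
  show ?thesis
  proof (rule three_dvd_class_number_if_locally_unramified)
    \<comment> \<open>The trace of z is 2s, so this element has trace 3 - 2s^2 = 1.\<close>
    let ?e = "1 - of_int s * z"
    have "?e \<in> R" by (intro R.closed zR)
    moreover have "\<sigma> ?e = 1 - of_int s * \<sigma> z" "\<sigma> (\<sigma> ?e) = 1 - of_int s * \<sigma> (\<sigma> z)"
    proof -
      have *: "\<sigma> (1 - of_int s * v) = 1 - of_int s * \<sigma> v" if "v \<in> L" for v
        using sigma_add[of 1 "- (of_int s * v)"] that
        by (simp add: sigma_minus sigma_mult sigma_F L.closed Fs.closed)
      have "z \<in> L" using zR R_subset_L by blast
      then show "\<sigma> ?e = 1 - of_int s * \<sigma> z" "\<sigma> (\<sigma> ?e) = 1 - of_int s * \<sigma> (\<sigma> z)"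
        by (simp_all add: * sigma_in_L)
    qed
    moreover have "?e + (1 - of_int s * \<sigma> z) + (1 - of_int s * \<sigma> (\<sigma> z)) = 1"
    proof -
      have "3 * (?e + (1 - of_int s * \<sigma> z) + (1 - of_int s * \<sigma> (\<sigma> z))) = 9 - of_int s * (X\<^sup>2 + Y\<^sup>2 + Z\<^sup>2)"
        unfolding sz2 unfolding sz1 unfolding z_def by (simp add: algebra_simps)
      also have "\<dots> = 3 * 1" unfolding sums using s_square_complex by algebra
      finally show ?thesis unfolding mult_left_cancel[OF zero_neq_numeral[symmetric]] .
    qed
    ultimately show "\<exists>e\<in>R. e + \<sigma> e + \<sigma> (\<sigma> e) = 1" by (intro bexI[of _ ?e]) simp_all
    have three: "3 * z = X\<^sup>2" "3 * \<sigma> z = Y\<^sup>2" "3 * \<sigma> (\<sigma> z) = Z\<^sup>2"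
      unfolding sz2 unfolding sz1 unfolding z_def by simp_all
    \<comment> \<open>From the cubic of z, the form is e_1^2 - 3 e_2 = (2s)^2 - 3 = 1, so z alone
      excludes ramification at every prime.\<close>
    have "9 * (z\<^sup>2 + (\<sigma> z)\<^sup>2 + (\<sigma> (\<sigma> z))\<^sup>2 - z * \<sigma> z - z * \<sigma> (\<sigma> z) - \<sigma> z * \<sigma> (\<sigma> z)) =
      (X\<^sup>2 + Y\<^sup>2 + Z\<^sup>2)\<^sup>2 - 3 * (X\<^sup>2 * Y\<^sup>2 + X\<^sup>2 * Z\<^sup>2 + Y\<^sup>2 * Z\<^sup>2)"
      using three by algebra
    also have "\<dots> = 9 * 1" unfolding sums using s_square_complex by algebra
    finally have "z\<^sup>2 + (\<sigma> z)\<^sup>2 + (\<sigma> (\<sigma> z))\<^sup>2 - z * \<sigma> z - z * \<sigma> (\<sigma> z) - \<sigma> z * \<sigma> (\<sigma> z) = 1"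
      unfolding mult_left_cancel[OF zero_neq_numeral[symmetric]] .
    then show "\<exists>y\<in>R. \<exists>z\<in>R. \<exists>m n :: int.
      of_int m * (y\<^sup>2 + (\<sigma> y)\<^sup>2 + (\<sigma> (\<sigma> y))\<^sup>2 - y * \<sigma> y - y * \<sigma> (\<sigma> y) - \<sigma> y * \<sigma> (\<sigma> y)) +
      of_int n * (z\<^sup>2 + (\<sigma> z)\<^sup>2 + (\<sigma> (\<sigma> z))\<^sup>2 - z * \<sigma> z - z * \<sigma> (\<sigma> z) - \<sigma> z * \<sigma> (\<sigma> z)) = 1"
      using zR by (intro bexI[of _ z] exI[of _ 1] exI[of _ 0]) simp_all
  qed
qed

text \<open>Modulo 3 the cubic is (y - 1)^3, hence the shift by 1. For z = (X - 1)^2/3 the equation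
  reduces modulo 3 to z(z - 1)^2 = 0, so its conjugates are not all congruent. Its trace is -1, so
  -z has trace 1.\<close>

theorem three_dvd_class_number_4:
  assumes T: "T = 4 + 9 * t" and s1: "s = - 1"
  shows "3 dvd class_number d"
proof -
  define z where "z = (X - 1)\<^sup>2 / 3"
  have sz1: "\<sigma> z = (Y - 1)\<^sup>2 / 3"
    using sigma_third_square[OF X_in_L, of 1] by (simp add: z_def sigma_X)
  have sz2: "\<sigma> (\<sigma> z) = (Z - 1)\<^sup>2 / 3"
    unfolding sz1 using sigma_third_square[OF Y_in_L, of 1] by (simp add: sigma_Y)
  have X3: "X ^ 3 = - 3 * X + 4 + 9 * of_int t" using X_root by (simp add: T s1)
  have X2: "(X - 1)\<^sup>2 = 3 * z" by (simp add: z_def)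
  have "z ^ 3 = of_int (3 * t\<^sup>2) + of_int (- 4 - 6 * t) * z + of_int (- 1) * z\<^sup>2"
  proof -
    have "27 * (z ^ 3 - (3 * (of_int t)\<^sup>2 - (4 + 6 * of_int t) * z - z\<^sup>2)) = 0"
      using X3 X2 by algebra
    then have "z ^ 3 - (3 * (of_int t)\<^sup>2 - (4 + 6 * of_int t) * z - z\<^sup>2) = 0" unfolding mult_eq_0_iff by simp
    then show ?thesis by (simp add: algebra_simps)
  qed
  moreover have "of_int 3 * z \<in> \<Lambda>" by (simp add: z_def \<Lambda>.closed X_in_\<Lambda>)
  ultimately have zR: "z \<in> R" using in_R_if_cubic[of 3 z] by (metis zero_neq_numeral)
  have XR: "X \<in> R" using X_in_\<Lambda> \<Lambda>.subset_almost_int unfolding R_def by blast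
  have rel: "X + Y + Z = 0" "X * Y + Y * Z + Z * X = 3" "X * Y * Z = 4 + 9 * of_int t"
    using sum_roots pair_sum product_roots by (simp_all add: T s1)
  show ?thesis
  proof (rule three_dvd_class_number_if_locally_unramified)
    have "z \<in> L" using zR R_subset_L by blast
    then have "\<sigma> (- z) = - \<sigma> z" "\<sigma> (\<sigma> (- z)) = - \<sigma> (\<sigma> z)"
      by (simp_all add: sigma_minus sigma_in_L)
    moreover have "- z + - \<sigma> z + - \<sigma> (\<sigma> z) = 1"
    proof -
      have "3 * (- z + - \<sigma> z + - \<sigma> (\<sigma> z)) = - ((X - 1)\<^sup>2 + (Y - 1)\<^sup>2 + (Z - 1)\<^sup>2)"
        unfolding sz2 unfolding sz1 unfolding z_def by (simp add: algebra_simps)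
      also have "\<dots> = 3 * 1" using rel(1,2) by algebra
      finally show ?thesis unfolding mult_left_cancel[OF zero_neq_numeral[symmetric]] .
    qed
    ultimately show "\<exists>e\<in>R. e + \<sigma> e + \<sigma> (\<sigma> e) = 1"
      using zR R.uminus_closed by (intro bexI[of _ "- z"]) simp_all
    have three: "3 * z = (X - 1)\<^sup>2" "3 * \<sigma> z = (Y - 1)\<^sup>2" "3 * \<sigma> (\<sigma> z) = (Z - 1)\<^sup>2"
      unfolding sz2 unfolding sz1 unfolding z_def by simp_all
    have "9 * (z\<^sup>2 + (\<sigma> z)\<^sup>2 + (\<sigma> (\<sigma> z))\<^sup>2 - z * \<sigma> z - z * \<sigma> (\<sigma> z) - \<sigma> z * \<sigma> (\<sigma> z)) =
      ((X - 1)\<^sup>2)\<^sup>2 + ((Y - 1)\<^sup>2)\<^sup>2 + ((Z - 1)\<^sup>2)\<^sup>2 - (X - 1)\<^sup>2 * (Y - 1)\<^sup>2 - (X - 1)\<^sup>2 * (Z - 1)\<^sup>2 - (Y - 1)\<^sup>2 * (Z - 1)\<^sup>2"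
      using three by algebra
    also have "\<dots> = 9 * (- (11 + 18 * of_int t))" using rel by algebra
    finally have 1: "z\<^sup>2 + (\<sigma> z)\<^sup>2 + (\<sigma> (\<sigma> z))\<^sup>2 - z * \<sigma> z - z * \<sigma> (\<sigma> z) - \<sigma> z * \<sigma> (\<sigma> z) = - (11 + 18 * of_int t)"
      unfolding mult_left_cancel[OF zero_neq_numeral[symmetric]] .
    have 2: "X\<^sup>2 + (\<sigma> X)\<^sup>2 + (\<sigma> (\<sigma> X))\<^sup>2 - X * \<sigma> X - X * \<sigma> (\<sigma> X) - \<sigma> X * \<sigma> (\<sigma> X) = - 9"
      unfolding sigma_X unfolding sigma_Y using rel(1,2) by algebra
    \<comment> \<open>The form takes the values -(11 + 18t) at z and -9 at X; the multipliers are
      Bezout coefficients: -4(11 + 18t) + 9(5 + 8t) = 1.\<close>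
    show "\<exists>y\<in>R. \<exists>z\<in>R. \<exists>m n :: int.
      of_int m * (y\<^sup>2 + (\<sigma> y)\<^sup>2 + (\<sigma> (\<sigma> y))\<^sup>2 - y * \<sigma> y - y * \<sigma> (\<sigma> y) - \<sigma> y * \<sigma> (\<sigma> y)) +
      of_int n * (z\<^sup>2 + (\<sigma> z)\<^sup>2 + (\<sigma> (\<sigma> z))\<^sup>2 - z * \<sigma> z - z * \<sigma> (\<sigma> z) - \<sigma> z * \<sigma> (\<sigma> z)) = 1"
      by (rule bexI[OF _ zR], rule bexI[OF _ XR], rule exI[of _ 4], rule exI[of _ "- (5 + 8 * t)"],
          unfold 1 2) (simp add: algebra_simps)
  qed
qed

end

section \<open>Square-free parts and fundamental units\<close>

text \<open>Uniqueness behind the definite description: after cancelling the gcd of the square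
  roots, M a^2 = M' b^2 with a, b coprime forces b^2 to divide M and a^2 to divide M'.\<close>

lemma sqfree_part_eq:
  assumes "squarefree M" "r \<ge> 1" "n = M * r\<^sup>2"
  shows "sqfree_part n = M"
  unfolding sqfree_part_def
proof (rule the_equality)
  show "squarefree M \<and> (\<exists>r\<ge>1. n = M * r\<^sup>2)" using assms by blast
  fix M' assume "squarefree M' \<and> (\<exists>r\<ge>1. n = M' * r\<^sup>2)"
  then obtain r' where r': "squarefree M'" "r' \<ge> 1" "n = M' * r'\<^sup>2" by blast
  define g where "g = gcd r r'"
  have g: "g \<noteq> 0" using assms(2) by (simp add: g_def)
  obtain a b where ab: "r = a * g" "r' = b * g" "coprime a b"
    using gcd_coprime_exists[of r r'] g unfolding g_def by blast
  have "g\<^sup>2 * (M * a\<^sup>2) = g\<^sup>2 * (M' * b\<^sup>2)"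
    using trans[OF assms(3)[symmetric] r'(3)] unfolding ab power_mult_distrib by (simp only: mult_ac)
  then have eq: "M * a\<^sup>2 = M' * b\<^sup>2" using g by (metis mult_left_cancel power_not_zero)
  have "coprime (a\<^sup>2) (b\<^sup>2)" using ab(3) by simp
  then have "b\<^sup>2 dvd M" "a\<^sup>2 dvd M'"
    using eq by (metis coprime_commute coprime_dvd_mult_left_iff dvd_triv_right)+
  then have "is_unit a" "is_unit b" using assms(1) r'(1) by (auto simp: squarefree_def)
  then have "a\<^sup>2 = 1" "b\<^sup>2 = 1" by (auto simp: power2_eq_1_iff abs_if split: if_splits)
  then show "M' = M" using eq by simp
qed

lemma sqfree_part_decompose:
  assumes "n \<noteq> 0"
  obtains r where "squarefree (sqfree_part n)" "r \<ge> 1" "n = sqfree_part n * r\<^sup>2"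
proof -
  have n: "n = squarefree_part n * (square_part n)\<^sup>2" by (rule squarefree_decompose)
  have "square_part n \<ge> 0" using normalize_square_part[of n] by (metis abs_ge_zero normalize_int_def)
  moreover have "square_part n \<noteq> 0" using assms by simp
  ultimately have r: "square_part n \<ge> 1" by linarith
  have "sqfree_part n = squarefree_part n" by (rule sqfree_part_eq[OF _ r n]) blast
  then show ?thesis using that[of "square_part n"] n r by auto
qed

text \<open>For |T| \<ge> 3 the number T^2 - 4 lies strictly above (|T| - 1)^2 and T^2 + 4 strictly
  below (|T| + 1)^2. Hence the square-free part is not 1.\<close>

lemma norm_discriminant_not_square:
  assumes "s = 1 \<or> s = (- 1 :: int)" "\<bar>T\<bar> \<ge> 3"
  shows "T\<^sup>2 - 4 * s \<noteq> r\<^sup>2"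
proof
  assume e: "T\<^sup>2 - 4 * s = r\<^sup>2"
  define a b where "a = \<bar>T\<bar>" and "b = \<bar>r\<bar>"
  have ab: "a \<ge> 3" "b \<ge> 0" "a * a - 4 * s = b * b"
    using assms e by (auto simp: a_def b_def power2_eq_square)
  show False
  proof (cases "s = 1")
    case True
    then have "b < a" using ab by (intro power_less_imp_less_base[of b 2 a]) (auto simp: power2_eq_square)
    then have "b * b \<le> (a - 1) * (a - 1)" using ab by (intro mult_mono) auto
    then show False using ab True by (simp add: algebra_simps)
  next
    case False
    then have s: "s = - 1" using assms by simp
    then have "a < b" using ab by (intro power_less_imp_less_base[of a 2 b]) (auto simp: power2_eq_square)
    then have "(a + 1) * (a + 1) \<le> b * b" using ab by (intro mult_mono) auto
    then show False using ab s by (simp add: algebra_simps)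
  qed
qed

text \<open>T may be negative here, so that T congruent to 5 modulo 9 can be treated through -T. The
  residue of T modulo 3 keeps 3 from dividing T^2 - 4s, and hence M.\<close>

lemma three_dvd_class_number_mirror:
  fixes T s t :: int
  assumes s: "s = 1 \<or> s = - 1" and T: "\<bar>T\<bar> \<ge> 3"
    and cases: "T = 9 * t \<or> (s = - 1 \<and> T = 4 + 9 * t)"
    and no_root: "\<And>y::int. y ^ 3 \<noteq> 3 * s * y + T"
  shows "3 dvd class_number (- 3 * sqfree_part (T\<^sup>2 - 4 * s))"
proof -
  define M where "M = sqfree_part (T\<^sup>2 - 4 * s)"
  have "3\<^sup>2 \<le> \<bar>T\<bar>\<^sup>2" using T by (intro power_mono) auto
  then have pos: "T\<^sup>2 - 4 * s > 0" using s by auto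
  obtain r where r: "squarefree M" "r \<ge> 1" "T\<^sup>2 - 4 * s = M * r\<^sup>2"
    using sqfree_part_decompose[of "T\<^sup>2 - 4 * s"] pos unfolding M_def by auto
  have "M > 0" using pos r by (metis zero_less_mult_pos2 zero_less_power zero_less_one order_less_le_trans)
  moreover have "M \<noteq> 1" using norm_discriminant_not_square[OF s T, of r] r(3) by auto
  ultimately have M2: "M \<ge> 2" by simp
  have M3: "\<not> 3 dvd M"
  proof
    assume "3 dvd M"
    then have d: "3 dvd T\<^sup>2 - 4 * s" unfolding r(3) by simp
    from cases show False
    proof
      assume "T = 9 * t"
      then have "T\<^sup>2 - 4 * s = 3 * (27 * t\<^sup>2 - s) - s" by (simp add: power2_eq_square)
      moreover have "\<not> (3::int) dvd 3 * k - s" for k using s by presburger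
      ultimately show False using d by metis
    next
      assume "s = - 1 \<and> T = 4 + 9 * t"
      then have "T\<^sup>2 - 4 * s = 3 * (27 * t\<^sup>2 + 24 * t + 6) + 2" by (simp add: power2_eq_square algebra_simps)
      moreover have "\<not> (3::int) dvd 3 * k + 2" for k by presburger
      ultimately show False using d by metis
    qed
  qed
  interpret mirror_cubic s T M r
    by (rule mirror_cubic.intro[OF s r(3,2,1) M2 M3 no_root])
  have "3 dvd class_number (- 3 * M)"
    using cases three_dvd_class_number_0 three_dvd_class_number_4 unfolding d_def by blast
  then show ?thesis by (simp only: M_def)
qed

section \<open>Real quadratic units as powers of the fundamental unit\<close>

context quad_number_field
begin

lemma unit_minimal_polynomial:
  assumes "is_unit_in d z"
  shows "\<exists>t n::int. (n = 1 \<or> n = - 1) \<and> z\<^sup>2 - of_int t * z + of_int n = 0"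
proof -
  obtain w where zw: "z \<in> OF" "w \<in> OF" "z * w = 1" using assms by (auto simp: is_unit_in_def)
  obtain a b t n where ab: "a \<in> \<rat>" "b \<in> \<rat>" "z = a + b * S" "2 * a = of_int t"
    "a\<^sup>2 - b\<^sup>2 * of_int d = of_int n" using quad_intsE[OF zw(1)] by metis
  obtain a' b' n' where ab': "a' \<in> \<rat>" "b' \<in> \<rat>" "w = a' + b' * S"
    "a'\<^sup>2 - b'\<^sup>2 * of_int d = of_int n'" using quad_intsE[OF zw(2)] by metis
  have "(a * a' + b * b' * of_int d) + (a * b' + a' * b) * S = 1 + 0 * S"
    using zw(3) S_square unfolding ab(3) ab'(3) by algebra
  then have e: "a * a' + b * b' * of_int d = 1" "a * b' + a' * b = 0"
    using rational_S_unique[of "a * a' + b * b' * of_int d" "a * b' + a' * b" 1 0] ab(1,2) ab'(1,2)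
    by (blast intro: Rats_add Rats_mult Rats_of_int Rats_0 Rats_1)+
  have "(a\<^sup>2 - b\<^sup>2 * of_int d) * (a'\<^sup>2 - b'\<^sup>2 * of_int d) = 1"
    using e by algebra
  then have "complex_of_int (n * n') = of_int 1" unfolding ab(5) ab'(4) by simp
  then have "n * n' = 1" by (simp only: of_int_eq_iff)
  then have "n = 1 \<or> n = - 1" by (auto simp: zmult_eq_1_iff)
  moreover have "z\<^sup>2 - of_int t * z + of_int n = 0"
    unfolding ab(3) ab(4)[symmetric] ab(5)[symmetric] S_square[symmetric]
    by (simp add: power2_eq_square algebra_simps)
  ultimately show ?thesis by blast
qed

lemma unit_divide:
  assumes "is_unit_in d z" "is_unit_in d w"
  shows "is_unit_in d (z / w)"
proof -
  interpret O: csubring OF by (rule csubring_OF)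
  obtain z' w' where "z \<in> OF" "z' \<in> OF" "z * z' = 1" "w \<in> OF" "w' \<in> OF" "w * w' = 1"
    using assms by (auto simp: is_unit_in_def)
  moreover from this have "z / w = z * w'" by (simp add: divide_inverse inverse_unique)
  ultimately show ?thesis unfolding is_unit_in_def
    by (auto intro!: O.mult_closed bexI[of _ "z' * w"] simp: mult_ac)
qed

lemma unit_divide_power: "is_unit_in d z \<Longrightarrow> is_unit_in d w \<Longrightarrow> is_unit_in d (z / w ^ k)"
proof (induction k)
  case (Suc k)
  then show ?case using unit_divide[of "z / w ^ k" w] by (simp add: mult.commute)
qed simp

definition big_units :: "real set" where
  "big_units = {u. u > 1 \<and> is_unit_in d (of_real u)}"

text \<open>A unit u > 1 has trace u + n/u with n = 1 or -1, so only finitely many quadratic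
  equations occur.\<close>

lemma finite_bounded_units: "finite {u \<in> big_units. u \<le> B}"
proof (rule finite_subset)
  let ?K = "{- \<lceil>B + 1\<rceil>..\<lceil>B + 1\<rceil>} \<times> {-1, 1}"
  show "finite (\<Union>(t,n)\<in>?K. {z. poly [:of_int n, - of_int t, 1:] z = (0::real)})"
    by (intro finite_UN_I) (auto intro!: poly_roots_finite simp del: poly_pCons)
  show "{u \<in> big_units. u \<le> B} \<subseteq> (\<Union>(t,n)\<in>?K. {z. poly [:of_int n, - of_int t, 1:] z = (0::real)})"
  proof clarify
    fix u assume "u \<in> big_units" and B: "u \<le> B"
    then have u: "u > 1" "is_unit_in d (of_real u)" by (auto simp: big_units_def)
    obtain t n :: int where tn: "n = 1 \<or> n = - 1" "(of_real u)\<^sup>2 - of_int t * of_real u + of_int n = (0::complex)"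
      using unit_minimal_polynomial[OF u(2)] by blast
    have "complex_of_real (u\<^sup>2 - of_int t * u + of_int n) = of_real 0" using tn(2) by simp
    then have e: "u\<^sup>2 - of_int t * u + of_int n = 0" by (simp only: of_real_eq_iff)
    then have "of_int t = u + of_int n / u" using u(1) by (simp add: field_simps power2_eq_square)
    moreover have "\<bar>of_int n / u\<bar> \<le> 1" using tn(1) u(1) by auto
    ultimately have "\<bar>real_of_int t\<bar> \<le> B + 1" using u(1) B by linarith
    then have "(t, n) \<in> ?K" using tn(1) by (auto simp: le_ceiling_iff ceiling_le_iff) linarith+
    moreover have "poly [:of_int n, - of_int t, 1:] u = 0" using e by (simp add: algebra_simps power2_eq_square)
    ultimately show "u \<in> (\<Union>(t,n)\<in>?K. {z. poly [:of_int n, - of_int t, 1:] z = (0::real)})" by blast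
  qed
qed

text \<open>The given u makes the set of units in (1, u] nonempty, and that set is finite, so its
  minimum exists and is the fundamental unit; no separate existence proof for units is
  required.\<close>

lemma unit_eq_fund_unit_power:
  assumes u: "u > 1" "is_unit_in d (of_real u)"
  shows "\<exists>k::nat. u = fund_unit d ^ k"
proof -
  let ?A = "{v \<in> big_units. v \<le> u}"
  have uA: "u \<in> ?A" using u by (simp add: big_units_def)
  define e where "e = Min ?A"
  have eA: "e \<in> ?A" unfolding e_def using finite_bounded_units uA by (intro Min_in) auto
  have le: "e \<le> v" if "v \<in> big_units" for v
  proof (cases "v \<le> u")
    case True
    then show ?thesis unfolding e_def using that finite_bounded_units by (intro Min_le) auto
  qed (use eA in auto)
  have e: "e > 1" "is_unit_in d (of_real e)" using eA by (auto simp: big_units_def)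
  have f: "fund_unit d = e"
    unfolding fund_unit_def
  proof (rule the_equality)
    show "e > 1 \<and> is_unit_in d (of_real e) \<and> (\<forall>u. u > 1 \<and> is_unit_in d (of_real u) \<longrightarrow> e \<le> u)"
      using e le by (auto simp: big_units_def)
    show "e' = e" if "e' > 1 \<and> is_unit_in d (of_real e') \<and> (\<forall>u. u > 1 \<and> is_unit_in d (of_real u) \<longrightarrow> e' \<le> u)" for e'
      using that e le[of e'] by (force simp: big_units_def)
  qed
  \<comment> \<open>With k = j + 1 this gives e^j \<le> u < e^(j+1); the unit u/e^j in [1, e) must
    be 1 by minimality.\<close>
  define k where "k = (LEAST k. u < e ^ k)"
  have "\<exists>k. u < e ^ k" using real_arch_pow[OF e(1)] by blast
  then have k: "u < e ^ k" unfolding k_def by (rule LeastI_ex)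
  have "k \<noteq> 0" using k u(1) by (intro notI) simp
  then obtain j where j: "k = Suc j" by (cases k) auto
  have "\<not> u < e ^ j" using not_less_Least[of j "\<lambda>k. u < e ^ k"] j unfolding k_def by simp
  then have 1: "u / e ^ j \<ge> 1" using e(1) by (simp add: field_simps)
  have 2: "u / e ^ j < e" using k j e(1) by (simp add: field_simps)
  have "is_unit_in d (of_real (u / e ^ j))" using unit_divide_power[OF u(2) e(2), of j] by simp
  then have "\<not> u / e ^ j > 1" using 2 le[of "u / e ^ j"] unfolding big_units_def by auto
  then have "u / e ^ j = 1" using 1 by (intro order_antisym) (simp_all only: not_less)
  moreover have "e ^ j \<noteq> 0" using e(1) by simp
  ultimately have "u = e ^ j" by (simp only: divide_eq_1_iff)
  then show ?thesis using f by blast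
qed

end

text \<open>The square root of y^2 - 4s lies in Q(sqrt M), because (y^2 - 4s)(y^2 - s)^2 = T^2 - 4s
  = M r^2. Hence \<theta> = (y + sqrt(y^2 - 4s))/2 is a unit of norm s, a power of the fundamental
  unit, and its cube is E_s(T).\<close>

lemma root_imp_fund_unit_cube:
  fixes T s y :: int
  assumes s: "s = 1 \<or> s = - 1" and T: "T \<ge> 3" and root: "y ^ 3 = 3 * s * y + T"
  shows "\<exists>k::int. (real_of_int T + sqrt (real_of_int (T\<^sup>2 - 4 * s))) / 2 = fund_unit (sqfree_part (T\<^sup>2 - 4 * s)) powi (3 * k)"
proof -
  define M where "M = sqfree_part (T\<^sup>2 - 4 * s)"
  have "3\<^sup>2 \<le> T\<^sup>2" using T by (intro power_mono) auto
  then have pos: "T\<^sup>2 - 4 * s > 0" using s by auto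
  obtain r where r: "squarefree M" "r \<ge> 1" "T\<^sup>2 - 4 * s = M * r\<^sup>2"
    using sqfree_part_decompose[of "T\<^sup>2 - 4 * s"] pos unfolding M_def by auto
  have M0: "M > 0" using pos r by (metis zero_less_mult_pos2 zero_less_power zero_less_one order_less_le_trans)
  have M1: "M \<noteq> 1" using norm_discriminant_not_square[OF s, of T r] T r(3) by auto
  interpret quad_number_field M using r(1) M1 by unfold_locales
  have prod: "y * (y * y - 3 * s) = T" using root by (simp add: power3_eq_cube algebra_simps)
  \<comment> \<open>Positivity of T forces y to be positive, and for s = 1 the small values are
    excluded by T \<ge> 3; this makes the square root real and \<theta> > 1.\<close>
  have y: "y \<ge> 1 \<and> (s = 1 \<longrightarrow> y \<ge> 3)"
  proof (cases "s = 1")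
    case True
    have "y \<ge> 3"
    proof (rule ccontr)
      assume "\<not> y \<ge> 3"
      then consider "y \<le> - 2" | "y = - 1" | "y = 0" | "y = 1" | "y = 2" by linarith
      then show False
      proof cases
        case 1
        then have "4 \<le> y * y" using mult_mono[of 2 "- y" 2 "- y"] by simp
        then have "y * (y * y - 3 * s) \<le> 0" using 1 True by (intro mult_nonpos_nonneg) auto
        then show False using prod T by simp
      qed (use prod T True in auto)
    qed
    then show ?thesis by simp
  next
    case False
    then have s1: "s = - 1" using s by simp
    have "y \<ge> 1"
    proof (rule ccontr)
      assume "\<not> y \<ge> 1"
      then have "y * (y * y - 3 * s) \<le> 0" using s1 by (intro mult_nonpos_nonneg) auto
      then show False using prod T by simp
    qed
    then show ?thesis using False by simp
  qed
  have ys: "y * y - s > 0" "y * y - 4 * s > 0"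
  proof -
    have "1 \<le> y * y" using mult_mono[of 1 y 1 y] y by simp
    moreover have "s = 1 \<Longrightarrow> 9 \<le> y * y" using mult_mono[of 3 y 3 y] y by simp
    ultimately show "y * y - s > 0" "y * y - 4 * s > 0" using s by auto
  qed
  define \<rho> where "\<rho> = sqrt (real_of_int (y * y - 4 * s))"
  define c where "c = real_of_int (y * y - s)"
  have c0: "c > 0" unfolding c_def of_int_0_less_iff by (rule ys(1))
  have \<rho>: "\<rho> \<ge> 0" "\<rho> * \<rho> = of_int y * of_int y - 4 * of_int s" 
  proof -
    have "0 < real_of_int (y * y - 4 * s)" unfolding of_int_0_less_iff by (rule ys(2))
    then show "\<rho> \<ge> 0" "\<rho> * \<rho> = of_int y * of_int y - 4 * of_int s"
      by (auto simp: \<rho>_def simp flip: power2_eq_square)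
  qed
  have ss: "s * s = 1" using s by auto
  have key: "(y * y - 4 * s) * (y * y - s)\<^sup>2 = T\<^sup>2 - 4 * s"
    using root ss by algebra
  have sq: "sqrt (real_of_int (T\<^sup>2 - 4 * s)) = \<rho> * c"
    unfolding key[symmetric] \<rho>_def using c0 unfolding c_def
    by (simp only: of_int_mult of_int_power real_sqrt_mult real_sqrt_abs abs_of_pos)
  have sq': "\<rho> * c = sqrt (real_of_int M) * of_int r"
    unfolding sq[symmetric] r(3) using r(2) by (simp add: real_sqrt_mult)
  define \<theta> where "\<theta> = (of_int y + \<rho>) / 2"
  have cube: "\<theta> ^ 3 = (real_of_int T + sqrt (real_of_int (T\<^sup>2 - 4 * s))) / 2"
  proof -
    have T': "real_of_int T = of_int y ^ 3 - 3 * of_int s * of_int y"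
      using arg_cong[OF root, of real_of_int] by simp
    have "8 * \<theta> ^ 3 = (2 * \<theta>) ^ 3" by (simp add: power_mult_distrib)
    also have "\<dots> = 4 * (real_of_int T + \<rho> * c)"
      unfolding T' using \<rho>(2) by (simp add: \<theta>_def c_def) algebra
    finally show ?thesis unfolding sq by simp
  qed
  have \<theta>1: "\<theta> > 1"
  proof (cases "s = 1")
    case True
    then have "real_of_int y \<ge> 3" using y by simp
    then show ?thesis using \<rho>(1) by (simp add: \<theta>_def)
  next
    case False
    then have "s = - 1" using s by simp
    then have "1 < \<rho>" unfolding \<rho>_def by (simp add: add_pos_nonneg)
    then show ?thesis using y by (simp add: \<theta>_def)
  qed
  have S: "S = of_real (sqrt (real_of_int M))"
    unfolding S_def using M0 csqrt_of_real_nonneg[of "of_int M"] by simp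
  \<comment> \<open>Coordinates of \<theta>: the square root of y^2 - 4s equals r sqrt(M) / (y^2 -
    s).\<close>
  define a b where "a = of_int y / (2::complex)" and "b = of_int r / (2 * (of_int y * of_int y - of_int s) :: complex)"
  have ab: "a \<in> \<rat>" "b \<in> \<rat>" by (auto simp: a_def b_def intro!: Rats_divide Rats_mult Rats_diff)
  have bS: "b * S = of_real (\<rho> / 2)"
  proof -
    have "b = of_real (of_int r / (2 * c))" by (simp add: b_def c_def)
    then have "b * S = of_real (sqrt (real_of_int M) * of_int r / (2 * c))" by (simp add: S)
    also have "sqrt (real_of_int M) * of_int r / (2 * c) = \<rho> / 2" unfolding sq'[symmetric] using c0 by simp
    finally show ?thesis .
  qed
  have \<theta>_eq: "of_real \<theta> = a + b * S" unfolding bS by (simp add: \<theta>_def a_def add_divide_distrib)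
  have norm: "a\<^sup>2 - b\<^sup>2 * of_int M = of_int s"
  proof -
    have "b\<^sup>2 * of_int M = (b * S) * (b * S)" unfolding S_square[symmetric] by (simp add: power2_eq_square mult_ac)
    also have "\<dots> = of_real (\<rho> * \<rho> / 4)" unfolding bS by simp
    also have "\<dots> = (of_int y * of_int y - 4 * of_int s) / 4" unfolding \<rho>(2) by simp
    finally show ?thesis by (simp add: a_def power2_eq_square diff_divide_distrib)
  qed
  have "is_unit_in M (of_real \<theta>)"
    unfolding is_unit_in_def
  proof (intro conjI bexI)
    show "of_real \<theta> \<in> OF" unfolding \<theta>_eq
      by (rule quad_intsI[OF ab _ norm, of y]) (simp add: a_def)
    \<comment> \<open>The inverse of a unit of norm s is s times its conjugate.\<close>
    have "of_int s * a + (- (of_int s * b)) * S \<in> OF"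
    proof (rule quad_intsI)
      show "of_int s * a \<in> \<rat>" "- (of_int s * b) \<in> \<rat>" using ab by auto
      show "2 * (of_int s * a) = of_int (s * y)" by (simp add: a_def)
      have "(of_int s * a)\<^sup>2 - (- (of_int s * b))\<^sup>2 * of_int M = (of_int s)\<^sup>2 * (a\<^sup>2 - b\<^sup>2 * of_int M)"
        by (simp add: power_mult_distrib algebra_simps)
      also have "\<dots> = of_int (s ^ 3)" unfolding norm by (simp add: power2_eq_square power3_eq_cube)
      finally show "(of_int s * a)\<^sup>2 - (- (of_int s * b))\<^sup>2 * of_int M = of_int (s ^ 3)" .
    qed
    then show "of_int s * (a - b * S) \<in> OF" by (simp add: algebra_simps)
    have "of_real \<theta> * (of_int s * (a - b * S)) = of_int s * (a\<^sup>2 - b\<^sup>2 * of_int M)"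
      unfolding \<theta>_eq S_square[symmetric] by (simp add: power2_eq_square algebra_simps)
    also have "\<dots> = 1" unfolding norm using ss by (metis of_int_1 of_int_mult)
    finally show "of_real \<theta> * (of_int s * (a - b * S)) = 1" .
  qed
  then obtain k :: nat where k: "\<theta> = fund_unit M ^ k" using unit_eq_fund_unit_power[OF \<theta>1] by blast
  have "fund_unit M powi (3 * int k) = fund_unit M ^ (3 * k)"
    by (metis of_nat_mult of_nat_numeral power_int_of_nat)
  also have "\<dots> = \<theta> ^ 3" by (simp add: k power_mult[symmetric] mult.commute)
  finally show ?thesis unfolding cube M_def[symmetric] by metis
qed

text \<open>(18u)^2 - 4s = 4(81u^2 - s), so T = 18u leads to the same square-free part, with T
  divisible by 9. A root is excluded modulo 7, where 18 is 4.\<close>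

lemma three_dvd_class_number_no_root_mod7:
  fixes s u :: int
  assumes s: "s = 1 \<or> s = - 1" and u: "u \<ge> 1"
    and no_root: "\<And>i. i \<in> {0..6} \<Longrightarrow> i ^ 3 mod 7 \<noteq> (3 * s * i + 4 * (u mod 7)) mod 7"
  shows "3 dvd class_number (- 3 * sqfree_part (81 * u\<^sup>2 - s))"
proof -
  have n: "81 * u\<^sup>2 - s > 0"
  proof -
    have "1\<^sup>2 \<le> u\<^sup>2" using u by (intro power_mono) auto
    then show ?thesis using s by auto
  qed
  obtain r where r: "squarefree (sqfree_part (81 * u\<^sup>2 - s))" "r \<ge> 1"
    "81 * u\<^sup>2 - s = sqfree_part (81 * u\<^sup>2 - s) * r\<^sup>2"
    using sqfree_part_decompose[of "81 * u\<^sup>2 - s"] n by auto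
  have "(18 * u)\<^sup>2 - 4 * s = 4 * (81 * u\<^sup>2 - s)" by (simp add: power2_eq_square)
  also have "\<dots> = 4 * (sqfree_part (81 * u\<^sup>2 - s) * r\<^sup>2)" using r(3) by simp
  also have "\<dots> = sqfree_part (81 * u\<^sup>2 - s) * (2 * r)\<^sup>2" by (simp add: power2_eq_square)
  finally have eq: "sqfree_part ((18 * u)\<^sup>2 - 4 * s) = sqfree_part (81 * u\<^sup>2 - s)"
    using r(1,2) by (intro sqfree_part_eq[of _ "2 * r"]) auto
  have "3 dvd class_number (- 3 * sqfree_part ((18 * u)\<^sup>2 - 4 * s))"
  proof (rule three_dvd_class_number_mirror[OF s, of _ "2 * u"])
    show "y ^ 3 \<noteq> 3 * s * y + 18 * u" for y
    proof
      assume "y ^ 3 = 3 * s * y + 18 * u"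
      then have "y ^ 3 mod 7 = (3 * s * y + 18 * u) mod 7" by simp
      then have "(y mod 7) ^ 3 mod 7 = (3 * s * (y mod 7) + 18 * (u mod 7)) mod 7"
        by (simp only: power_mod) (intro mod_add_cong; simp only: mod_mult_right_eq)
      moreover have "3 * s * (y mod 7) + 18 * (u mod 7) = (3 * s * (y mod 7) + 4 * (u mod 7)) + 7 * (2 * (u mod 7))"
        by simp
      then have "(3 * s * (y mod 7) + 18 * (u mod 7)) mod 7 = (3 * s * (y mod 7) + 4 * (u mod 7)) mod 7"
        by (metis mod_mult_self2)
      ultimately show False using no_root[of "y mod 7"] by auto
    qed
  qed (use u in auto)
  then show ?thesis unfolding eq .
qed

theorem theorem7p1:
  fixes t0 t s :: int
  assumes "t0 \<in> {0, 4, 5}" and "t \<ge> 1"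
    and "t0 \<in> {4, 5} \<Longrightarrow> s = -1"
    and "t0 = 0 \<Longrightarrow> s \<in> {-1, 1}"
  shows "(let T = t0 + 9 * t;
              M = sqfree_part (T^2 - 4 * s);
              E = (real_of_int T + sqrt (real_of_int (T^2 - 4 * s))) / 2
          in \<not> (\<exists>k::int. E = fund_unit M powi (3 * k))
             \<longrightarrow> 3 dvd class_number (-3 * M))
    \<and> (\<forall>u::int. u \<ge> 1 \<and> (u mod 7 = 2 \<or> u mod 7 = 5)
          \<longrightarrow> 3 dvd class_number (-3 * sqfree_part (81 * u^2 - 1)))
    \<and> (\<forall>u::int. u \<ge> 1 \<and> (u mod 7 = 3 \<or> u mod 7 = 4)
          \<longrightarrow> 3 dvd class_number (-3 * sqfree_part (81 * u^2 + 1)))"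
proof (intro conjI allI impI)
  define T where "T = t0 + 9 * t"
  have s: "s = 1 \<or> s = - 1" using assms by auto
  have T: "T \<ge> 3" using assms by (auto simp: T_def)
  have "3 dvd class_number (- 3 * sqfree_part (T\<^sup>2 - 4 * s))"
    if E: "\<not> (\<exists>k::int. (real_of_int T + sqrt (real_of_int (T\<^sup>2 - 4 * s))) / 2
      = fund_unit (sqfree_part (T\<^sup>2 - 4 * s)) powi (3 * k))"
  proof -
    have nr: "y ^ 3 \<noteq> 3 * s * y + T" for y
      using root_imp_fund_unit_cube[OF s T] E by blast
    show ?thesis
    proof (cases "t0 = 5")
      case True
      \<comment> \<open>Changing the signs of T and y preserves T^2 - 4s and the absence of roots,
        and -5 - 9t = 4 + 9(-t - 1).\<close>
      have "3 dvd class_number (- 3 * sqfree_part ((- T)\<^sup>2 - 4 * s))"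
      proof (rule three_dvd_class_number_mirror[OF s, of _ "- t - 1"])
        show "y ^ 3 \<noteq> 3 * s * y + - T" for y using nr[of "- y"] by auto
      qed (use T True assms in \<open>auto simp: T_def\<close>)
      then show ?thesis by simp
    next
      case False
      show ?thesis
        by (rule three_dvd_class_number_mirror[OF s, of _ t])
          (use T False assms nr in \<open>auto simp: T_def\<close>)
    qed
  qed
  then show "let T = t0 + 9 * t; M = sqfree_part (T^2 - 4 * s);
              E = (real_of_int T + sqrt (real_of_int (T^2 - 4 * s))) / 2
          in \<not> (\<exists>k::int. E = fund_unit M powi (3 * k)) \<longrightarrow> 3 dvd class_number (-3 * M)"
    unfolding Let_def T_def by blast
next
  have I: "{0..6::int} = {0, 1, 2, 3, 4, 5, 6}" by auto
  fix u :: int assume u: "u \<ge> 1 \<and> (u mod 7 = 2 \<or> u mod 7 = 5)"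
  show "3 dvd class_number (-3 * sqfree_part (81 * u^2 - 1))"
    by (rule three_dvd_class_number_no_root_mod7[of 1 u]) (use u in \<open>auto simp: I\<close>)
next
  have I: "{0..6::int} = {0, 1, 2, 3, 4, 5, 6}" by auto
  fix u :: int assume u: "u \<ge> 1 \<and> (u mod 7 = 3 \<or> u mod 7 = 4)"
  have "3 dvd class_number (-3 * sqfree_part (81 * u^2 - (- 1)))"
    by (rule three_dvd_class_number_no_root_mod7) (use u in \<open>auto simp: I\<close>)
  then show "3 dvd class_number (-3 * sqfree_part (81 * u^2 + 1))" by simp
qed

end
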